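(* Let $\hat r^*$ (with cutoff $c^*$) be the optimal reward program, i.e. the solution of $$\underset{\hat r\in L^\infty(\mathbb{R};[0,p]),\ c\in\mathbb{R}}{\text{maximize}}\ \ \mathbb{E}_v\Big[(p-\hat r(v))\,\Phi\Big(\frac{v-c}{\sigma_\epsilon}\Big)\Big]$$ subject to $$\mathbb{E}_{v|v_i}[\hat r(v)]+v_i-p\ge 0\ \text{ for all } v_i\ge c,\qquad \mathbb{E}_{v|v_i}[\hat r(v)]+v_i-p\le 0\ \text{ for all } v_i\le c .$$ Then $\hat r^*$ is a "full-refund or nothing" policy of the form $$\hat r^*(v)=p\times\sum_{j=1}^{l}\mathbf{1}\{w_L^j\le v\le w_H^j\},$$ where the finitely many intervals $[w_L^j,w_H^j]$, $j=1,\dots,l$, identify the qualities eligible for a refund. Moreover, fixing the total uncertainty $\sigma^2=\sigma_\theta^2+\sigma_\epsilon^2$ (and $\theta$), as $\sigma_\epsilon\to 0$: (i) the number $l$ of refund-eligible intervals in the optimal reward program tends to infinity; more precisely, $\frac{1}{\sigma_\epsilon}=\mathcal{O}(l)$, or equivalently $l=\Omega(\frac{1}{\sigma_\epsilon})$; (ii) for any fixed $l$, the expected profit resulting from the optimal reward program with $l$ full-refund intervals approaches that of the no-reward case, $p\,\Phi\big(\frac{\theta-p}{\sigma}\big)$.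
   Context: Parameters: $\theta\in\mathbb{R}$, $\sigma_\theta>0$, $\sigma_\epsilon>0$, $\sigma=\sqrt{\sigma_\theta^2+\sigma_\epsilon^2}$. $\Phi$ and $\phi$ are the CDF and PDF of the standard normal distribution. The quality $v$ of a product has prior $v\sim N(\theta,\sigma_\theta^2)$; $\mathbb{E}_v$ is expectation under this prior. Consumers $i\in[0,1]$ have valuations $v_i=v+\epsilon_i$ with $\epsilon_i\sim N(0,\sigma_\epsilon^2)$ independent of $v$, so that $v\,|\,v_i\sim N(\tau v_i+(1-\tau)\theta,\sigma_v^2)$ with $\tau=\frac{\sigma_\theta^2}{\sigma_\epsilon^2+\sigma_\theta^2}$ and $\sigma_v^2=\frac{\sigma_\epsilon^2\sigma_\theta^2}{\sigma_\epsilon^2+\sigma_\theta^2}$; $\mathbb{E}_{v|v_i}$ is expectation under this posterior. Standing assumption: the market price $p>0$ maximizes $p\mapsto p\,\Phi(\frac{\theta-p}{\sigma})$, i.e. it is the unique solution of $\frac{p}{\sigma}=\Phi(\frac{\theta-p}{\sigma})/\phi(\frac{\theta-p}{\sigma})$ (so $p$ depends only on $\theta$ and $\sigma$). $L^\infty(\mathbb{R};[0,p])$ is the space of measurable functions $\mathbb{R}\to[0,p]$ (up to a.e. equality). $\hat r(v)$ is the rebate paid to each buyer when the realized quality is $v$; $c$ is the cutoff of the equilibrium purchase strategy (consumer $i$ buys iff $v_i>c$), the constraints express that this strategy is an equilibrium, and the objective is the seller's expected profit. The no-reward case is $\hat r\equiv0$, $c=p$, with expected profit $p\,\Phi(\frac{\theta-p}{\sigma})$.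 The left endpoint $w_L^1=-\infty$ is allowed, so a refund interval may be unbounded to the left. In (ii), "the optimal reward program with $l$ full-refund intervals" means the maximizer of the same objective under the same constraints, with $\hat r$ restricted to functions of the form $p\sum_{j=1}^{l}\mathbf{1}\{w_L^j\le v\le w_H^j\}$ with disjoint intervals. *)

theory Defs
  imports "HOL-Probability.Probability" "HOL-Library.Landau_Symbols"
begin

abbreviation normal_distribution :: "real \<Rightarrow> real \<Rightarrow> real measure" where
  "normal_distribution m s \<equiv> density lborel (normal_density m s)"

definition Phi :: "real \<Rightarrow> real" where
  "Phi = cdf std_normal_distribution"

definition no_reward_profit :: "real \<Rightarrow> real \<Rightarrow> real \<Rightarrow> real" where
  "no_reward_profit \<theta> \<sigma> p = p * Phi ((\<theta> - p) / \<sigma>)"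

definition market_price :: "real \<Rightarrow> real \<Rightarrow> real \<Rightarrow> bool" where
  "market_price \<theta> \<sigma> p \<longleftrightarrow> p > 0 \<and> is_arg_max (no_reward_profit \<theta> \<sigma>) (\<lambda>q. q > 0) p"

text \<open>
  In the following, \<open>st\<close> and \<open>se\<close> are the standard deviations of the prior and of the
  idiosyncratic noise. The posterior of the quality given the valuation \<open>x\<close> of a consumer
  is normal with the mean and variance of the usual Gaussian updating formula.
\<close>

definition posterior :: "real \<Rightarrow> real \<Rightarrow> real \<Rightarrow> real \<Rightarrow> real measure" where
  "posterior \<theta> st se x =
     (let \<tau> = st\<^sup>2 / (se\<^sup>2 + st\<^sup>2)
      in normal_distribution (\<tau> * x + (1 - \<tau>) * \<theta>) (sqrt (se\<^sup>2 * st\<^sup>2 / (se\<^sup>2 + st\<^sup>2))))"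

definition expected_profit ::
  "real \<Rightarrow> real \<Rightarrow> real \<Rightarrow> real \<Rightarrow> (real \<Rightarrow> real) \<times> real \<Rightarrow> real" where
  "expected_profit \<theta> st se p = (\<lambda>(r, c).
     LINT v | normal_distribution \<theta> st. (p - r v) * Phi ((v - c) / se))"

definition buyer_surplus ::
  "real \<Rightarrow> real \<Rightarrow> real \<Rightarrow> real \<Rightarrow> (real \<Rightarrow> real) \<Rightarrow> real \<Rightarrow> real" where
  "buyer_surplus \<theta> st se p r x = (LINT v | posterior \<theta> st se x. r v) + x - p"

text \<open>
  Elements of \<open>L\<^sup>\<infinity>(\<real>; [0,p])\<close> are represented by Borel functions with values in \<open>[0,p]\<close>;
  statements about such a function are made only up to almost everywhere equality.
\<close>

definition feasible ::
  "real \<Rightarrow> real \<Rightarrow> real \<Rightarrow> real \<Rightarrow> (real \<Rightarrow> real) \<times> real \<Rightarrow> bool" where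
  "feasible \<theta> st se p = (\<lambda>(r, c).
     r \<in> borel_measurable borel \<and> (\<forall>v. r v \<in> {0..p}) \<and>
     (\<forall>x\<ge>c. buyer_surplus \<theta> st se p r x \<ge> 0) \<and>
     (\<forall>x\<le>c. buyer_surplus \<theta> st se p r x \<le> 0))"

definition optimal_program ::
  "real \<Rightarrow> real \<Rightarrow> real \<Rightarrow> real \<Rightarrow> (real \<Rightarrow> real) \<times> real \<Rightarrow> bool" where
  "optimal_program \<theta> st se p rc \<longleftrightarrow>
     is_arg_max (expected_profit \<theta> st se p) (feasible \<theta> st se p) rc"

text \<open>
  The intervals are listed from left to right, so disjointness means that each one ends
  strictly before the next one starts, and only \<open>wL 1\<close> can be \<open>-\<infinity>\<close>. Since \<open>wL j = wH j\<close> is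
  not excluded, a function that has this form with \<open>l\<close> intervals also has it with more than \<open>l\<close>:
  effectively, the number of nondegenerate intervals is at most \<open>l\<close>.
\<close>

definition full_refund_or_nothing :: "real \<Rightarrow> nat \<Rightarrow> (real \<Rightarrow> real) \<Rightarrow> bool" where
  "full_refund_or_nothing p l r \<longleftrightarrow>
     (\<exists>(wL :: nat \<Rightarrow> ereal) (wH :: nat \<Rightarrow> real).
        (\<forall>j\<in>{1..l}. wL j \<le> ereal (wH j)) \<and>
        (\<forall>j\<in>{1..<l}. ereal (wH j) < wL (Suc j)) \<and>
        (AE v in lborel. r v =
           p * (\<Sum>j=1..l. indicator {v. wL j \<le> ereal v \<and> v \<le> wH j} v)))"

definition feasible_full_refund ::
  "real \<Rightarrow> real \<Rightarrow> real \<Rightarrow> real \<Rightarrow> nat \<Rightarrow> (real \<Rightarrow> real) \<times> real \<Rightarrow> bool" where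
  "feasible_full_refund \<theta> st se p l rc \<longleftrightarrow>
     feasible \<theta> st se p rc \<and> full_refund_or_nothing p l (fst rc)"

definition optimal_full_refund ::
  "real \<Rightarrow> real \<Rightarrow> real \<Rightarrow> real \<Rightarrow> nat \<Rightarrow> (real \<Rightarrow> real) \<times> real \<Rightarrow> bool" where
  "optimal_full_refund \<theta> st se p l rc \<longleftrightarrow>
     is_arg_max (expected_profit \<theta> st se p) (feasible_full_refund \<theta> st se p l) rc"

text \<open>The prior standard deviation when the total uncertainty \<open>\<sigma>\<close> is held fixed.\<close>

definition prior_sd :: "real \<Rightarrow> real \<Rightarrow> real" where
  "prior_sd \<sigma> se = sqrt (\<sigma>\<^sup>2 - se\<^sup>2)"

end

theory Submission
  imports Defs "HOL-Complex_Analysis.Conformal_Mappings" "HOL-Real_Asymp.Real_Asymp"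
begin

text \<open>
  Let \<open>R(x)\<close> be the expected rebate of a buyer with valuation \<open>x\<close> and \<open>f\<close> the density of the
  valuations. The profit is \<open>\<integral>\<^bsub>x>c\<^esub> f(x) (p - R(x)) dx\<close>.

  Existence: the near-optimal rebates form a decreasing sequence of convex sets; by the parallelogram
  law their elements of almost minimal \<open>L\<^sup>2\<close> norm converge.

  Bang-bang: \<open>f\<close> times the surplus \<open>R(x) + x - p\<close> extends to an entire function, so only finitely
  many constraints are tight. The constant rebate \<open>p - c\<close> is a Slater point, so there are finitely many
  multipliers, and the optimal rebate is \<open>p\<close> where \<open>k < 0\<close> and \<open>0\<close> where \<open>k > 0\<close>, with \<open>k\<close> equal to
  \<open>\<Phi>((v - c) / se)\<close> minus a combination of Gaussians; \<open>k\<close> has finitely many zeros and tends to \<open>1\<close>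
  at \<open>\<infinity>\<close>.

  Asymptotics: with \<open>l\<close> intervals, \<open>R (p - R)\<close> is a posterior variance of mass \<open>O(l se)\<close>, and obedience
  then keeps the profit within \<open>O(\<delta> + l se / \<delta>)\<close> of the no-reward profit for every \<open>\<delta> > 0\<close>. A clipped
  linear rebate beats the no-reward profit by a constant as \<open>se\<close> tends to \<open>0\<close>, whence \<open>l = \<Omega>(1 / se)\<close>.
\<close>

section \<open>Multipliers for finitely many affine constraints\<close>

text \<open>The cutoff is kept fixed in every perturbation, which makes profit and surplus affine in
  the rebate. The obstacle is the point \<open>c\<close> itself: the surplus of every competitor
  vanishes there, so the sign condition \<open>(x - c) * surplus r x \<ge> 0\<close> can never be
  strict at \<open>c\<close>. Its place is taken by positivity of the derivative of \<open>g\<close>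
  at \<open>c\<close>; this is the source of the slope term \<open>gauss_slope\<close> in the
  multiplier function. The weight \<open>f\<close> in \<open>g\<close> turns the posterior, which
  moves with \<open>x\<close>, into the fixed prior times the noise density, so that differentiation
  and analytic continuation act on the kernel alone. The multiplier of the equality at
  \<open>c\<close> needs rebates with surplus of both signs there, whence \<open>0 < c < p\<close>;
  the value \<open>c = 0\<close> yields no profit, and \<open>c = p\<close> forces a zero rebate. In
  the asymptotic bound, \<open>\<delta>\<close> balances two losses: valuations in a window of width
  \<open>\<delta>\<close> are counted at the full price, and those below cost a factor
  \<open>1 / \<delta>\<close>. Fixing \<open>\<delta>\<close> as a multiple of the profit gap spends
  half of the gap on the window and leaves the other half to \<open>l * se\<close>.\<close>

abbreviation mix :: "real \<Rightarrow> (real \<Rightarrow> real) \<Rightarrow> (real \<Rightarrow> real) \<Rightarrow> real \<Rightarrow> real" where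
  "mix t a b \<equiv> \<lambda>v. (1 - t) * a v + t * b v"

text \<open>Only segments inside the set are tested: profit and surplus are integrals, and
  additivity is available where these converge.\<close>

definition affine_on :: "(real \<Rightarrow> real) set \<Rightarrow> ((real \<Rightarrow> real) \<Rightarrow> real) \<Rightarrow> bool" where
  "affine_on X f \<longleftrightarrow> (\<forall>a\<in>X. \<forall>b\<in>X. \<forall>t\<in>{0..1}.
     f (mix t a b) = (1 - t) * f a + t * f b)"

definition convex_functions :: "(real \<Rightarrow> real) set \<Rightarrow> bool" where
  "convex_functions X \<longleftrightarrow> (\<forall>a\<in>X. \<forall>b\<in>X. \<forall>t\<in>{0..1}. (mix t a b) \<in> X)"

lemma affine_onD:
  "affine_on X f \<Longrightarrow> a \<in> X \<Longrightarrow> b \<in> X \<Longrightarrow> 0 \<le> t \<Longrightarrow> t \<le> 1 \<Longrightarrow>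
    f (mix t a b) = (1 - t) * f a + t * f b"
  by (auto simp: affine_on_def)

lemma convex_functionsD:
  "convex_functions X \<Longrightarrow> a \<in> X \<Longrightarrow> b \<in> X \<Longrightarrow> 0 \<le> t \<Longrightarrow> t \<le> 1 \<Longrightarrow>
    (mix t a b) \<in> X"
  by (auto simp: convex_functions_def)

lemma affine_on_subset: "affine_on X f \<Longrightarrow> Y \<subseteq> X \<Longrightarrow> affine_on Y f"
  by (auto simp: affine_on_def)

lemma affine_on_diff_scale:
  "affine_on X f \<Longrightarrow> affine_on X g \<Longrightarrow> affine_on X (\<lambda>a. f a - l * g a)"
  by (simp add: affine_on_def) (simp add: algebra_simps)

lemma affine_on_sum:
  "(\<And>i. i \<in> I \<Longrightarrow> affine_on X (g i)) \<Longrightarrow> affine_on X (\<lambda>a. \<Sum>i\<in>I. l i * g i a)"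
  by (simp add: affine_on_def sum_distrib_left sum.distrib[symmetric] distrib_left mult.left_commute)

lemma convex_functions_pos:
  assumes X: "convex_functions X" and g: "affine_on X g"
  shows "convex_functions {a\<in>X. g a > (0::real)}"
  unfolding convex_functions_def
proof (intro ballI)
  fix a b t assume ab: "a \<in> {a\<in>X. g a > 0}" "b \<in> {a\<in>X. g a > 0}" and t: "t \<in> {0..1::real}"
  have "(1 - t) * g a + t * g b > 0"
  proof (cases "t = 0")
    case False
    then have "t * g b > 0" using ab t by auto
    moreover have "(1 - t) * g a \<ge> 0" using ab t by auto
    ultimately show ?thesis by linarith
  qed (use ab in auto)
  then show "(mix t a b) \<in> {a\<in>X. g a > 0}"
    using ab t affine_onD[OF g, of a b t] convex_functionsD[OF X, of a b t] by auto
qed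

lemma convex_functions_zero:
  assumes X: "convex_functions X" and g: "affine_on X g"
  shows "convex_functions {a\<in>X. g a = (0::real)}"
  unfolding convex_functions_def
proof (intro ballI)
  fix a b t assume ab: "a \<in> {a\<in>X. g a = 0}" "b \<in> {a\<in>X. g a = 0}" and t: "t \<in> {0..1::real}"
  then show "(mix t a b) \<in> {a\<in>X. g a = 0}"
    using affine_onD[OF g, of a b t] convex_functionsD[OF X, of a b t] by auto
qed

text \<open>The multiplier is the infimum of the slopes \<open>f / g\<close> over the points with
  \<open>g > 0\<close>. The hypothesis on \<open>f\<close> speaks of strict \<open>g > 0\<close>
  only, because strictness at the tight constraints is what makes a small mixture obedient; points
  with \<open>g \<le> 0\<close> are compared along segments to the strict side.\<close>

lemma multiplier_inequality:
  assumes X: "convex_functions X" and f: "affine_on X f" and g: "affine_on X g"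
    and x0: "x0 \<in> X" "g x0 > 0"
    and pos: "\<And>x. x \<in> X \<Longrightarrow> g x > 0 \<Longrightarrow> f x \<ge> 0"
  shows "\<exists>l\<ge>0. \<forall>x\<in>X. f x \<ge> l * g x"
proof -
  let ?Q = "(\<lambda>y. f y / g y) ` {y\<in>X. g y > 0}"
  have ne: "?Q \<noteq> {}" using x0 by auto
  have lb: "q \<ge> 0" if "q \<in> ?Q" for q using that pos by auto
  then have bdd: "bdd_below ?Q" by (meson bdd_belowI)
  define l where "l = Inf ?Q"
  have l0: "l \<ge> 0" unfolding l_def using ne lb by (rule cInf_greatest)
  have cross: "g x * (f y / g y) \<le> f x" if x: "x \<in> X" "g x \<le> 0" and y: "y \<in> X" "g y > 0" for x y
  proof -
    \<comment> \<open>The parameter at which the segment from \<open>x\<close> to \<open>y\<close>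
      meets \<open>g = 0\<close>. Beyond it \<open>g > 0\<close>, hence \<open>f \<ge> 0\<close>; at
      \<open>t0\<close> itself \<open>f \<ge> 0\<close> holds in the limit, and the interpolated
      value there is a positive multiple of \<open>g y * f x - g x * f y\<close>.\<close>
    define t0 where "t0 = - g x / (g y - g x)"
    have d: "g y - g x > 0" using x y by linarith
    have t0: "0 \<le> t0" "t0 < 1" using x y d by (auto simp: t0_def divide_simps)
    have ev: "(1 - t) * f x + t * f y \<ge> 0" if t: "t0 < t" "t \<le> 1" for t
    proof -
      have "t * (g y - g x) > - g x" using t d by (simp add: t0_def divide_simps)
      then have "(1 - t) * g x + t * g y > 0" by (simp add: algebra_simps)
      then have "g (mix t x y) > 0"
        using affine_onD[OF g x(1) y(1), of t] t t0 by auto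
      then have "f (mix t x y) \<ge> 0"
        using pos convex_functionsD[OF X x(1) y(1), of t] t t0 by auto
      then show ?thesis using affine_onD[OF f x(1) y(1), of t] t t0 by auto
    qed
    have "((\<lambda>t. (1 - t) * f x + t * f y) \<longlongrightarrow> (1 - t0) * f x + t0 * f y) (at_right t0)"
      by (intro tendsto_intros)
    moreover have "\<forall>\<^sub>F t in at_right t0. (1 - t) * f x + t * f y \<ge> 0"
      unfolding eventually_at_right_field using ev t0 by (intro exI[of _ 1]) auto
    ultimately have "(1 - t0) * f x + t0 * f y \<ge> 0"
      by (rule tendsto_lowerbound) simp
    then have "(g y - g x) * ((1 - t0) * f x + t0 * f y) \<ge> 0" using d by simp
    moreover have "(g y - g x) * ((1 - t0) * f x + t0 * f y) = g y * f x - g x * f y"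
    proof -
      have *: "t0 * (g y - g x) = - g x" using d by (simp add: t0_def)
      have "(g y - g x) * ((1 - t0) * f x + t0 * f y) = (g y - g x) * f x + (t0 * (g y - g x)) * (f y - f x)"
        by (simp add: algebra_simps)
      then show ?thesis unfolding * by (simp add: algebra_simps)
    qed
    ultimately show ?thesis using y by (simp add: field_simps)
  qed
  have "f x \<ge> l * g x" if x: "x \<in> X" for x
  proof (cases "g x > 0")
    case True
    then have "l \<le> f x / g x" unfolding l_def using x bdd by (intro cInf_lower) auto
    then show ?thesis using True by (simp add: field_simps)
  next
    case False
    show ?thesis
    proof (rule ccontr)
      assume "\<not> ?thesis"
      then have lt: "f x < l * g x" by simp
      have g0: "g x \<noteq> 0" using cross[OF x _ x0] lt by auto
      then have gn: "g x < 0" using False by simp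
      have "l < f x / g x" using lt gn by (simp add: field_simps)
      then obtain q where q: "q \<in> ?Q" "q < f x / g x"
        using cInf_lessD[OF ne, of "f x / g x"] unfolding l_def by blast
      have "g x * q > f x" using q gn by (simp add: field_simps)
      moreover obtain y where "y \<in> X" "g y > 0" "q = f y / g y" using q by blast
      ultimately show False using cross[OF x, of y] gn by auto
    qed
  qed
  then show ?thesis using l0 by blast
qed

text \<open>Constraints are removed one at a time: on the convex part where \<open>g i > 0\<close>
  the induction hypothesis yields multipliers for the rest, and then the single-constraint lemma is
  applied on all of \<open>X\<close> to \<open>f\<close> minus their combination. The induction
  therefore ranges over all convex domains.\<close>

lemma multiplier_inequalities:
  assumes "finite I"
  shows "convex_functions X \<Longrightarrow> affine_on X f \<Longrightarrow> (\<And>i. i \<in> I \<Longrightarrow> affine_on X (g i)) \<Longrightarrow>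
    x0 \<in> X \<Longrightarrow> (\<And>i. i \<in> I \<Longrightarrow> g i x0 > 0) \<Longrightarrow>
    (\<And>x. x \<in> X \<Longrightarrow> (\<And>i. i \<in> I \<Longrightarrow> g i x > 0) \<Longrightarrow> f x \<ge> 0) \<Longrightarrow>
    \<exists>l. (\<forall>i\<in>I. l i \<ge> 0) \<and> (\<forall>x\<in>X. f x \<ge> (\<Sum>i\<in>I. l i * g i x))"
  using assms
proof (induction I arbitrary: X)
  case empty
  then show ?case by auto
next
  case (insert i I)
  let ?X = "{a\<in>X. g i a > 0}"
  note X = insert.prems(1) and f = insert.prems(2) and g = insert.prems(3) and x0 = insert.prems(4,5)
  have gi: "affine_on X (g i)" by (rule g) simp
  have gI: "affine_on X (g j)" if "j \<in> I" for j by (rule g) (simp add: that)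
  have sub: "?X \<subseteq> X" by blast
  have "\<exists>l. (\<forall>i\<in>I. l i \<ge> 0) \<and> (\<forall>x\<in>?X. f x \<ge> (\<Sum>i\<in>I. l i * g i x))"
  proof (rule insert.IH)
    show "convex_functions ?X" using X gi by (rule convex_functions_pos)
    show "affine_on ?X f" using f sub by (rule affine_on_subset)
    show "affine_on ?X (g j)" if "j \<in> I" for j using gI[OF that] sub by (rule affine_on_subset)
    show "x0 \<in> ?X" using x0(1) x0(2)[of i] by simp
    show "0 < g j x0" if "j \<in> I" for j using x0(2)[of j] that by simp
    show "0 \<le> f x" if x: "x \<in> ?X" "\<And>j. j \<in> I \<Longrightarrow> 0 < g j x" for x
      by (rule insert.prems(6)) (use x in auto)
  qed
  then obtain l where l: "\<And>i. i \<in> I \<Longrightarrow> l i \<ge> 0" "\<And>x. x \<in> ?X \<Longrightarrow> f x \<ge> (\<Sum>i\<in>I. l i * g i x)"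
    by blast
  have "\<exists>k\<ge>0. \<forall>x\<in>X. f x - 1 * (\<Sum>j\<in>I. l j * g j x) \<ge> k * g i x"
  proof (rule multiplier_inequality)
    show "affine_on X (\<lambda>x. f x - 1 * (\<Sum>j\<in>I. l j * g j x))"
      by (intro affine_on_diff_scale affine_on_sum f gI)
    show "0 < g i x0" using x0(2)[of i] by simp
    show "0 \<le> f x - 1 * (\<Sum>j\<in>I. l j * g j x)" if "x \<in> X" "0 < g i x" for x
      using l(2)[of x] that by simp
  qed fact+
  then obtain k where k: "k \<ge> 0" "\<And>x. x \<in> X \<Longrightarrow> f x - (\<Sum>j\<in>I. l j * g j x) \<ge> k * g i x" by auto
  have eq: "(\<Sum>j\<in>I. (if j = i then k else l j) * g j x) = (\<Sum>j\<in>I. l j * g j x)" for x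
    using insert.hyps by (intro sum.cong) auto
  define l' where "l' = (\<lambda>j. if j = i then k else l j)"
  have "(\<Sum>j\<in>insert i I. l' j * g j x) = k * g i x + (\<Sum>j\<in>I. l j * g j x)" for x
    using insert.hyps eq[of x] by (simp add: l'_def)
  moreover have "f x \<ge> k * g i x + (\<Sum>j\<in>I. l j * g j x)" if "x \<in> X" for x
    using k(2)[OF that] by simp
  moreover have "l' j \<ge> 0" if "j \<in> insert i I" for j using that k(1) l(1) by (auto simp: l'_def)
  ultimately show ?case by (intro exI[of _ l']) auto
qed

text \<open>Crossing \<open>g = 0\<close> along a segment shows that every slope
  \<open>f / g\<close> at a point with \<open>g < 0\<close> lies below every such slope at a point
  with \<open>g > 0\<close>. The infimum of the latter separates the two families; points on both
  sides make it finite, and its sign is arbitrary.\<close>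

lemma multiplier_equality:
  assumes X: "convex_functions X" and f: "affine_on X f" and g: "affine_on X g"
    and x1: "x1 \<in> X" "g x1 > 0" and x2: "x2 \<in> X" "g x2 < 0"
    and zero: "\<And>x. x \<in> X \<Longrightarrow> g x = 0 \<Longrightarrow> f x \<ge> 0"
  shows "\<exists>l. \<forall>x\<in>X. f x \<ge> l * g x"
proof -
  have cross: "f x / g x \<le> f y / g y" if x: "x \<in> X" "g x < 0" and y: "y \<in> X" "g y > 0" for x y
  proof -
    define t where "t = - g x / (g y - g x)"
    have d: "g y - g x > 0" using x y by linarith
    have t: "0 \<le> t" "t \<le> 1" using x y d by (auto simp: t_def divide_simps)
    have "(1 - t) * g x + t * g y = 0" using d by (simp add: t_def field_simps)
    then have "f (mix t x y) \<ge> 0"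
      using zero convex_functionsD[OF X x(1) y(1) t] affine_onD[OF g x(1) y(1) t] by auto
    then have "(1 - t) * f x + t * f y \<ge> 0" using affine_onD[OF f x(1) y(1) t] by auto
    then have "(g y - g x) * ((1 - t) * f x + t * f y) \<ge> 0" using d by simp
    moreover have "(g y - g x) * ((1 - t) * f x + t * f y) = g y * f x - g x * f y"
    proof -
      have *: "t * (g y - g x) = - g x" using d by (simp add: t_def)
      have "(g y - g x) * ((1 - t) * f x + t * f y) = (g y - g x) * f x + (t * (g y - g x)) * (f y - f x)"
        by (simp add: algebra_simps)
      then show ?thesis unfolding * by (simp add: algebra_simps)
    qed
    ultimately show ?thesis using x y by (simp add: field_simps)
  qed
  let ?Q = "(\<lambda>y. f y / g y) ` {y\<in>X. g y > 0}"
  have ne: "?Q \<noteq> {}" using x1 by auto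
  have bdd: "bdd_below ?Q" using cross[OF x2] by (intro bdd_belowI[of _ "f x2 / g x2"]) auto
  have "f x \<ge> Inf ?Q * g x" if x: "x \<in> X" for x
  proof -
    consider "g x > 0" | "g x = 0" | "g x < 0" by linarith
    then show ?thesis
    proof cases
      case 1
      then have "Inf ?Q \<le> f x / g x" using x bdd by (intro cInf_lower) auto
      then show ?thesis using 1 by (simp add: field_simps)
    next
      case 2 then show ?thesis using zero x by auto
    next
      case 3
      then have "f x / g x \<le> Inf ?Q" using cross[OF x] ne by (intro cInf_greatest) auto
      then show ?thesis using 3 by (simp add: field_simps)
    qed
  qed
  then show ?thesis by blast
qed

section \<open>Zeros of exponential polynomials\<close>

text \<open>A zero \<open>x\<close> is sent to the set of critical points to its left. Rolle's
  theorem puts a critical point between two zeros, so this map into a finite power set is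
  injective.\<close>

lemma finite_zeros_of_finite_deriv_zeros:
  fixes f f' :: "real \<Rightarrow> real"
  assumes der: "\<And>x. (f has_real_derivative f' x) (at x)" and fin: "finite {x. f' x = 0}"
  shows "finite {x. f x = 0}"
proof (rule inj_on_finite)
  show "inj_on (\<lambda>x. {z. f' z = 0 \<and> z < x}) {x. f x = 0}"
  proof (rule linorder_inj_onI)
    fix x y assume xy: "x < y" "x \<in> {x. f x = 0}" "y \<in> {x. f x = 0}"
    have "\<exists>z. x < z \<and> z < y \<and> DERIV f z :> 0"
    proof (rule Rolle)
      show "continuous_on {x..y} f" by (meson DERIV_atLeastAtMost_imp_continuous_on der)
      show "\<And>z. x < z \<Longrightarrow> z < y \<Longrightarrow> f differentiable at z" using der real_differentiable_def by blast
    qed (use xy in auto)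
    then obtain z where z: "x < z" "z < y" "DERIV f z :> 0" by blast
    then have "f' z = 0" using der DERIV_unique by blast
    then have "z \<in> {z. f' z = 0 \<and> z < y}" "z \<notin> {z. f' z = 0 \<and> z < x}" using z by auto
    then show "{z. f' z = 0 \<and> z < x} \<noteq> {z. f' z = 0 \<and> z < y}" by blast
  qed auto
  show "(\<lambda>x. {z. f' z = 0 \<and> z < x}) ` {x. f x = 0} \<subseteq> Pow {x. f' x = 0}" by auto
  show "finite (Pow {x. f' x = 0})" using fin by simp
qed

text \<open>Exponents may repeat and polynomials may vanish; without a normal form, the dichotomy
  \<open>exp_poly_finite_zeros\<close> has to allow for the zero function.\<close>

definition exp_poly :: "(real \<times> real poly) list \<Rightarrow> real \<Rightarrow> real" where
  "exp_poly L v = (\<Sum>(a, P)\<leftarrow>L. poly P v * exp (a * v))"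

lemma exp_poly_shift: "exp_poly L v * exp (b * v) = exp_poly (map (\<lambda>(a, P). (a + b, P)) L) v"
  by (induction L) (auto simp: exp_poly_def algebra_simps exp_add)

lemma exp_poly_deriv:
  "(exp_poly L has_real_derivative exp_poly (map (\<lambda>(a, P). (a, pderiv P + smult a P)) L) v) (at v)"
proof (induction L)
  case Nil
  then show ?case by (simp add: exp_poly_def[abs_def])
next
  case (Cons x L)
  obtain a P where x: "x = (a, P)" by force
  have eq: "exp_poly (x # L) = (\<lambda>v. poly P v * exp (a * v) + exp_poly L v)"
    by (auto simp: exp_poly_def x)
  show ?case unfolding eq
    by (rule derivative_eq_intros Cons.IH poly_DERIV refl)+ (simp add: exp_poly_def x algebra_simps)
qed

lemma degree_exp_poly_deriv: "degree (pderiv P + smult a P) \<le> degree (P :: real poly)"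
  by (intro degree_add_le) (auto simp: degree_pderiv)

text \<open>Multiplication by \<open>exp (- a * v)\<close> keeps the zeros and turns the first
  summand into a polynomial. Differentiation then lowers its degree without raising any other, so
  the sum of \<open>Suc (degree P)\<close> decreases, and Rolle's theorem carries finiteness
  back.\<close>

lemma exp_poly_finite_zeros:
  "(\<forall>v. exp_poly L v = 0) \<or> finite {v. exp_poly L v = 0}"
proof (induction "\<Sum>(a, P)\<leftarrow>L. Suc (degree P)" arbitrary: L rule: less_induct)
  case less
  show ?case
  proof (cases L)
    case Nil
    then show ?thesis by (simp add: exp_poly_def)
  next
    case (Cons x M)
    obtain a P where x: "x = (a, P)" by force
    define L0 where "L0 = map (\<lambda>(b, P). (b + - a, P)) L"
    define f where "f = exp_poly L0"
    have fL: "f v = exp_poly L v * exp (- a * v)" for v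
      unfolding f_def L0_def exp_poly_shift ..
    then have zeros: "{v. exp_poly L v = 0} = {v. f v = 0}" by auto
    define M' where "M' = map (\<lambda>(b, P). (b - a, pderiv P + smult (b - a) P)) M"
    \<comment> \<open>A constant \<open>P\<close> differentiates to 0, whose \<open>degree\<close>
      is again 0; dropping the summand is what makes the measure decrease.\<close>
    define L' where "L' = (if degree P = 0 then M' else (0, pderiv P) # M')"
    have der: "(f has_real_derivative exp_poly L' v) (at v)" for v
    proof -
      have "exp_poly (map (\<lambda>(a, P). (a, pderiv P + smult a P)) L0) v = exp_poly ((0, pderiv P) # M') v"
        by (simp add: L0_def M'_def Cons x comp_def case_prod_unfold)
      also have "\<dots> = exp_poly L' v"
        by (auto simp: L'_def exp_poly_def pderiv_eq_0_iff[THEN iffD2])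
      finally show ?thesis using exp_poly_deriv[of L0 v] by (simp add: f_def)
    qed
    have "(\<Sum>(a, P)\<leftarrow>M'. Suc (degree P)) \<le> (\<Sum>(a, P)\<leftarrow>M. Suc (degree P))"
      unfolding M'_def
      by (auto simp: comp_def case_prod_beta intro!: sum_list_mono degree_exp_poly_deriv)
    then have "(\<Sum>(a, P)\<leftarrow>L'. Suc (degree P)) < (\<Sum>(a, P)\<leftarrow>L. Suc (degree P))"
      by (auto simp: Cons x L'_def degree_pderiv)
    from less(1)[OF this] have "(\<forall>v. exp_poly L' v = 0) \<or> finite {v. exp_poly L' v = 0}" .
    then show ?thesis
    proof
      assume "finite {v. exp_poly L' v = 0}"
      then have "finite {v. f v = 0}" using finite_zeros_of_finite_deriv_zeros[of f "exp_poly L'"] der by blast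
      then show ?thesis using zeros by simp
    next
      assume "\<forall>v. exp_poly L' v = 0"
      then have "\<And>v. (f has_real_derivative 0) (at v)" using der by metis
      then have c: "f v = f w" for v w using DERIV_isconst_all[of f] by blast
      show ?thesis
      proof (cases "f 0 = 0")
        case True
        then have "f v = 0" for v using c[of v 0] by simp
        then show ?thesis by (auto simp: fL)
      next
        case False
        then have "f v \<noteq> 0" for v using c[of 0 v] by simp
        then have "{v. f v = 0} = {}" by simp
        then show ?thesis using zeros by simp
      qed
    qed
  qed
qed

section \<open>Interval representation\<close>

abbreviation ereal_Icc :: "ereal \<Rightarrow> real \<Rightarrow> real set" where
  "ereal_Icc a b \<equiv> {v. a \<le> ereal v \<and> v \<le> b}"

text \<open>Induction on the largest point \<open>z\<close> of \<open>Z\<close>. Right of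
  \<open>z\<close> nothing belongs to \<open>S\<close>, by constancy and boundedness; the gap before
  \<open>z\<close> belongs to \<open>S\<close> entirely or not at all. Right endpoints are recorded
  to lie in \<open>Z\<close> so that they stay left of the next gap and are avoided by every
  \<open>v\<close> outside \<open>Z\<close>.\<close>

lemma interval_representation:
  fixes Z :: "real set"
  assumes "finite Z"
  shows "(\<And>x y. x < y \<Longrightarrow> {x..y} \<inter> Z = {} \<Longrightarrow> x \<in> S \<longleftrightarrow> y \<in> S) \<Longrightarrow> (\<exists>M. \<forall>x>M. x \<notin> S) \<Longrightarrow>
    \<exists>l (wL :: nat \<Rightarrow> ereal) wH. (\<forall>j\<in>{1..l}. wL j \<le> ereal (wH j)) \<and>
      (\<forall>j\<in>{1..<l}. ereal (wH j) < wL (Suc j)) \<and> (\<forall>j\<in>{1..l}. wH j \<in> Z) \<and>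
      (\<forall>v. v \<notin> Z \<longrightarrow> indicator S v = (\<Sum>j=1..l. indicator (ereal_Icc (wL j) (wH j)) v :: real))"
  using assms
proof (induction Z arbitrary: S rule: finite_linorder_max_induct)
  case empty
  obtain M where M: "\<And>x. x > M \<Longrightarrow> x \<notin> S" using empty by blast
  have "x \<notin> S" for x
    using empty(1)[of x "max x M + 1"] M[of "max x M + 1"] by auto
  then show ?case by (intro exI[of _ 0]) auto
next
  case (insert z Z)
  obtain M where M: "\<And>x. x > M \<Longrightarrow> x \<notin> S" using insert by blast
  have right: "x \<notin> S" if "x > z" for x
    using insert(4)[of x "max x M + 1"] M[of "max x M + 1"] insert.hyps that by fastforce
  \<comment> \<open>The left end of the last gap. The value \<open>-\<infinity>\<close> occurs when
    no point of \<open>Z\<close> precedes \<open>z\<close>, and it is the source of an interval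
    unbounded to the left.\<close>
  define y where "y = (if Z = {} then -\<infinity> else ereal (Max Z))"
  have yZ: "ereal w \<le> y" if "w \<in> Z" for w using that insert.hyps by (auto simp: y_def)
  have yz: "y < ereal z" using insert.hyps by (auto simp: y_def)
  have gap: "u \<in> S \<longleftrightarrow> w \<in> S" if "y < ereal u" "u < w" "w < z" for u w
  proof -
    have "v \<notin> Z" if "u \<le> v" for v
      using yZ[of v] that \<open>y < ereal u\<close> by (metis ereal_less_eq(3) leD order.strict_trans2)
    then have "{u..w} \<inter> insert z Z = {}" using that by auto
    then show ?thesis using insert(4) that by blast
  qed
  \<comment> \<open>Without the cut, membership could change at \<open>z\<close>, which is no longer
    among the exceptional points.\<close>
  define S' where "S' = {x\<in>S. ereal x < y}"
  have ex: "\<exists>l (wL :: nat \<Rightarrow> ereal) wH. (\<forall>j\<in>{1..l}. wL j \<le> ereal (wH j)) \<and>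
      (\<forall>j\<in>{1..<l}. ereal (wH j) < wL (Suc j)) \<and> (\<forall>j\<in>{1..l}. wH j \<in> Z) \<and>
      (\<forall>v. v \<notin> Z \<longrightarrow> indicator S' v = (\<Sum>j=1..l. indicator (ereal_Icc (wL j) (wH j)) v :: real))"
  proof (rule insert.IH)
    show "u \<in> S' \<longleftrightarrow> w \<in> S'" if uw: "u < w" "{u..w} \<inter> Z = {}" for u w
    proof (cases "ereal w < y")
      case True
      then have "w < z" using yz by (metis less_ereal.simps(1) order.strict_trans)
      then have "z \<notin> {u..w}" by simp
      moreover have "ereal u < y" using True uw(1) by (meson less_ereal.simps(1) order.strict_trans)
      ultimately show ?thesis using insert(4)[OF uw(1)] uw True by (auto simp: S'_def)
    next
      case False
      then have "\<not> ereal u < y" 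
      proof (cases "Z = {}")
        case ne: False
        then have "Max Z \<in> Z" using insert.hyps by simp
        then have "Max Z \<notin> {u..w}" using uw by blast
        then show ?thesis using False ne by (auto simp: y_def)
      qed (simp add: y_def)
      then show ?thesis using False by (auto simp: S'_def)
    qed
    show "\<exists>M. \<forall>x>M. x \<notin> S'" using M by (auto simp: S'_def)
  qed
  then obtain l and wL :: "nat \<Rightarrow> ereal" and wH where
    w: "\<And>j. j \<in> {1..l} \<Longrightarrow> wL j \<le> ereal (wH j)" "\<And>j. j \<in> {1..<l} \<Longrightarrow> ereal (wH j) < wL (Suc j)"
      "\<And>j. j \<in> {1..l} \<Longrightarrow> wH j \<in> Z"
      "\<And>v. v \<notin> Z \<Longrightarrow> indicator S' v = (\<Sum>j=1..l. indicator (ereal_Icc (wL j) (wH j)) v :: real)"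
    by blast
  have wH_y: "ereal (wH j) \<le> y" if "j \<in> {1..l}" for j using yZ w(3)[OF that] .
  show ?case
  proof (cases "\<exists>u. y < ereal u \<and> u < z \<and> u \<in> S")
    case False
    have "indicator S v = (indicator S' v :: real)" if "v \<notin> insert z Z" for v
    proof -
      have "ereal v \<noteq> y" using that insert.hyps Max_in[of Z] by (auto simp: y_def simp del: Max_in)
      then have "ereal v < y \<or> y < ereal v" by (simp add: neq_iff)
      moreover have "v < z \<or> z < v" using that by (auto simp: neq_iff)
      ultimately have "v \<in> S \<longleftrightarrow> v \<in> S'" using False right[of v] unfolding S'_def by blast
      then show ?thesis by (simp add: indicator_def)
    qed
    then show ?thesis using w by (intro exI[of _ l] exI[of _ wL] exI[of _ wH]) auto
  next
    case True
    then obtain u where u: "y < ereal u" "u < z" "u \<in> S" by blast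
    have mid: "v \<in> S" if "y < ereal v" "v < z" for v
    proof (cases u v rule: linorder_cases)
      case less
      then show ?thesis using gap[of u v] u that by blast
    next
      case equal
      then show ?thesis using u by simp
    next
      case greater
      then show ?thesis using gap[of v u] u that by blast
    qed
    have S_eq: "indicator S v = (indicator S' v + indicator {v. y \<le> ereal v \<and> v \<le> z} v :: real)"
      if v: "v \<notin> insert z Z" for v
    proof -
      have "ereal v \<noteq> y" using that insert.hyps Max_in[of Z] by (auto simp: y_def simp del: Max_in)
      then consider "ereal v < y" | "y < ereal v" "v < z" | "y < ereal v" "v > z"
        using v by (metis insertI1 neq_iff)
      then show ?thesis
      proof cases
        case 1
        then have "v \<in> S' \<longleftrightarrow> v \<in> S" "\<not> y \<le> ereal v" by (auto simp: S'_def)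
        then show ?thesis by (simp add: indicator_def)
      next
        case 2
        then have "v \<in> S" "v \<notin> S'" "y \<le> ereal v" "v \<le> z" using mid[of v] by (auto simp: S'_def)
        then show ?thesis by (simp add: indicator_def)
      next
        case 3
        then have "v \<notin> S" "v \<notin> S'" "\<not> v \<le> z" using right[of v] by (auto simp: S'_def)
        then show ?thesis by (simp add: indicator_def)
      qed
    qed
    show ?thesis
    proof (cases "l \<ge> 1 \<and> ereal (wH l) = y")
      case False
      define wL' where "wL' = wL(Suc l := y)"
      define wH' where "wH' = wH(Suc l := z)"
      have "(\<Sum>j=1..Suc l. indicator (ereal_Icc (wL' j) (wH' j)) v) =
         (\<Sum>j=1..l. indicator (ereal_Icc (wL j) (wH j)) v) +
         (indicator {v. y \<le> ereal v \<and> v \<le> z} v :: real)" for v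
        by (auto simp: wL'_def wH'_def intro!: sum.cong)
      moreover have "ereal (wH' j) < wL' (Suc j)" if "j \<in> {1..<Suc l}" for j
      proof (cases "j = l")
        case True
        then show ?thesis using that wH_y[of l] False by (simp add: wL'_def wH'_def order.not_eq_order_implies_strict)
      next
        case neq: False
        then show ?thesis using that w(2)[of j] by (auto simp: wL'_def wH'_def)
      qed
      moreover have "wL' j \<le> ereal (wH' j)" "wH' j \<in> insert z Z" if j: "j \<in> {1..Suc l}" for j
      proof -
        consider "j = Suc l" | "j \<in> {1..l}" "j \<noteq> Suc l" using j by (cases "j = Suc l") auto
        then show "wL' j \<le> ereal (wH' j)" "wH' j \<in> insert z Z"
          using w(1,3)[of j] yz by (cases; simp add: wL'_def wH'_def)+
      qed
      moreover have "indicator S v = (\<Sum>j=1..Suc l. indicator (ereal_Icc (wL' j) (wH' j)) v :: real)"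
        if "v \<notin> insert z Z" for v
        using calculation(1)[of v] w(4)[of v] S_eq[OF that] that by simp
      ultimately show ?thesis
        by (intro exI[of _ "Suc l"] exI[of _ wL'] exI[of _ wH'] conjI ballI allI impI) assumption+
    next
      case True
      \<comment> \<open>Here the last interval already ends at \<open>y\<close>. Appending
        \<open>[y, z]\<close> would break strict disjointness, so that interval is prolonged to
        \<open>z\<close>.\<close>
      define wH' where "wH' = wH(l := z)"
      have l: "l \<in> {1..l}" using True by auto
      have split: "{1..l} = insert l {1..<l}" using True by auto
      have *: "indicator {v. wL l \<le> ereal v \<and> v \<le> z} v =
          (indicator {v. wL l \<le> ereal v \<and> v \<le> wH l} v + indicator {v. y \<le> ereal v \<and> v \<le> z} v :: real)"
        if v: "v \<notin> insert z Z" for v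
      proof -
        have "v \<noteq> wH l" using v w(3)[OF l] by auto
        have y: "y = ereal (wH l)" using True by simp
        have lz: "wH l < z" using yz y by simp
        have wl: "wL l \<le> ereal (wH l)" using w(1)[OF l] .
        consider "v < wH l" | "wH l < v" using \<open>v \<noteq> wH l\<close> by (auto simp: neq_iff)
        then show ?thesis
        proof cases
          case 1
          then have "\<not> y \<le> ereal v" "v \<le> z" "v \<le> wH l" using lz y by auto
          then show ?thesis by (simp add: indicator_def)
        next
          case 2
          then have "y \<le> ereal v" "\<not> v \<le> wH l" using y by auto
          moreover have "wL l \<le> ereal v" using wl calculation(1) y by (metis order_trans)
          ultimately show ?thesis by (simp add: indicator_def)
        qed
      qed
      have "(\<Sum>j=1..l. indicator (ereal_Icc (wL j) (wH' j)) v) =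
         (\<Sum>j=1..l. indicator (ereal_Icc (wL j) (wH j)) v) +
         (indicator {v. y \<le> ereal v \<and> v \<le> z} v :: real)" if v: "v \<notin> insert z Z" for v
      proof -
        have "(\<Sum>j=1..<l. indicator (ereal_Icc (wL j) (wH' j)) v) =
            (\<Sum>j=1..<l. indicator (ereal_Icc (wL j) (wH j)) v :: real)"
          by (intro sum.cong) (auto simp: wH'_def)
        then show ?thesis unfolding split using *[OF v] by (simp add: wH'_def)
      qed
      moreover have "wL l \<le> ereal z"
      proof -
        have "ereal (wH l) \<le> ereal z" using True yz by (metis less_imp_le)
        then show ?thesis using w(1)[OF l] by (rule order_trans[rotated])
      qed
      moreover have "ereal (wH' j) < wL (Suc j)" if "j \<in> {1..<l}" for j
        using w(2)[OF that] that by (simp add: wH'_def)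
      moreover have "wL j \<le> ereal (wH' j)" "wH' j \<in> insert z Z" if "j \<in> {1..l}" for j
        using w(1,3)[OF that] calculation(2) by (simp_all add: wH'_def)
      moreover have "indicator S v = (\<Sum>j=1..l. indicator (ereal_Icc (wL j) (wH' j)) v :: real)"
        if "v \<notin> insert z Z" for v
        using calculation(1)[OF that] w(4)[of v] S_eq[OF that] that by simp
      ultimately show ?thesis
        by (intro exI[of _ l] exI[of _ wL] exI[of _ wH'] conjI ballI allI impI) assumption+
    qed
  qed
qed

section \<open>A compactness principle for convex sets of functions\<close>

lemmas bochner_cong = Bochner_Integration.integral_cong

text \<open>The infimal energies \<open>d n\<close> increase and are bounded. Midpoints stay in
  \<open>C n\<close>, so two elements whose energies almost attain \<open>d n\<close> must be close.
  The limit is not claimed to lie in any \<open>C n\<close>, since no closedness is assumed; the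
  caller passes to the limit in each defining condition.\<close>

lemma (in prob_space) nested_convex_AE_limit:
  fixes C :: "nat \<Rightarrow> ('a \<Rightarrow> real) set"
  assumes meas: "\<And>n r. r \<in> C n \<Longrightarrow> r \<in> borel_measurable M"
    and range: "\<And>n r x. r \<in> C n \<Longrightarrow> r x \<in> {0..p}"
    and mid: "\<And>n r r'. r \<in> C n \<Longrightarrow> r' \<in> C n \<Longrightarrow> (\<lambda>x. (r x + r' x) / 2) \<in> C n"
    and dec: "decseq C" and ne: "\<And>n. C n \<noteq> {}"
  obtains s where "\<And>n. s n \<in> C n" "AE x in M. convergent (\<lambda>n. s n x)"
proof -
  define q where "q r = (\<integral>x. (r x)\<^sup>2 \<partial>M)" for r :: "'a \<Rightarrow> real"
  have bnd: "\<bar>r x\<bar> \<le> \<bar>p\<bar>" if "r \<in> C n" for r n x using range[OF that, of x] by auto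
  have int2: "integrable M (\<lambda>x. r x * r' x)" if "r \<in> C n" "r' \<in> C m" for r r' n m
  proof (rule integrable_const_bound)
    show "AE x in M. norm (r x * r' x) \<le> \<bar>p\<bar> * \<bar>p\<bar>"
      unfolding real_norm_def abs_mult
      by (intro AE_I2 mult_mono bnd[OF that(1)] bnd[OF that(2)]) auto
  qed (use meas that in measurable)
  have q0: "q r \<ge> 0" for r by (simp add: q_def)
  have qp: "q r \<le> p\<^sup>2" if "r \<in> C n" for r n
  proof -
    have "q r \<le> (\<integral>x. p\<^sup>2 \<partial>M)" unfolding q_def
    proof (rule integral_mono)
      show "integrable M (\<lambda>x. (r x)\<^sup>2)" using int2[OF that that] by (simp add: power2_eq_square)
      show "(r x)\<^sup>2 \<le> p\<^sup>2" for x using range[OF that, of x] by (intro power_mono) auto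
    qed simp
    then show ?thesis by (simp add: prob_space)
  qed
  define d where "d n = Inf (q ` C n)" for n
  have bdd: "bdd_below (q ` C n)" for n using q0 by (intro bdd_belowI[of _ 0]) auto
  have d_le: "d n \<le> q r" if "r \<in> C n" for n r unfolding d_def using that bdd by (intro cInf_lower) auto
  have sub: "C m \<subseteq> C n" if "n \<le> m" for n m using dec that by (auto simp: decseq_def)
  have d_mono: "d n \<le> d m" if "n \<le> m" for n m
    unfolding d_def using sub[OF that] ne bdd by (intro cInf_superset_mono) auto
  have d_bdd: "d n \<le> p\<^sup>2" for n using ne[of n] d_le qp by (meson all_not_in_conv order_trans)
  have "\<exists>r\<in>C n. q r < d n + 1 / Suc n" for n
    using cInf_lessD[of "q ` C n" "d n + 1 / Suc n"] ne[of n] by (auto simp: d_def)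
  then obtain a where a: "\<And>n. a n \<in> C n" "\<And>n. q (a n) < d n + 1 / Suc n" by metis
  define D where "D = (SUP n. d n)"
  have bdda: "bdd_above (range d)" using d_bdd by (intro bdd_aboveI[of _ "p\<^sup>2"]) auto
  have dD: "d n \<le> D" for n unfolding D_def using bdda by (intro cSUP_upper) auto
  have lim: "d \<longlonglongrightarrow> D" unfolding D_def
    using bdda d_mono by (intro LIMSEQ_incseq_SUP) (auto simp: incseq_def)
  \<comment> \<open>From the parallelogram law: this dominates
    \<open>2 * (d n + 1 / Suc n) + 2 * (d m + 1 / Suc m) - 4 * d n\<close>, because
    \<open>d m \<le> D\<close> and \<open>n \<le> m\<close>.\<close>
  define e where "e n = 2 * (D - d n) + 4 / Suc n" for n
  have e_anti: "e m \<le> e n" if "n \<le> m" for n m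
  proof -
    have "4 / real (Suc m) \<le> 4 / real (Suc n)" using that by (intro divide_left_mono) auto
    then show ?thesis using d_mono[OF that] by (simp add: e_def)
  qed
  have "(\<lambda>n. 4 / real (Suc n)) \<longlonglongrightarrow> 0" by real_asymp
  then have "e \<longlonglongrightarrow> 2 * (D - D) + 0" unfolding e_def by (intro tendsto_intros lim)
  then have elim: "e \<longlonglongrightarrow> 0" by simp
  have close: "(\<integral>x. (a n x - a m x)\<^sup>2 \<partial>M) \<le> e n" if nm: "n \<le> m" for n m
  proof -
    note am = subsetD[OF sub[OF nm] a(1)[of m]]
    have "(\<integral>x. (a n x - a m x)\<^sup>2 \<partial>M) =
        (\<integral>x. 2 * (a n x)\<^sup>2 + 2 * (a m x)\<^sup>2 - 4 * ((a n x + a m x) / 2)\<^sup>2 \<partial>M)"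
      by (intro bochner_cong) (auto simp: power2_eq_square field_simps)
    also have "\<dots> = 2 * q (a n) + 2 * q (a m) - 4 * q (\<lambda>x. (a n x + a m x) / 2)"
    proof -
      have i: "integrable M (\<lambda>x. (a n x)\<^sup>2)" for n
        unfolding power2_eq_square by (rule int2[OF a(1) a(1)])
      have j: "integrable M (\<lambda>x. ((a n x + a m x) / 2)\<^sup>2)"
        unfolding power2_eq_square by (rule int2[OF mid[OF a(1) am] mid[OF a(1) am]])
      show ?thesis unfolding q_def
        using i j by (simp only: Bochner_Integration.integral_diff Bochner_Integration.integral_add
          integral_mult_right_zero integrable_mult_right Bochner_Integration.integrable_add)
    qed
    also have "\<dots> \<le> 2 * (d n + 1 / Suc n) + 2 * (d m + 1 / Suc m) - 4 * d n"
    proof -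
      have "2 * x + 2 * y - 4 * z \<le> 2 * (dn + u) + 2 * (dm + w) - 4 * dn"
        if "x < dn + u" "y < dm + w" "dn \<le> z" for x y z dn dm u w :: real
        using that by (simp add: algebra_simps)
      then show ?thesis using a(2)[of n] a(2)[of m] d_le[OF mid[OF a(1) am]] by blast
    qed
    also have "\<dots> \<le> e n"
    proof -
      have "1 / real (Suc m) \<le> 1 / real (Suc n)" using nm by (auto intro!: divide_left_mono)
      then show ?thesis using dD[of m] unfolding e_def by simp
    qed
    finally show ?thesis .
  qed
  have "\<exists>n. e n < (1/4)^j" for j
    using order_tendstoD(2)[OF elim, of "(1/4)^j"] by (auto simp: eventually_sequentially)
  then obtain N where N: "\<And>j. e (N j) < (1/4)^j" by metis
  \<comment> \<open>\<open>N j \<le> k j\<close> gives squared distance below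
    \<open>(1/4)^j\<close>, \<open>j \<le> k j\<close> puts \<open>a (k j)\<close> into
    \<open>C j\<close>, and the cumulative sum makes \<open>k\<close> nondecreasing.\<close>
  define k where "k j = (\<Sum>i\<le>j. N i) + j" for j
  have kN: "N j \<le> k j" "j \<le> k j" for j
    unfolding k_def using member_le_sum[of j "{..j}" N] by auto
  have kmono: "k j \<le> k (Suc j)" for j by (simp add: k_def)
  define s where "s j = a (k j)" for j
  have sC: "s n \<in> C n" for n using a(1)[of "k n"] sub[OF kN(2)] by (auto simp: s_def)
  have sm[measurable]: "s j \<in> borel_measurable M" for j using meas[OF sC] .
  have intabs: "integrable M (\<lambda>x. \<bar>s (Suc j) x - s j x\<bar>)" for j
  proof (rule integrable_const_bound)
    have "\<bar>s (Suc j) x - s j x\<bar> \<le> p" for x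
      using range[OF sC[of j], of x] range[OF sC[of "Suc j"], of x] by auto
    then show "AE x in M. norm \<bar>s (Suc j) x - s j x\<bar> \<le> p" by simp
  qed measurable
  have L1: "(\<integral>x. \<bar>s (Suc j) x - s j x\<bar> \<partial>M) \<le> (1/2)^j" for j
  proof -
    have intd: "integrable M (\<lambda>x. (s j x - s (Suc j) x)\<^sup>2)"
    proof -
      have "integrable M (\<lambda>x. s j x * s j x - 2 * (s j x * s (Suc j) x) + s (Suc j) x * s (Suc j) x)"
        by (intro Bochner_Integration.integrable_add Bochner_Integration.integrable_diff
            integrable_mult_right int2[OF sC sC])
      then show ?thesis by (simp add: power2_eq_square algebra_simps)
    qed
    \<comment> \<open>The inequality \<open>2 * b \<le> 2^j * b\<^sup>2 + (1/2)^j\<close> trades the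
      squared distance \<open>(1/4)^j\<close> for a mean absolute distance \<open>(1/2)^j\<close>.
      These are summable, so the increments are absolutely summable almost everywhere.\<close>
    have "(\<integral>x. \<bar>s (Suc j) x - s j x\<bar> \<partial>M) \<le> (\<integral>x. (2^j * (s j x - s (Suc j) x)\<^sup>2 + (1/2)^j) / 2 \<partial>M)"
    proof (rule integral_mono)
      show "integrable M (\<lambda>x. \<bar>s (Suc j) x - s j x\<bar>)"
        by (rule intabs)
      show "integrable M (\<lambda>x. (2^j * (s j x - s (Suc j) x)\<^sup>2 + (1/2)^j) / 2)" using intd by simp
      fix x
      define b where "b = \<bar>s (Suc j) x - s j x\<bar>"
      have "0 \<le> 2^j * (b - (1/2)^j)\<^sup>2" by simp
      also have "\<dots> = 2^j * b\<^sup>2 - 2 * b * (2^j * (1/2)^j) + (1/2)^j * (2^j * (1/2)^j)"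
        by (simp add: power2_eq_square algebra_simps)
      also have "(2::real)^j * (1/2)^j = 1" by (simp add: power_one_over)
      finally have "2 * b \<le> 2^j * b\<^sup>2 + (1/2)^j" by simp
      moreover have "b\<^sup>2 = (s j x - s (Suc j) x)\<^sup>2" by (simp add: b_def power2_commute)
      ultimately show "b \<le> (2^j * (s j x - s (Suc j) x)\<^sup>2 + (1/2)^j) / 2" by simp
    qed
    also have "\<dots> = (2^j * (\<integral>x. (s j x - s (Suc j) x)\<^sup>2 \<partial>M) + (1/2)^j) / 2"
      using intd by (simp add: prob_space)
    also have "\<dots> \<le> (2^j * (1/4)^j + (1/2)^j) / 2"
    proof -
      have "(\<integral>x. (s j x - s (Suc j) x)\<^sup>2 \<partial>M) \<le> e (k j)"
        unfolding s_def by (rule close[OF kmono])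
      also have "\<dots> \<le> e (N j)" by (rule e_anti[OF kN(1)])
      also have "\<dots> \<le> (1/4)^j" by (rule less_imp_le[OF N])
      finally show ?thesis by (intro divide_right_mono add_right_mono mult_left_mono) simp_all
    qed
    also have "(2::real)^j * (1/4)^j = (1/2)^j" by (simp flip: power_mult_distrib)
    finally show ?thesis by simp
  qed
  have "(\<integral>\<^sup>+x. (\<Sum>j. ennreal \<bar>s (Suc j) x - s j x\<bar>) \<partial>M) = (\<Sum>j. \<integral>\<^sup>+x. ennreal \<bar>s (Suc j) x - s j x\<bar> \<partial>M)"
    using sm by (intro nn_integral_suminf) auto
  also have "\<dots> \<le> (\<Sum>j. ennreal ((1/2)^j))"
  proof (intro suminf_le ballI allI)
    fix j
    show "(\<integral>\<^sup>+x. ennreal \<bar>s (Suc j) x - s j x\<bar> \<partial>M) \<le> ennreal ((1/2)^j)"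
      unfolding nn_integral_eq_integral[OF intabs AE_I2[OF abs_ge_zero]] by (rule ennreal_leI[OF L1])
  qed auto
  also have "\<dots> = ennreal (\<Sum>j. (1/2)^j)" by (intro suminf_ennreal2) (auto simp: summable_geometric)
  finally have "(\<integral>\<^sup>+x. (\<Sum>j. ennreal \<bar>s (Suc j) x - s j x\<bar>) \<partial>M) < \<infinity>"
    by (rule le_less_trans) simp
  then have fin: "(\<integral>\<^sup>+x. (\<Sum>j. ennreal \<bar>s (Suc j) x - s j x\<bar>) \<partial>M) \<noteq> \<infinity>" by simp
  have "AE x in M. (\<Sum>j. ennreal \<bar>s (Suc j) x - s j x\<bar>) \<noteq> \<infinity>"
    by (rule nn_integral_PInf_AE[OF _ fin]) measurable
  then have "AE x in M. convergent (\<lambda>n. s n x)"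
  proof eventually_elim
    fix x assume "(\<Sum>j. ennreal \<bar>s (Suc j) x - s j x\<bar>) \<noteq> \<infinity>"
    then have "summable (\<lambda>j. \<bar>s (Suc j) x - s j x\<bar>)" by (intro summable_suminf_not_top) auto
    then have "summable (\<lambda>j. s (Suc j) x - s j x)" by (rule summable_rabs_cancel)
    then have "convergent (\<lambda>n. \<Sum>j<n. s (Suc j) x - s j x)" by (simp add: summable_iff_convergent)
    then have "convergent (\<lambda>n. s n x - s 0 x)" unfolding sum_lessThan_telescope[of "\<lambda>j. s j x"] .
    then have "convergent (\<lambda>n. (s n x - s 0 x) + s 0 x)" using convergent_const by (rule convergent_add)
    then show "convergent (\<lambda>n. s n x)" by simp
  qed
  then show ?thesis using sC that by blast
qed

section \<open>The normal distribution function\<close>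

lemma integrable_normal_density_mult:
  assumes "s > 0" and [measurable]: "h \<in> borel_measurable borel" and "\<And>v. \<bar>h v\<bar> \<le> B"
  shows "integrable lborel (\<lambda>v. normal_density m s v * h v)"
proof (rule Bochner_Integration.integrable_bound)
  show "integrable lborel (\<lambda>v. B * normal_density m s v)" using assms by simp
  show "AE v in lborel. norm (normal_density m s v * h v) \<le> norm (B * normal_density m s v)"
  proof (rule AE_I2)
    fix v
    have "\<bar>normal_density m s v * h v\<bar> \<le> normal_density m s v * B"
      using assms(3)[of v] by (simp add: abs_mult mult_left_mono)
    then show "norm (normal_density m s v * h v) \<le> norm (B * normal_density m s v)"
      by (simp add: mult.commute)
  qed
qed measurable

lemma integral_normal_distribution:
  "h \<in> borel_measurable borel \<Longrightarrow>
    (LINT v|normal_distribution m s. h v) = (LBINT v. normal_density m s v * h v)"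
  by (subst integral_density) auto

lemma normal_density_affine:
  assumes "s > 0"
  shows "s * normal_density m s (m + s * z) = std_normal_density z"
  using assms by (simp add: normal_density_def real_sqrt_mult power_mult_distrib)

lemma integral_normal_density_affine:
  assumes "s > 0"
  shows "(LBINT v. normal_density m s v * h v) = (LBINT z. std_normal_density z * h (m + s * z))"
proof -
  have "(LBINT v. normal_density m s v * h v) = s *\<^sub>R (LBINT z. normal_density m s (m + s * z) * h (m + s * z))"
    using assms by (subst lborel_integral_real_affine[of s _ m]) auto
  also have "\<dots> = (LBINT z. (s * normal_density m s (m + s * z)) * h (m + s * z))"
    by (simp add: mult.assoc)
  finally show ?thesis by (simp only: normal_density_affine[OF assms])
qed

abbreviation "phi \<equiv> std_normal_density"

lemma Phi_eq: "Phi y = (LBINT z. phi z * indicator {..y} z)"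
proof -
  interpret prob_space std_normal_distribution by (rule prob_space_normal_density) simp
  have "Phi y = (LINT z|std_normal_distribution. indicator {..y} z)"
    by (simp add: Phi_def cdf_def)
  also have "\<dots> = (LBINT z. phi z * indicator {..y} z)"
    by (rule integral_normal_distribution) measurable
  finally show ?thesis .
qed

interpretation std_normal: real_distribution std_normal_distribution
  by (intro real_distribution.intro real_distribution_axioms.intro prob_space_normal_density) auto

lemma Phi_nonneg [simp]: "Phi y \<ge> 0" unfolding Phi_def by (rule std_normal.cdf_nonneg)
lemma Phi_le_1 [simp]: "Phi y \<le> 1" unfolding Phi_def by (rule std_normal.cdf_bounded_prob)
lemma Phi_mono: "x \<le> y \<Longrightarrow> Phi x \<le> Phi y" unfolding Phi_def by (rule std_normal.cdf_nondecreasing)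
lemma Phi_at_top: "(Phi \<longlongrightarrow> 1) at_top" unfolding Phi_def by (rule std_normal.cdf_lim_at_top_prob)
lemma Phi_at_bot: "(Phi \<longlongrightarrow> 0) at_bot" unfolding Phi_def by (rule std_normal.cdf_lim_at_bot)

lemma borel_measurable_Phi [measurable]: "Phi \<in> borel_measurable borel"
  by (rule borel_measurable_mono) (auto simp: mono_def Phi_mono)

lemma std_normal_density_le_1: "phi x \<le> 1"
proof -
  have "1 \<le> sqrt (2 * pi)" using pi_gt3 by simp
  then have "1 / sqrt (2 * pi) \<le> 1" by simp
  moreover have "exp (- x\<^sup>2 / 2) \<le> 1" by simp
  ultimately have "1 / sqrt (2 * pi) * exp (- x\<^sup>2 / 2) \<le> 1 * 1" by (intro mult_mono) auto
  then show ?thesis by (simp add: std_normal_density_def)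
qed

lemma Phi_diff: "a \<le> b \<Longrightarrow> Phi b - Phi a = (LBINT z=a..b. phi z)"
proof -
  assume ab: "a \<le> b"
  have i: "integrable lborel (\<lambda>z. phi z * indicator {..c} z)" for c :: real
    by (rule integrable_normal_density_mult[where B = 1]) auto
  have "Phi b - Phi a = (LBINT z. phi z * indicator {..b} z - phi z * indicator {..a} z)"
    unfolding Phi_eq using i by simp
  also have "\<dots> = (LBINT z. indicator {a<..b} z *\<^sub>R phi z)"
    using ab by (intro bochner_cong) (auto simp: indicator_def)
  also have "\<dots> = (LBINT z:{a<..b}. phi z)" by (simp add: set_lebesgue_integral_def)
  also have "\<dots> = (LBINT z=a..b. phi z)" using ab by (simp add: interval_integral_Ioc)
  finally show ?thesis .
qed

lemma continuous_on_normal_density [continuous_intros]: "continuous_on A (normal_density m s)"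
  unfolding normal_density_def[abs_def] by (cases "s = 0") (auto intro!: continuous_intros)

lemma DERIV_Phi: "(Phi has_real_derivative phi x) (at x)"
proof -
  have "((\<lambda>u. LBINT y=x-1..u. phi y) has_vector_derivative phi x)
      (at x within {x-1..x+1})"
    by (rule interval_integral_FTC2) (auto intro: continuous_on_normal_density)
  then have "((\<lambda>u. LBINT y=x-1..u. phi y) has_real_derivative phi x)
      (at x within {x-1..x+1})"
    by (simp add: has_real_derivative_iff_has_vector_derivative)
  then have "((\<lambda>u. LBINT y=x-1..u. phi y) has_real_derivative phi x) (at x)"
    by (subst (asm) at_within_interior) auto
  then have "((\<lambda>u. (LBINT y=x-1..u. phi y) + Phi (x - 1)) has_real_derivative phi x) (at x)"
    by (auto intro!: derivative_eq_intros)
  then show ?thesis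
    by (rule has_field_derivative_transform_within[of _ _ _ _ 1])
       (auto simp: dist_real_def Phi_diff[symmetric])
qed

lemma DERIV_Phi_comp [derivative_intros]:
  "(g has_real_derivative g') (at x within S) \<Longrightarrow>
    ((\<lambda>x. Phi (g x)) has_real_derivative phi (g x) * g') (at x within S)"
  using DERIV_chain2[OF DERIV_Phi] .

lemma Phi_lipschitz: "\<bar>Phi a - Phi b\<bar> \<le> \<bar>a - b\<bar>"
proof -
  have *: "Phi y - Phi x \<le> y - x" if xy: "x < y" for x y
  proof -
    obtain z where "Phi y - Phi x = (y - x) * phi z"
      using MVT2[OF xy, of Phi phi] DERIV_Phi by blast
    then show ?thesis using std_normal_density_le_1[of z] xy by (simp add: mult_left_le)
  qed
  show ?thesis
    using *[of a b] *[of b a] Phi_mono[of a b] Phi_mono[of b a] by (cases a b rule: linorder_cases) auto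
qed

lemma Phi_strict_mono: "x < y \<Longrightarrow> Phi x < Phi y"
  using DERIV_pos_imp_increasing[of x y Phi] DERIV_Phi normal_density_pos[of 1 0] by auto

lemma Phi_gt_0: "Phi x > 0"
  using Phi_strict_mono[of "x - 1" x] Phi_nonneg[of "x - 1"] by linarith

lemma Phi_uminus: "Phi (- y) = 1 - Phi y"
proof -
  have i: "integrable lborel (\<lambda>z. phi z * indicator S z)" if "S \<in> sets borel" for S :: "real set"
    by (rule integrable_normal_density_mult[where B = 1]) (use that in auto)
  have "Phi (- y) = (LBINT z. phi (0 + (-1) * z) * indicator {..-y} (0 + (-1) * z))"
    unfolding Phi_eq
    by (rule trans[OF lborel_integral_real_affine[of "-1" _ 0]]) (simp, simp only: abs_neg_one scaleR_one)
  also have "\<dots> = (LBINT z. phi z * indicator {y..} z)"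
    by (intro bochner_cong) (auto simp: std_normal_density_def indicator_def)
  finally have 1: "Phi (- y) = (LBINT z. phi z * indicator {y..} z)" .
  have "Phi y + Phi (- y) = (LBINT z. phi z * indicator {..y} z + phi z * indicator {y..} z)"
    using i by (simp add: 1 Phi_eq[of y])
  also have "\<dots> = (LBINT z. phi z)"
  proof (rule integral_cong_AE)
    show "AE z in lborel. phi z * indicator {..y} z + phi z * indicator {y..} z
        = phi z"
      using AE_lborel_singleton[of y] by eventually_elim (auto simp: indicator_def)
  qed measurable
  finally show ?thesis by simp
qed

lemma normal_lower_tail:
  "s > 0 \<Longrightarrow> (LBINT v. normal_density m s v * indicator {..b} v) = Phi ((b - m) / s)"
  unfolding Phi_eq
  by (subst integral_normal_density_affine)
     (auto intro!: bochner_cong simp: indicator_def field_simps)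

lemma normal_upper_tail:
  assumes s: "s > 0"
  shows "(LBINT v. normal_density m s v * indicator {b<..} v) = Phi ((m - b) / s)"
proof -
  have i: "integrable lborel (\<lambda>z. normal_density m s z * indicator S z)" if "S \<in> sets borel" for S :: "real set"
    by (rule integrable_normal_density_mult[OF s, where B = 1]) (use that in auto)
  have "(LBINT v. normal_density m s v * indicator {b<..} v) =
     (LBINT v. normal_density m s v - normal_density m s v * indicator {..b} v)"
    by (intro bochner_cong) (auto simp: indicator_def)
  also have "\<dots> = 1 - Phi ((b - m) / s)"
    using i s by (simp add: normal_lower_tail)
  also have "\<dots> = Phi ((m - b) / s)" using Phi_uminus[of "(b - m) / s"] by (simp add: minus_divide_left)
  finally show ?thesis .
qed

text \<open>After shifting the tail to the half-line \<open>z > 0\<close>, the inequality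
  \<open>(y + z)\<^sup>2 \<ge> y\<^sup>2 + z\<^sup>2\<close> factors out
  \<open>exp (- y\<^sup>2 / 2)\<close>; the remaining mass is bounded by 1.\<close>

lemma Phi_mills:
  assumes "y \<ge> 0" shows "1 - Phi y \<le> exp (- y\<^sup>2 / 2)"
proof -
  have "1 - Phi y = Phi (0 - y)" by (simp add: Phi_uminus)
  also have "\<dots> = (LBINT z. phi z * indicator {y<..} z)"
    using normal_upper_tail[of 1 0 y] by simp
  also have "\<dots> = (LBINT z. phi (y + 1 * z) * indicator {y<..} (y + 1 * z))"
    by (rule trans[OF lborel_integral_real_affine[of 1 _ y]]) simp_all
  also have "\<dots> \<le> (LBINT z. exp (- y\<^sup>2 / 2) * phi z)"
  proof (rule integral_mono)
    show "integrable lborel (\<lambda>z. phi (y + 1 * z) * indicator {y<..} (y + 1 * z))"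
      by (rule lborel_integrable_real_affine[OF integrable_normal_density_mult[where B = 1]]) auto
    fix z
    show "phi (y + 1 * z) * indicator {y<..} (y + 1 * z) \<le> exp (- y\<^sup>2 / 2) * phi z"
    proof (cases "z > 0")
      case True
      have "- (y + z)\<^sup>2 / 2 \<le> - y\<^sup>2 / 2 + - z\<^sup>2 / 2" using True assms by (simp add: power2_sum)
      then have "exp (- (y + z)\<^sup>2 / 2) \<le> exp (- y\<^sup>2 / 2) * exp (- z\<^sup>2 / 2)"
        by (metis exp_add exp_le_cancel_iff)
      then have "1 / sqrt (2 * pi) * exp (- (y + z)\<^sup>2 / 2) \<le> 1 / sqrt (2 * pi) * (exp (- y\<^sup>2 / 2) * exp (- z\<^sup>2 / 2))"
        by (intro mult_left_mono) auto
      then show ?thesis using True by (simp add: std_normal_density_def mult_ac)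
    qed simp
  qed simp
  also have "\<dots> = exp (- y\<^sup>2 / 2)" by simp
  finally show ?thesis .
qed

text \<open>This is the variance of the indicator of a half-line; whichever factor is a tail
  probability supplies the decay.\<close>

lemma Phi_tails: "Phi y * (1 - Phi y) \<le> exp (- y\<^sup>2 / 2)"
proof (cases "y \<ge> 0")
  case True
  have "Phi y * (1 - Phi y) \<le> 1 * (1 - Phi y)" by (intro mult_right_mono) auto
  then show ?thesis using Phi_mills[OF True] by simp
next
  case False
  have "Phi y * (1 - Phi y) \<le> Phi y * 1" by (intro mult_left_mono) auto
  then show ?thesis using Phi_mills[of "- y"] False by (simp add: Phi_uminus)
qed

section \<open>Taylor bounds and exponential transforms\<close>

lemma std_normal_density_deriv:
  "(phi has_real_derivative - x * phi x) (at x)"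
  unfolding std_normal_density_def[abs_def]
  by (auto intro!: derivative_eq_intros simp: field_simps)

lemma std_normal_density_deriv2:
  "((\<lambda>x. - x * phi x) has_real_derivative (x\<^sup>2 - 1) * phi x) (at x)"
  by (auto intro!: derivative_eq_intros std_normal_density_deriv simp: algebra_simps power2_eq_square)

lemma std_normal_density_deriv2_bound: "\<bar>(x\<^sup>2 - 1) * phi x\<bar> \<le> 2"
proof -
  have "1 + x\<^sup>2 / 2 \<le> exp (x\<^sup>2 / 2)" by (rule exp_ge_add_one_self)
  then have "(x\<^sup>2 + 1) * exp (- x\<^sup>2 / 2) \<le> 2 * exp (x\<^sup>2 / 2) * exp (- x\<^sup>2 / 2)"
    by (intro mult_right_mono) (linarith, simp)
  also have "\<dots> = 2" by (simp flip: exp_add)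
  finally have "(x\<^sup>2 + 1) * exp (- x\<^sup>2 / 2) \<le> 2" .
  moreover have "1 / sqrt (2 * pi) \<le> 1" using pi_gt3 by simp
  ultimately have "1 / sqrt (2 * pi) * ((x\<^sup>2 + 1) * exp (- x\<^sup>2 / 2)) \<le> 1 * 2" by (intro mult_mono) auto
  then have "(x\<^sup>2 + 1) * phi x \<le> 2" by (simp add: std_normal_density_def mult_ac)
  moreover have "\<bar>(x\<^sup>2 - 1) * phi x\<bar> \<le> (x\<^sup>2 + 1) * phi x"
    unfolding abs_mult by (intro mult_mono) (auto simp: abs_le_iff)
  ultimately show ?thesis by linarith
qed

text \<open>Lagrange's remainder with a second derivative bounded by 2, so the constant is
  \<open>2 / fact 2 = 1\<close>.\<close>

lemma std_normal_density_taylor: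
  "\<bar>phi x - phi a + (x - a) * a * phi a\<bar> \<le> (x - a)\<^sup>2"
proof (cases "x = a")
  case False
  define diff where "diff m = (if m = 0 then phi else if m = 1 then (\<lambda>x. - x * phi x)
     else (\<lambda>x. (x\<^sup>2 - 1) * phi x))" for m :: nat
  have "\<exists>t. (if x < a then x < t \<and> t < a else a < t \<and> t < x) \<and>
      phi x = (\<Sum>m<2. diff m a / fact m * (x - a) ^ m) + diff 2 t / fact 2 * (x - a)\<^sup>2"
    by (rule Taylor[where a = "min a x" and b = "max a x"])
       (use False in \<open>auto simp: diff_def less_2_cases_iff std_normal_density_deriv[simplified] std_normal_density_deriv2[simplified]\<close>)
  then obtain t where "phi x =
      phi a - a * phi a * (x - a) + (t\<^sup>2 - 1) * phi t / 2 * (x - a)\<^sup>2"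
    by (auto simp: diff_def numeral_2_eq_2)
  then have "\<bar>phi x - phi a + (x - a) * a * phi a\<bar> =
      \<bar>(t\<^sup>2 - 1) * phi t\<bar> / 2 * (x - a)\<^sup>2"
  proof -
    assume *: "phi x =
      phi a - a * phi a * (x - a) + (t\<^sup>2 - 1) * phi t / 2 * (x - a)\<^sup>2"
    have "phi x - phi a + (x - a) * a * phi a =
        (t\<^sup>2 - 1) * phi t / 2 * (x - a)\<^sup>2"
      unfolding * by simp
    then show ?thesis by (simp only: abs_mult abs_divide abs_power2 abs_numeral)
  qed
  also have "\<dots> \<le> 1 * (x - a)\<^sup>2"
    using std_normal_density_deriv2_bound[of t] by (intro mult_right_mono) auto
  finally show ?thesis by simp
qed simp

lemma normal_density_std: "s > 0 \<Longrightarrow> normal_density m s x = phi ((x - m) / s) / s"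
  by (simp add: normal_density_def real_sqrt_mult power_divide)

lemma normal_density_le_inverse: "s > 0 \<Longrightarrow> normal_density m s x \<le> 1 / s"
  unfolding normal_density_std using std_normal_density_le_1 by (intro divide_right_mono) auto

text \<open>The derivative of the noise density \<open>normal_density v s x\<close> in the valuation
  \<open>x\<close>, taken at \<open>x = c\<close>.\<close>

abbreviation gauss_slope :: "real \<Rightarrow> real \<Rightarrow> real \<Rightarrow> real" where
  "gauss_slope s c v \<equiv> normal_density v s c * (v - c) / s\<^sup>2"

text \<open>The remainder is bounded uniformly in the quality \<open>v\<close>, so it survives
  integration against the prior. One factor \<open>1 / s\<close> comes from the density and two from
  rescaling \<open>x - c\<close>.\<close>

lemma normal_density_taylor:
  assumes s: "s > 0"
  shows "\<bar>normal_density v s x - normal_density v s c - (x - c) * gauss_slope s c v\<bar>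
    \<le> (x - c)\<^sup>2 / s ^ 3"
proof -
  have "normal_density v s x - normal_density v s c - (x - c) * gauss_slope s c v =
    (phi ((x - v) / s) - phi ((c - v) / s) +
      ((x - v) / s - (c - v) / s) * ((c - v) / s) * phi ((c - v) / s)) / s"
    using s unfolding normal_density_std[OF s] by (simp add: field_simps power2_eq_square)
  then have "\<bar>normal_density v s x - normal_density v s c - (x - c) * gauss_slope s c v\<bar>
    = \<bar>phi ((x - v) / s) - phi ((c - v) / s) +
      ((x - v) / s - (c - v) / s) * ((c - v) / s) * phi ((c - v) / s)\<bar> / s"
    using s by simp
  also have "\<dots> \<le> ((x - v) / s - (c - v) / s)\<^sup>2 / s"
    using s by (intro divide_right_mono std_normal_density_taylor) simp
  also have "\<dots> = (x - c)\<^sup>2 / s ^ 3"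
    using s by (simp add: diff_divide_distrib[symmetric] power_divide power3_eq_cube power2_eq_square)
  finally show ?thesis .
qed

lemma normal_density_deriv_bound:
  assumes s: "s > 0"
  shows "\<bar>gauss_slope s c v\<bar> \<le> 2 / s\<^sup>2"
proof -
  have 1: "\<bar>y * phi y\<bar> \<le> 2" for y
  proof -
    have "\<bar>y\<bar> \<le> exp (y\<^sup>2 / 2)"
    proof -
      have "2 * \<bar>y\<bar> \<le> 1 + \<bar>y\<bar>\<^sup>2" using sum_squares_bound[of 1 "\<bar>y\<bar>"] by simp
      then have "\<bar>y\<bar> \<le> 1 + y\<^sup>2 / 2" by simp
      also have "\<dots> \<le> exp (y\<^sup>2 / 2)" by (rule exp_ge_add_one_self)
      finally show ?thesis .
    qed
    then have "\<bar>y\<bar> * exp (- y\<^sup>2 / 2) \<le> exp (y\<^sup>2 / 2) * exp (- y\<^sup>2 / 2)" by (intro mult_right_mono) auto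
    also have "\<dots> = 1" by (simp flip: exp_add)
    finally have 2: "\<bar>y\<bar> * exp (- y\<^sup>2 / 2) \<le> 1" .
    have "1 / sqrt (2 * pi) \<le> 1" using pi_gt3 by simp
    then have "1 / sqrt (2 * pi) * (\<bar>y\<bar> * exp (- y\<^sup>2 / 2)) \<le> 1 * 1" using 2 by (intro mult_mono) auto
    moreover have "\<bar>y * phi y\<bar> = 1 / sqrt (2 * pi) * (\<bar>y\<bar> * exp (- y\<^sup>2 / 2))"
      by (simp add: std_normal_density_def abs_mult)
    ultimately show ?thesis by linarith
  qed
  have "gauss_slope s c v = - (((c - v) / s) * phi ((c - v) / s)) / s\<^sup>2"
    using s unfolding normal_density_std[OF s] by (simp add: field_simps)
  then have "\<bar>gauss_slope s c v\<bar> = \<bar>((c - v) / s) * phi ((c - v) / s)\<bar> / s\<^sup>2"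
    by (simp only: abs_divide abs_minus_cancel abs_power2)
  also have "\<dots> \<le> 2 / s\<^sup>2" by (intro divide_right_mono 1) simp
  finally show ?thesis .
qed

text \<open>The exponential series is integrated term by term. The partial sums of absolute values
  are dominated by \<open>\<bar>w v\<bar> * exp (\<bar>t\<bar> * \<bar>v\<bar>)\<close>;
  integrability for every \<open>t\<close> makes the radius of convergence infinite.\<close>

lemma entire_exponential_transform:
  fixes w :: "real \<Rightarrow> real"
  assumes [measurable]: "w \<in> borel_measurable borel"
    and int: "\<And>t. integrable lborel (\<lambda>v. \<bar>w v\<bar> * exp (t * \<bar>v\<bar>))"
  obtains F :: "complex \<Rightarrow> complex" where "\<And>\<rho>. F holomorphic_on ball 0 \<rho>"
    "\<And>x. F (of_real x) = of_real (LBINT v. w v * exp (x * v))"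
proof -
  define f where "f t n v = w v * (t * v) ^ n / fact n" for t :: real and n :: nat and v
  have fm[measurable]: "f t n \<in> borel_measurable borel" for t n unfolding f_def by measurable
  have exp_sums: "(\<lambda>n. (t * v) ^ n / fact n) sums exp (t * v)" for t v :: real
    using exp_converges[of "t * v"] by (simp add: divide_inverse mult.commute)
  have f_sums: "f t n v = w v * ((t * v) ^ n / fact n)" for t n v by (simp add: f_def)
  have sums: "(\<lambda>n. f t n v) sums (w v * exp (t * v))" for t v
    unfolding f_sums by (intro sums_mult exp_sums)
  have nf: "\<bar>f t n v\<bar> = \<bar>w v\<bar> * ((\<bar>t\<bar> * \<bar>v\<bar>) ^ n / fact n)" for t n v
    by (simp add: f_def abs_mult power_abs)
  have nsums: "(\<lambda>n. \<bar>f t n v\<bar>) sums (\<bar>w v\<bar> * exp (\<bar>t\<bar> * \<bar>v\<bar>))" for t v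
    unfolding nf by (intro sums_mult exp_sums)
  have fin_le: "(\<Sum>n<N. \<bar>f t n v\<bar>) \<le> \<bar>w v\<bar> * exp (\<bar>t\<bar> * \<bar>v\<bar>)" for N t v
    using nsums by (intro sum_le_suminf[of "\<lambda>n. \<bar>f t n v\<bar>" "{..<N}", THEN order_trans])
      (auto simp: sums_iff)
  have f_le: "\<bar>f t n v\<bar> \<le> \<bar>w v\<bar> * exp (\<bar>t\<bar> * \<bar>v\<bar>)" for t n v
  proof -
    have "\<bar>f t n v\<bar> \<le> (\<Sum>n<Suc n. \<bar>f t n v\<bar>)" by (rule member_le_sum) auto
    then show ?thesis using fin_le[of t v "Suc n"] by linarith
  qed
  have fint: "integrable lborel (f t n)" for t n
    by (rule Bochner_Integration.integrable_bound[OF int[of "\<bar>t\<bar>"]]) (auto intro!: AE_I2 f_le simp: abs_mult)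
  have sumint: "summable (\<lambda>n. LBINT v. \<bar>f t n v\<bar>)" for t
  proof (rule bounded_imp_summable)
    show "(\<Sum>k\<le>n. LBINT v. \<bar>f t k v\<bar>) \<le> (LBINT v. \<bar>w v\<bar> * exp (\<bar>t\<bar> * \<bar>v\<bar>))" for n
    proof -
      have "(\<Sum>k\<le>n. LBINT v. \<bar>f t k v\<bar>) = (LBINT v. (\<Sum>k\<le>n. \<bar>f t k v\<bar>))"
        using fint by simp
      also have "\<dots> \<le> (LBINT v. \<bar>w v\<bar> * exp (\<bar>t\<bar> * \<bar>v\<bar>))"
        using fint int fin_le[of t _ "Suc n"] by (intro integral_mono) (auto simp: lessThan_Suc_atMost)
      finally show ?thesis .
    qed
  qed auto
  define b where "b n = (LBINT v. w v * v ^ n / fact n)" for n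
  have bt: "b n * t ^ n = (LBINT v. f t n v)" for n t
  proof -
    have "b n * t ^ n = (LBINT v. w v * v ^ n / fact n * t ^ n)"
      unfolding b_def by (rule integral_mult_left_zero[symmetric])
    also have "\<dots> = (LBINT v. f t n v)"
      by (intro bochner_cong) (auto simp: f_def power_mult_distrib)
    finally show ?thesis .
  qed
  have real_sums: "(\<lambda>n. b n * t ^ n) sums (LBINT v. w v * exp (t * v))" for t
  proof -
    have "(\<lambda>n. LBINT v. f t n v) sums (LBINT v. (\<Sum>n. f t n v))"
      using fint sumint nsums by (intro sums_integral) (auto simp: sums_iff intro!: AE_I2)
    also have "(\<lambda>v. \<Sum>n. f t n v) = (\<lambda>v. w v * exp (t * v))" using sums by (auto simp: sums_iff)
    finally show ?thesis by (simp add: bt)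
  qed
  have abs_sum: "summable (\<lambda>n. \<bar>b n\<bar> * \<bar>t\<bar> ^ n)" for t
  proof (rule summable_comparison_test'[OF sumint[of t]])
    show "norm (\<bar>b n\<bar> * \<bar>t\<bar> ^ n) \<le> (LBINT v. \<bar>f t n v\<bar>)" for n
    proof -
      have "\<bar>b n\<bar> * \<bar>t\<bar> ^ n = \<bar>LBINT v. f t n v\<bar>"
        unfolding bt[symmetric] by (simp add: abs_mult power_abs)
      then show ?thesis using integral_abs_bound[of lborel "f t n"] by simp
    qed
  qed
  define F where "F z = (\<Sum>n. of_real (b n) * z ^ n)" for z :: complex
  have Fs: "(\<lambda>n. of_real (b n) * z ^ n) sums F z" for z :: complex
    unfolding F_def
    by (intro summable_sums summable_norm_cancel[of "\<lambda>n. of_real (b n) * z ^ n"])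
       (use abs_sum[of "norm z"] in \<open>simp add: norm_mult norm_power\<close>)
  have "F holomorphic_on ball 0 \<rho>" for \<rho>
    by (rule power_series_holomorphic[of _ _ "\<lambda>n. of_real (b n)"]) (use Fs in simp)
  moreover have "F (of_real x) = of_real (LBINT v. w v * exp (x * v))" for x
  proof -
    have "(\<lambda>n. of_real (b n * x ^ n)) sums (of_real (LBINT v. w v * exp (x * v)) :: complex)"
      by (intro sums_of_real real_sums)
    then show ?thesis using Fs[of "of_real x"] sums_unique2 by fastforce
  qed
  ultimately show ?thesis using that by blast
qed

section \<open>The signal structure\<close>

locale signal =
  fixes \<theta> st se p :: real
  assumes st: "st > 0" and se: "se > 0" and p: "p > 0"
begin

definition "sd = sqrt (st\<^sup>2 + se\<^sup>2)"
definition "pm x = st\<^sup>2 / (se\<^sup>2 + st\<^sup>2) * x + (1 - st\<^sup>2 / (se\<^sup>2 + st\<^sup>2)) * \<theta>"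
definition "sv = sqrt (se\<^sup>2 * st\<^sup>2 / (se\<^sup>2 + st\<^sup>2))"
definition policies :: "(real \<Rightarrow> real) set" where "policies = {r \<in> borel_measurable borel. \<forall>v. r v \<in> {0..p}}"
abbreviation "prior \<equiv> normal_density \<theta> st"
abbreviation "post x \<equiv> normal_density (pm x) sv"
definition "R r x = (LBINT v. post x v * r v)" for r :: "real \<Rightarrow> real"
definition "f = normal_density \<theta> sd"
text \<open>The expected rebate weighted by the valuation density, written with the prior: only the
  noise density depends on \<open>x\<close>, and its derivative in \<open>x\<close> produces
  \<open>A'\<close>.\<close>

definition "A h x = (LBINT v. prior v * (normal_density v se x * h v))" for h :: "real \<Rightarrow> real"
definition "A' h c = (LBINT v. prior v * (gauss_slope se c v * h v))" for h :: "real \<Rightarrow> real"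
definition "surplus r x = R r x + x - p"
abbreviation "tight_points r \<equiv> {x. surplus r x = 0}"
abbreviation "obedient \<equiv> feasible \<theta> st se p"
abbreviation "optimal \<equiv> optimal_program \<theta> st se p"
abbreviation "base_profit \<equiv> no_reward_profit \<theta> sd p"
definition "g r x = f x * surplus r x"

lemma ss: "se\<^sup>2 + st\<^sup>2 > 0" "st\<^sup>2 + se\<^sup>2 > 0"
  using st se by (simp_all add: add_pos_pos)

lemma sd: "sd > 0" "sd\<^sup>2 = st\<^sup>2 + se\<^sup>2" and sv: "sv > 0" "sv\<^sup>2 = se\<^sup>2 * st\<^sup>2 / (se\<^sup>2 + st\<^sup>2)"
  using ss st se by (simp_all add: sd_def sv_def)

lemma f_pos: "f x > 0" unfolding f_def by (rule normal_density_pos[OF sd(1)])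

lemma f_measurable [measurable]: "f \<in> borel_measurable borel" by (simp add: f_def)

lemma policiesD:
  assumes "r \<in> policies"
  shows "r \<in> borel_measurable borel" "0 \<le> r v" "r v \<le> p" "\<bar>r v\<bar> \<le> p"
  using assms by (auto simp: policies_def)

lemma convex_policies: "convex_functions policies"
  unfolding convex_functions_def
proof (intro ballI)
  fix a b t assume ab: "a \<in> policies" "b \<in> policies" and t: "t \<in> {0..1::real}"
  have [measurable]: "a \<in> borel_measurable borel" "b \<in> borel_measurable borel" using ab policiesD by auto
  have "0 \<le> (1 - t) * a v + t * b v \<and> (1 - t) * a v + t * b v \<le> p" for v
  proof
    show "0 \<le> (1 - t) * a v + t * b v" using t policiesD(2)[OF ab(1)] policiesD(2)[OF ab(2)] by simp
    have "(1 - t) * a v + t * b v \<le> (1 - t) * p + t * p"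
      using t policiesD(3)[OF ab(1)] policiesD(3)[OF ab(2)] by (intro add_mono mult_left_mono) auto
    then show "(1 - t) * a v + t * b v \<le> p" by (simp add: algebra_simps)
  qed
  then show "(mix t a b) \<in> policies" unfolding policies_def by simp
qed

lemma const_policy: "0 \<le> k \<Longrightarrow> k \<le> p \<Longrightarrow> (\<lambda>v. k) \<in> policies"
  by (simp add: policies_def)

lemma pm_eq: "pm x = (st\<^sup>2 * x + se\<^sup>2 * \<theta>) / (se\<^sup>2 + st\<^sup>2)"
proof -
  have "1 - st\<^sup>2 / (se\<^sup>2 + st\<^sup>2) = se\<^sup>2 / (se\<^sup>2 + st\<^sup>2)"
    using ss(1) by (metis add_diff_cancel_right' diff_divide_distrib divide_self less_irrefl)
  then show ?thesis by (simp add: pm_def add_divide_distrib)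
qed

text \<open>Bayes' rule: two factorisations of the joint density of quality and valuation. The
  exponents agree by completing the square in \<open>v\<close>, the constants because
  \<open>sd * sv = st * se\<close>.\<close>

lemma joint_density:
  "prior v * normal_density v se x = f x * post x v"
proof -
  have c: "sqrt (2 * pi * st\<^sup>2) * sqrt (2 * pi * se\<^sup>2) = sqrt (2 * pi * sd\<^sup>2) * sqrt (2 * pi * sv\<^sup>2)"
  proof -
    have "2 * pi * st\<^sup>2 * (2 * pi * se\<^sup>2) = 2 * pi * sd\<^sup>2 * (2 * pi * sv\<^sup>2)"
    proof -
      have "sd\<^sup>2 * sv\<^sup>2 = se\<^sup>2 * st\<^sup>2" unfolding sd sv using ss by (simp add: add.commute)
      then show ?thesis by (simp add: mult_ac)
    qed
    then show ?thesis unfolding real_sqrt_mult[symmetric] by simp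
  qed
  have e: "- (v - \<theta>)\<^sup>2 / (2 * st\<^sup>2) + - (x - v)\<^sup>2 / (2 * se\<^sup>2) =
      - (x - \<theta>)\<^sup>2 / (2 * sd\<^sup>2) + - (v - pm x)\<^sup>2 / (2 * sv\<^sup>2)"
  proof -
    define S where "S = se\<^sup>2 + st\<^sup>2"
    have S: "S > 0" "st\<^sup>2 + se\<^sup>2 = S" "se\<^sup>2 = S - st\<^sup>2" using ss by (auto simp: S_def)
    have "pm x = (st\<^sup>2 * x + se\<^sup>2 * \<theta>) / S" unfolding S_def by (rule pm_eq)
    then have "v - pm x = (S * v - st\<^sup>2 * x - se\<^sup>2 * \<theta>) / S"
      using S(1) by (simp add: field_simps)
    then have 1: "(v - pm x)\<^sup>2 = (S * v - st\<^sup>2 * x - se\<^sup>2 * \<theta>)\<^sup>2 / S\<^sup>2"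
      by (simp only: power_divide)
    have 2: "- (v - pm x)\<^sup>2 / (2 * sv\<^sup>2) = - (S * v - st\<^sup>2 * x - se\<^sup>2 * \<theta>)\<^sup>2 / (2 * se\<^sup>2 * st\<^sup>2 * S)"
      unfolding sv 1 S_def[symmetric] using S(1) st se by (simp add: field_simps power2_eq_square)
    have 3: "(S * v - st\<^sup>2 * x - se\<^sup>2 * \<theta>) = se\<^sup>2 * (v - \<theta>) + st\<^sup>2 * (v - x)"
      unfolding S_def by (simp add: algebra_simps)
    have "(v - \<theta>)\<^sup>2 * se\<^sup>2 * S + (x - v)\<^sup>2 * st\<^sup>2 * S =
        (x - \<theta>)\<^sup>2 * se\<^sup>2 * st\<^sup>2 + (se\<^sup>2 * (v - \<theta>) + st\<^sup>2 * (v - x))\<^sup>2"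
      unfolding S_def power2_eq_square by (simp add: algebra_simps)
    then have "((v - \<theta>)\<^sup>2 * se\<^sup>2 * S + (x - v)\<^sup>2 * st\<^sup>2 * S) / (2 * se\<^sup>2 * st\<^sup>2 * S) =
        ((x - \<theta>)\<^sup>2 * se\<^sup>2 * st\<^sup>2 + (se\<^sup>2 * (v - \<theta>) + st\<^sup>2 * (v - x))\<^sup>2) / (2 * se\<^sup>2 * st\<^sup>2 * S)"
      by simp
    then have "(v - \<theta>)\<^sup>2 / (2 * st\<^sup>2) + (x - v)\<^sup>2 / (2 * se\<^sup>2) =
        (x - \<theta>)\<^sup>2 / (2 * S) + (se\<^sup>2 * (v - \<theta>) + st\<^sup>2 * (v - x))\<^sup>2 / (2 * se\<^sup>2 * st\<^sup>2 * S)"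
      unfolding add_divide_distrib using S(1) st se by (simp add: mult_ac)
    then show ?thesis unfolding 2 3 sd S(2) by simp
  qed
  have "prior v * normal_density v se x =
      1 / (sqrt (2 * pi * st\<^sup>2) * sqrt (2 * pi * se\<^sup>2)) * exp (- (v - \<theta>)\<^sup>2 / (2 * st\<^sup>2) + - (x - v)\<^sup>2 / (2 * se\<^sup>2))"
    unfolding exp_add normal_density_def by simp
  also have "\<dots> = f x * post x v"
    unfolding c e unfolding exp_add normal_density_def f_def by simp
  finally show ?thesis .
qed

section \<open>Differentiation of weighted expectations in the valuation\<close>

lemma A_eq: "A h x = f x * R h x"
  unfolding A_def R_def mult.assoc[symmetric] joint_density
  by (simp add: mult.assoc)

lemma measurable_normal_density_mean [measurable]:
  "(\<lambda>v. normal_density v s x) \<in> borel_measurable borel"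
  unfolding normal_density_def by measurable

lemma A_integrable:
  assumes [measurable]: "h \<in> borel_measurable borel" and h: "\<And>v. \<bar>h v\<bar> \<le> B"
  shows "integrable lborel (\<lambda>v. prior v * (normal_density v se x * h v))"
proof (rule integrable_normal_density_mult[OF st, where B = "1 / se * B"])
  fix v
  show "\<bar>normal_density v se x * h v\<bar> \<le> 1 / se * B"
    unfolding abs_mult using h[of v] normal_density_le_inverse[OF se, of v x] se by (intro mult_mono) auto
qed measurable

lemma A'_integrable:
  assumes [measurable]: "h \<in> borel_measurable borel" and h: "\<And>v. \<bar>h v\<bar> \<le> B"
  shows "integrable lborel (\<lambda>v. prior v * (gauss_slope se x v * h v))"
proof (rule integrable_normal_density_mult[OF st, where B = "2 / se\<^sup>2 * B"])
  fix v
  show "\<bar>gauss_slope se x v * h v\<bar> \<le> 2 / se\<^sup>2 * B"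
    unfolding abs_mult[of _ "h v"] using h[of v] se by (intro mult_mono normal_density_deriv_bound) auto
qed measurable

lemma A_taylor:
  assumes [measurable]: "h \<in> borel_measurable borel" and h: "\<And>v. \<bar>h v\<bar> \<le> B"
  shows "\<bar>A h x - A h c - (x - c) * A' h c\<bar> \<le> B * (x - c)\<^sup>2 / se ^ 3"
proof -
  define e where "e v = (normal_density v se x - normal_density v se c -
      (x - c) * gauss_slope se c v) * h v" for v
  have e: "\<bar>e v\<bar> \<le> (x - c)\<^sup>2 / se ^ 3 * B" for v
    unfolding e_def abs_mult[of _ "h v"] using h[of v] se by (intro mult_mono normal_density_taylor) auto
  have [measurable]: "e \<in> borel_measurable borel" unfolding e_def by measurable
  have "A h x - A h c - (x - c) * A' h c = (LBINT v. prior v * (normal_density v se x * h v) -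
      prior v * (normal_density v se c * h v) -
      (x - c) * (prior v * (gauss_slope se c v * h v)))"
    unfolding A_def A'_def using A_integrable[OF assms] A'_integrable[OF assms]
    by (simp only: Bochner_Integration.integral_diff integral_mult_right_zero integrable_mult_right
        Bochner_Integration.integrable_diff)
  also have "\<dots> = (LBINT v. prior v * e v)"
    unfolding e_def by (intro bochner_cong) (auto simp: algebra_simps)
  finally have eq: "A h x - A h c - (x - c) * A' h c = (LBINT v. prior v * e v)" .
  have "\<bar>LBINT v. prior v * e v\<bar> \<le> (LBINT v. \<bar>prior v * e v\<bar>)"
    by (rule integral_abs_bound)
  also have "\<dots> \<le> (LBINT v. ((x - c)\<^sup>2 / se ^ 3 * B) * prior v)"
  proof (rule integral_mono)
    show "integrable lborel (\<lambda>v. \<bar>prior v * e v\<bar>)"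
      by (intro integrable_abs integrable_normal_density_mult[OF st _ e]) measurable
    show "\<bar>prior v * e v\<bar> \<le> ((x - c)\<^sup>2 / se ^ 3 * B) * prior v" for v
      using mult_left_mono[OF e[of v], of "prior v"] by (simp add: abs_mult mult.commute)
  qed (use st in simp)
  also have "\<dots> = B * (x - c)\<^sup>2 / se ^ 3" using st by simp
  finally show ?thesis unfolding eq .
qed

text \<open>The remainder in \<open>A_taylor\<close> is quadratic in \<open>x - c\<close>, so the
  difference quotient misses \<open>A' h c\<close> by at most a multiple of
  \<open>\<bar>x - c\<bar>\<close>.\<close>

lemma A_deriv:
  assumes "h \<in> borel_measurable borel" and "\<And>v. \<bar>h v\<bar> \<le> B"
  shows "(A h has_real_derivative A' h c) (at c)"
proof -
  have "((\<lambda>x. (A h x - A h c) / (x - c) - A' h c) \<longlongrightarrow> 0) (at c)"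
  proof (rule tendsto_rabs_zero_cancel, rule tendsto_sandwich[where f = "\<lambda>_. 0" and h = "\<lambda>x. B / se ^ 3 * \<bar>x - c\<bar>"])
    show "((\<lambda>x. B / se ^ 3 * \<bar>x - c\<bar>) \<longlongrightarrow> 0) (at c)" using se by (auto intro!: tendsto_eq_intros)
    show "\<forall>\<^sub>F x in at c. \<bar>(A h x - A h c) / (x - c) - A' h c\<bar> \<le> B / se ^ 3 * \<bar>x - c\<bar>"
      unfolding eventually_at_filter
    proof (intro always_eventually allI impI)
      fix x assume x: "x \<noteq> c"
      have "(A h x - A h c) / (x - c) - A' h c = (A h x - A h c - (x - c) * A' h c) / (x - c)"
        using x by (simp add: field_simps)
      then have "\<bar>(A h x - A h c) / (x - c) - A' h c\<bar> = \<bar>A h x - A h c - (x - c) * A' h c\<bar> / \<bar>x - c\<bar>"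
        by simp
      also have "\<dots> \<le> (B * (x - c)\<^sup>2 / se ^ 3) / \<bar>x - c\<bar>"
        by (intro divide_right_mono A_taylor assms) auto
      also have "\<dots> = B / se ^ 3 * \<bar>x - c\<bar>" 
      proof -
        have "B * d\<^sup>2 / se ^ 3 / d = B / se ^ 3 * d" if "d \<noteq> 0" for d
          using that by (simp add: power2_eq_square)
        from this[of "\<bar>x - c\<bar>"] show ?thesis using x by simp
      qed
      finally show "\<bar>(A h x - A h c) / (x - c) - A' h c\<bar> \<le> B / se ^ 3 * \<bar>x - c\<bar>" .
    qed
  qed auto
  then have "((\<lambda>x. (A h x - A h c) / (x - c)) \<longlongrightarrow> A' h c) (at c)" by (rule LIM_zero_cancel)
  then show ?thesis unfolding has_field_derivative_iff .
qed

section \<open>Expected rebates and buyers' surplus\<close>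

lemma R_integrable: "r \<in> policies \<Longrightarrow> integrable lborel (\<lambda>v. post x v * r v)"
  by (rule integrable_normal_density_mult[OF sv(1)]) (auto dest: policiesD)

lemma R_const [simp]: "R (\<lambda>v. k) x = k"
  unfolding R_def using sv(1) by simp

lemma R_mono: "r \<in> policies \<Longrightarrow> r' \<in> policies \<Longrightarrow> (\<And>v. r v \<le> r' v) \<Longrightarrow> R r x \<le> R r' x"
  unfolding R_def by (intro integral_mono R_integrable mult_left_mono) auto

lemma R_range:
  assumes "r \<in> policies" shows "0 \<le> R r x" "R r x \<le> p"
  using R_mono[OF const_policy[of 0] assms, of x] R_mono[OF assms const_policy[of p], of x] p policiesD[OF assms]
  by auto

lemma buyer_surplus_eq: "r \<in> policies \<Longrightarrow> buyer_surplus \<theta> st se p r x = surplus r x"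
  unfolding buyer_surplus_def posterior_def Let_def surplus_def R_def
  by (subst integral_normal_distribution) (auto dest: policiesD simp: pm_def sv_def)

lemma R_affine: "affine_on policies (\<lambda>r. R r x)"
  unfolding affine_on_def
proof (intro ballI)
  fix a b t assume ab: "a \<in> policies" "b \<in> policies" and "t \<in> {0..1::real}"
  have "R (mix t a b) x =
      (LBINT v. (1 - t) * (post x v * a v) + t * (post x v * b v))"
    unfolding R_def by (intro bochner_cong) (auto simp: algebra_simps)
  also have "\<dots> = (1 - t) * R a x + t * R b x"
    unfolding R_def using R_integrable[OF ab(1)] R_integrable[OF ab(2)] by simp
  finally show "R (mix t a b) x = (1 - t) * R a x + t * R b x" .
qed

lemma surplus_mix:
  assumes "a \<in> policies" "b \<in> policies" "0 \<le> t" "t \<le> 1"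
  shows "surplus (mix t a b) x = (1 - t) * surplus a x + t * surplus b x"
  using affine_onD[OF R_affine assms] by (simp add: surplus_def algebra_simps)

text \<open>The constant rebate \<open>p - c\<close> has surplus \<open>x - c\<close>. Subtracting
  it leaves a summand that is differentiated through the kernel and a product with the factor
  \<open>x - c\<close>; hence the derivative at \<open>c\<close> is affine in \<open>r\<close> and
  involves \<open>f c\<close> but not the derivative of \<open>f\<close>.\<close>

lemma g_eq:
  assumes r: "r \<in> policies"
  shows "g r x = A (\<lambda>v. r v - (p - c)) x + (x - c) * f x"
proof -
  have "R (\<lambda>v. r v - (p - c)) x = (LBINT v. post x v * r v - post x v * (p - c))"
    unfolding R_def by (intro bochner_cong) (auto simp: algebra_simps)
  also have "\<dots> = R r x - (p - c)"
    unfolding R_def using R_integrable[OF r] sv by simp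
  finally show ?thesis unfolding A_eq g_def surplus_def by (simp only:) (simp add: algebra_simps)
qed

definition "g' r c = A' (\<lambda>v. r v - (p - c)) c + f c" for r :: "real \<Rightarrow> real"

lemma g_deriv:
  assumes r: "r \<in> policies" shows "(g r has_real_derivative g' r c) (at c)"
proof -
  have fd: "(f has_real_derivative A' (\<lambda>v. 1) x) (at x)" for x
  proof -
    have "A (\<lambda>v. 1) = f" by (rule ext) (simp add: A_eq)
    then show ?thesis using A_deriv[of "\<lambda>v. 1" 1] by simp
  qed
  have "(A (\<lambda>v. r v - (p - c)) has_real_derivative A' (\<lambda>v. r v - (p - c)) c) (at c)"
  proof (rule A_deriv)
    show "\<bar>r v - (p - c)\<bar> \<le> p + \<bar>p - c\<bar>" for v using policiesD(4)[OF r, of v] by linarith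
  qed (use policiesD(1)[OF r] in measurable)
  then have "((\<lambda>x. A (\<lambda>v. r v - (p - c)) x + (x - c) * f x) has_real_derivative g' r c) (at c)"
    unfolding g'_def by (auto intro!: derivative_eq_intros fd)
  then show ?thesis using g_eq[OF r, of _ c] by presburger
qed

lemma isCont_g: "r \<in> policies \<Longrightarrow> isCont (g r) x"
  using g_deriv DERIV_isCont by blast

lemma isCont_surplus:
  assumes r: "r \<in> policies" shows "isCont (surplus r) x"
proof -
  have "surplus r = (\<lambda>x. g r x / f x)" using f_pos by (auto simp: g_def less_imp_neq[symmetric])
  moreover have "isCont f x" unfolding f_def using continuous_on_normal_density[of UNIV]
    by (simp add: continuous_on_eq_continuous_at)
  ultimately show ?thesis using f_pos[of x] isCont_g[OF r] by (auto intro!: continuous_intros)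
qed

lemma g'_affine: "affine_on policies (\<lambda>r. g' r c)"
  unfolding affine_on_def
proof (intro ballI)
  fix a b t assume ab: "a \<in> policies" "b \<in> policies" and "t \<in> {0..1::real}"
  define k where "k v = prior v" for v
  define j where "j v = gauss_slope se c v" for v
  have i: "integrable lborel (\<lambda>v. k v * (j v * (r v - (p - c))))" if r: "r \<in> policies" for r
    unfolding k_def j_def
  proof (rule A'_integrable)
    show "\<bar>r v - (p - c)\<bar> \<le> p + \<bar>p - c\<bar>" for v using policiesD(4)[OF r, of v] by linarith
  qed (use policiesD(1)[OF r] in measurable)
  have "A' (\<lambda>v. ((1 - t) * a v + t * b v) - (p - c)) c =
      (LBINT v. (1 - t) * (k v * (j v * (a v - (p - c)))) + t * (k v * (j v * (b v - (p - c)))))"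
    unfolding A'_def k_def[symmetric] j_def[symmetric]
    by (intro bochner_cong) (auto simp: algebra_simps)
  also have "\<dots> = (1 - t) * A' (\<lambda>v. a v - (p - c)) c + t * A' (\<lambda>v. b v - (p - c)) c"
    unfolding A'_def k_def[symmetric] j_def[symmetric] using i[OF ab(1)] i[OF ab(2)] by simp
  finally show "g' (mix t a b) c = (1 - t) * g' a c + t * g' b c"
    unfolding g'_def by (simp add: algebra_simps)
qed

lemma g'_const: "g' (\<lambda>v. p - c) c = f c"
  by (simp add: g'_def A'_def)

text \<open>Together with \<open>surplus_neg\<close> this confines all ties to the compact interval
  \<open>{0..p}\<close>.\<close>

lemma surplus_pos: "r \<in> policies \<Longrightarrow> x > p \<Longrightarrow> surplus r x > 0"
  using R_range(1)[of r x] by (simp add: surplus_def)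

lemma surplus_neg: "r \<in> policies \<Longrightarrow> x < 0 \<Longrightarrow> surplus r x < 0"
  using R_range(2)[of r x] by (simp add: surplus_def)

end

section \<open>Existence of an optimal program\<close>

lemma normal_integral_tendsto:
  assumes s: "s > 0" and [measurable]: "\<And>n. u n \<in> borel_measurable borel" "w \<in> borel_measurable borel"
    and B: "\<And>n v. \<bar>u n v\<bar> \<le> B" and lim: "AE v in lborel. (\<lambda>n. u n v) \<longlonglongrightarrow> w v"
  shows "(\<lambda>n. LBINT v. normal_density m s v * u n v) \<longlonglongrightarrow> (LBINT v. normal_density m s v * w v)"
proof (rule integral_dominated_convergence[where w = "\<lambda>v. B * normal_density m s v"])
  show "integrable lborel (\<lambda>v. B * normal_density m s v)" using s by simp
  show "AE v in lborel. (\<lambda>n. normal_density m s v * u n v) \<longlonglongrightarrow> normal_density m s v * w v"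
    using lim by eventually_elim (intro tendsto_intros)
  show "AE v in lborel. norm (normal_density m s v * u n v) \<le> B * normal_density m s v" for n
  proof (rule AE_I2)
    fix v
    show "norm (normal_density m s v * u n v) \<le> B * normal_density m s v"
      using mult_left_mono[OF B[of n v], of "normal_density m s v"] by (simp add: abs_mult mult.commute)
  qed
qed measurable

context signal
begin

section \<open>The seller's profit as a function of rebate and cutoff\<close>

definition "profit r c = expected_profit \<theta> st se p (r, c)"

lemma profit_integrable:
  assumes r: "r \<in> policies"
  shows "integrable lborel (\<lambda>v. prior v * ((p - r v) * Phi ((v - c) / se)))"
proof (rule integrable_normal_density_mult[OF st, where B = "p * 1"])
  note [measurable] = policiesD(1)[OF r]
  show "(\<lambda>v. (p - r v) * Phi ((v - c) / se)) \<in> borel_measurable borel" by measurable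
  show "\<bar>(p - r v) * Phi ((v - c) / se)\<bar> \<le> p * 1" for v
    unfolding abs_mult using policiesD(2,3)[OF r, of v] p by (intro mult_mono) auto
qed

lemma profit_eq:
  assumes r: "r \<in> policies"
  shows "profit r c = (LBINT v. prior v * ((p - r v) * Phi ((v - c) / se)))"
proof -
  note [measurable] = policiesD(1)[OF r]
  show ?thesis unfolding profit_def expected_profit_def
    by (simp add: integral_normal_distribution)
qed

lemma R_measurable [measurable]:
  assumes "r \<in> policies" shows "R r \<in> borel_measurable borel"
proof -
  have "R r = (\<lambda>x. surplus r x - x + p)" by (auto simp: surplus_def)
  moreover have "surplus r \<in> borel_measurable borel"
    by (intro borel_measurable_continuous_onI continuous_at_imp_continuous_on ballI isCont_surplus assms)
  ultimately show ?thesis by simp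
qed

text \<open>\<open>Phi ((v - c) / se)\<close> is the probability that a valuation exceeds
  \<open>c\<close> at quality \<open>v\<close>; exchanging the two integrals conditions on the
  valuation instead.\<close>

lemma profit_eq_valuation:
  assumes r: "r \<in> policies"
  shows "profit r c = (LBINT x. f x * ((p - R r x) * indicator {c<..} x))"
proof -
  note [measurable] = policiesD(1)[OF r]
  define h where "h v x = prior v * (normal_density v se x * ((p - r v) * indicator {c<..} x))" for v x :: real
  have hm[measurable]: "case_prod h \<in> borel_measurable (lborel \<Otimes>\<^sub>M lborel)"
    unfolding h_def normal_density_def by measurable
  have h0: "h v x \<ge> 0" for v x using policiesD(3)[OF r, of v] by (simp add: h_def)
  have inner: "(LBINT x. h v x) = prior v * ((p - r v) * Phi ((v - c) / se))" for v
  proof -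
    have "(LBINT x. h v x) = (LBINT x. (prior v * (p - r v)) * (normal_density v se x * indicator {c<..} x))"
      unfolding h_def by (intro bochner_cong) auto
    also have "\<dots> = (prior v * (p - r v)) * Phi ((v - c) / se)"
      by (simp add: normal_upper_tail[OF se])
    finally show ?thesis by simp
  qed
  have int: "integrable (lborel \<Otimes>\<^sub>M lborel) (case_prod h)"
  proof (rule lborel_pair.Fubini_integrable)
    show "integrable lborel (\<lambda>v. LBINT x. norm (case_prod h (v, x)))"
      using h0 profit_integrable[OF r, of c] by (simp add: inner)
    have "integrable lborel (\<lambda>x. (prior v * (p - r v)) * (normal_density v se x * indicator {c<..} x))" for v
      by (intro integrable_mult_right integrable_normal_density_mult[OF se, where B = 1]) (auto simp: indicator_def)
    then show "AE v in lborel. integrable lborel (\<lambda>x. case_prod h (v, x))"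
      by (simp add: h_def mult_ac)
  qed measurable
  have "profit r c = (LBINT v. LBINT x. h v x)"
    by (simp add: inner profit_eq[OF r])
  also have "\<dots> = (LBINT x. LBINT v. h v x)"
    by (rule lborel_pair.Fubini_integral[OF int, symmetric])
  also have "\<dots> = (LBINT x. f x * ((p - R r x) * indicator {c<..} x))"
  proof (rule bochner_cong)
    fix x
    have "(LBINT v. h v x) = (LBINT v. (f x * indicator {c<..} x) * (p * post x v - post x v * r v))"
      unfolding h_def mult.assoc[symmetric] joint_density
      by (intro bochner_cong) (auto simp: algebra_simps)
    also have "\<dots> = (f x * indicator {c<..} x) * (p - R r x)"
      unfolding integral_mult_right_zero using R_integrable[OF r, of x] sv by (simp add: R_def)
    finally show "(LBINT v. h v x) = f x * ((p - R r x) * indicator {c<..} x)" by simp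
  qed simp
  finally show ?thesis .
qed

lemma profit_le:
  assumes r: "r \<in> policies" shows "profit r c \<le> p"
proof -
  have "profit r c \<le> (LBINT v. p * prior v)"
    unfolding profit_eq[OF r]
  proof (rule integral_mono[OF profit_integrable[OF r]])
    fix v
    have "(p - r v) * Phi ((v - c) / se) \<le> p * 1"
      using policiesD(2,3)[OF r, of v] p by (intro mult_mono) auto
    from mult_left_mono[OF this, of "prior v"]
    show "prior v * ((p - r v) * Phi ((v - c) / se)) \<le> p * prior v"
      by (simp add: mult.commute)
  qed (use st in simp)
  then show ?thesis using st by simp
qed

text \<open>The constant is uniform in the rebate, so a near-optimal rebate with its own cutoff
  \<open>c'\<close> may be evaluated at a common limit cutoff.\<close>

lemma profit_lipschitz:
  assumes r: "r \<in> policies" shows "profit r c - profit r c' \<le> p / se * \<bar>c - c'\<bar>"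
proof -
  have "profit r c - profit r c' = (LBINT v. prior v * ((p - r v) * Phi ((v - c) / se)) -
      prior v * ((p - r v) * Phi ((v - c') / se)))"
    unfolding profit_eq[OF r] using profit_integrable[OF r] by simp
  also have "\<dots> \<le> (LBINT v. (p / se * \<bar>c - c'\<bar>) * prior v)"
  proof (rule integral_mono)
    fix v
    have "Phi ((v - c) / se) - Phi ((v - c') / se) \<le> \<bar>(v - c) / se - (v - c') / se\<bar>"
      using Phi_lipschitz[of "(v - c) / se" "(v - c') / se"] by linarith
    also have "\<dots> = \<bar>c - c'\<bar> / se" using se by (simp add: diff_divide_distrib[symmetric] abs_minus_commute)
    finally have "(p - r v) * (Phi ((v - c) / se) - Phi ((v - c') / se)) \<le> (p - r v) * (\<bar>c - c'\<bar> / se)"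
      using policiesD(3)[OF r, of v] by (intro mult_left_mono) auto
    also have "\<dots> \<le> p * (\<bar>c - c'\<bar> / se)"
      using policiesD(2)[OF r, of v] se by (intro mult_right_mono) auto
    finally have "prior v * ((p - r v) * (Phi ((v - c) / se) - Phi ((v - c') / se)))
        \<le> prior v * (p * (\<bar>c - c'\<bar> / se))" by (intro mult_left_mono) auto
    then show "prior v * ((p - r v) * Phi ((v - c) / se)) -
      prior v * ((p - r v) * Phi ((v - c') / se)) \<le> (p / se * \<bar>c - c'\<bar>) * prior v"
      by (simp add: algebra_simps)
  qed (use profit_integrable[OF r] st in auto)
  also have "\<dots> = p / se * \<bar>c - c'\<bar>" using st by simp
  finally show ?thesis .
qed

lemma profit_affine: "affine_on policies (\<lambda>r. profit r c)"
  unfolding affine_on_def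
proof (intro ballI)
  fix a b t assume ab: "a \<in> policies" "b \<in> policies" and t: "t \<in> {0..1::real}"
  have m: "(mix t a b) \<in> policies" using convex_functionsD[OF convex_policies ab] t by simp
  show "profit (mix t a b) c = (1 - t) * profit a c + t * profit b c"
  proof -
    have "profit (mix t a b) c =
        (LBINT v. (1 - t) * (prior v * ((p - a v) * Phi ((v - c) / se))) +
           t * (prior v * ((p - b v) * Phi ((v - c) / se))))"
      unfolding profit_eq[OF m] by (intro bochner_cong) (auto simp: algebra_simps)
    also have "\<dots> = (1 - t) * profit a c + t * profit b c"
      unfolding profit_eq[OF ab(1)] profit_eq[OF ab(2)]
      using profit_integrable[OF ab(1), of c] profit_integrable[OF ab(2), of c]
      by (simp only: Bochner_Integration.integral_add integrable_mult_right integral_mult_right_zero)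
    finally show ?thesis .
  qed
qed

lemma feasible_iff:
  "obedient (r, c) \<longleftrightarrow>
    r \<in> policies \<and> (\<forall>x\<ge>c. surplus r x \<ge> 0) \<and> (\<forall>x\<le>c. surplus r x \<le> 0)"
  unfolding feasible_def using buyer_surplus_eq[of r] by (auto simp: policies_def)

lemma feasible_cutoff:
  assumes "obedient (r, c)"
  shows "surplus r c = 0" "0 \<le> c" "c \<le> p"
proof -
  have r: "r \<in> policies" using assms feasible_iff by blast
  show *: "surplus r c = 0" using assms feasible_iff by (meson antisym order_refl)
  show "0 \<le> c" "c \<le> p" using * R_range[OF r, of c] by (auto simp: surplus_def)
qed

lemma no_reward_feasible: "obedient (\<lambda>v. 0, p)"
  unfolding feasible_iff using p by (auto simp: const_policy surplus_def)

lemma no_reward_profit_eq: "profit (\<lambda>v. 0) p = base_profit"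
proof -
  have "profit (\<lambda>v. 0) p = (LBINT x. p * (f x * indicator {p<..} x))"
    using const_policy[of 0] p by (simp add: profit_eq_valuation mult_ac)
  then show ?thesis by (simp add: no_reward_profit_def f_def normal_upper_tail[OF sd(1)])
qed

lemma optimal_exists: "\<exists>rc. optimal_program \<theta> st se p rc"
proof -
  define V where "V = Sup {profit r c |r c. obedient (r, c)}"
  have bdd: "bdd_above {profit r c |r c. obedient (r, c)}"
    using profit_le by (intro bdd_aboveI[of _ p]) (auto simp: feasible_iff)
  have leV: "profit r c \<le> V" if "obedient (r, c)" for r c
    unfolding V_def using that bdd by (intro cSup_upper) auto
  have "\<exists>r c. obedient (r, c) \<and> V - 1 / Suc n < profit r c" for n
  proof -
    have "\<exists>y\<in>{profit r c |r c. obedient (r, c)}. V - 1 / Suc n < y"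
      unfolding V_def using no_reward_feasible by (intro less_cSupD) auto
    then show ?thesis by blast
  qed
  then obtain r0 c0 where rc: "\<And>n. obedient (r0 n, c0 n)" "\<And>n. V - 1 / Suc n < profit (r0 n) (c0 n)"
    by metis
  have "\<forall>n. c0 n \<in> {0..p}" using feasible_cutoff(2,3)[OF rc(1)] by auto
  then obtain c k where k: "strict_mono k" "(c0 \<circ> k) \<longlonglongrightarrow> c"
    using compact_Icc[of 0 p] unfolding compact_eq_seq_compact_metric seq_compact_def by blast
  have near: "\<exists>r c'. obedient (r, c') \<and> \<bar>c' - c\<bar> < 1 / Suc n \<and> V - 1 / Suc n < profit r c'" for n
  proof -
    have "\<forall>\<^sub>F i in sequentially. dist ((c0 \<circ> k) i) c < 1 / Suc n"
      using k(2) by (rule tendstoD) simp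
    then obtain N where N: "\<And>i. i \<ge> N \<Longrightarrow> dist ((c0 \<circ> k) i) c < 1 / Suc n"
      unfolding eventually_sequentially by blast
    define i where "i = k (max N n)"
    have "n \<le> i" unfolding i_def using seq_suble[OF k(1), of "max N n"] by simp
    then have "1 / real (Suc i) \<le> 1 / real (Suc n)" by (intro divide_left_mono) auto
    then have "V - 1 / Suc n < profit (r0 i) (c0 i)" using rc(2)[of i] by linarith
    moreover have "\<bar>c0 i - c\<bar> < 1 / Suc n" using N[of "max N n"] by (simp add: i_def dist_real_def)
    ultimately show ?thesis using rc(1) by blast
  qed
  \<comment> \<open>\<open>p / se\<close> pays for moving the cutoff by less than
    \<open>1 / Suc n\<close> to \<open>c\<close>, and 1 for being \<open>1 / Suc n\<close> below the
    supremum \<open>V\<close>.\<close>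
  define L where "L = p / se + 1"
  \<comment> \<open>A program near the supremum may have a cutoff different from \<open>c\<close>,
    so obedience is demanded only at distance \<open>1 / Suc n\<close> from \<open>c\<close>. With
    \<open>c\<close> fixed, every condition is affine in the rebate and \<open>C n\<close> is
    convex.\<close>
  define C where "C n = {r \<in> policies. (\<forall>x\<ge>c + 1 / Suc n. surplus r x \<ge> 0) \<and>
     (\<forall>x\<le>c - 1 / Suc n. surplus r x \<le> 0) \<and> profit r c \<ge> V - L / Suc n}" for n
  interpret M: prob_space "normal_distribution \<theta> st" by (rule prob_space_normal_density[OF st])
  have L: "L > 0" using p se by (simp add: L_def add_pos_pos)
  obtain s where s: "\<And>n. s n \<in> C n" "AE x in normal_distribution \<theta> st. convergent (\<lambda>n. s n x)"
  proof (rule M.nested_convex_AE_limit[of C p])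
    show "r \<in> borel_measurable (normal_distribution \<theta> st)" if "r \<in> C n" for n r
      using that policiesD(1) by (auto simp: C_def)
    show "r x \<in> {0..p}" if "r \<in> C n" for n r x
      using that policiesD by (auto simp: C_def)
    show "(\<lambda>x. (a x + b x) / 2) \<in> C n" if ab: "a \<in> C n" "b \<in> C n" for n a b
    proof -
      have ab': "a \<in> policies" "b \<in> policies" using ab by (auto simp: C_def)
      have eq: "(\<lambda>x. (a x + b x) / 2) = (\<lambda>x. (1 - 1/2) * a x + 1/2 * b x)" by (auto simp: field_simps)
      have "profit (\<lambda>x. (1 - 1/2) * a x + 1/2 * b x) c = (1 - 1/2) * profit a c + 1/2 * profit b c"
        by (rule affine_onD[OF profit_affine ab']) auto
      moreover have "(\<lambda>x. (1 - 1/2) * a x + 1/2 * b x) \<in> policies"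
        by (rule convex_functionsD[OF convex_policies ab']) auto
      moreover have "surplus (\<lambda>x. (1 - 1/2) * a x + 1/2 * b x) x = (1 - 1/2) * surplus a x + 1/2 * surplus b x" for x
        by (rule surplus_mix[OF ab']) auto
      ultimately show ?thesis using ab unfolding C_def eq by (auto intro!: add_nonpos_nonpos)
    qed
    show "decseq C"
    proof (rule decseq_SucI, rule subsetI)
      fix n r assume r: "r \<in> C (Suc n)"
      have le: "1 / real (Suc (Suc n)) \<le> 1 / real (Suc n)" by (intro divide_left_mono) auto
      then have "L / real (Suc (Suc n)) \<le> L / real (Suc n)" using mult_left_mono[OF le, of L] L by simp
      then show "r \<in> C n" using r le by (auto simp: C_def)
    qed
    show "C n \<noteq> {}" for n
    proof -
      obtain r c' where r: "obedient (r, c')" "\<bar>c' - c\<bar> < 1 / Suc n" "V - 1 / Suc n < profit r c'"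
        using near by blast
      have rp: "r \<in> policies" using r feasible_iff by blast
      have "profit r c' - profit r c \<le> p / se * \<bar>c' - c\<bar>" by (rule profit_lipschitz[OF rp])
      also have "\<dots> \<le> p / se * (1 / Suc n)" using r(2) p se by (intro mult_left_mono) auto
      finally have "profit r c \<ge> V - L / Suc n" using r(3) by (simp add: L_def add_divide_distrib)
      then have "r \<in> C n" using r rp unfolding C_def feasible_iff by auto
      then show ?thesis by blast
    qed
    fix s assume "\<And>n. s n \<in> C n" "AE x in normal_distribution \<theta> st. convergent (\<lambda>n. s n x)"
    then show thesis by (rule that)
  qed
  have sp: "s n \<in> policies" for n using s(1)[of n] by (simp add: C_def)
  note [measurable] = policiesD(1)[OF sp]
  \<comment> \<open>The value of \<open>lim\<close> is unspecified where the sequence diverges;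
    clipping makes \<open>r\<close> a policy everywhere.\<close>
  define r where "r v = max 0 (min p (lim (\<lambda>n. s n v)))" for v
  have [measurable]: "r \<in> borel_measurable borel"
    unfolding r_def by (intro borel_measurable_max borel_measurable_min borel_measurable_lim_metric) measurable
  have rp: "r \<in> policies" using p by (auto simp: policies_def r_def)
  have AE: "AE v in lborel. (\<lambda>n. s n v) \<longlonglongrightarrow> r v"
  proof -
    have "AE v in lborel. convergent (\<lambda>n. s n v)"
      using s(2) normal_density_pos[OF st, of \<theta>] by (subst (asm) AE_density) auto
    then show ?thesis
    proof eventually_elim
      fix v assume "convergent (\<lambda>n. s n v)"
      then have l: "(\<lambda>n. s n v) \<longlonglongrightarrow> lim (\<lambda>n. s n v)" by (simp add: convergent_LIMSEQ_iff)
      have "0 \<le> lim (\<lambda>n. s n v)" "lim (\<lambda>n. s n v) \<le> p"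
        using policiesD(2,3)[OF sp] by (auto intro!: LIMSEQ_le_const[OF l] LIMSEQ_le_const2[OF l])
      then show "(\<lambda>n. s n v) \<longlonglongrightarrow> r v" using l by (simp add: r_def)
    qed
  qed
  have limR: "(\<lambda>n. R (s n) x) \<longlonglongrightarrow> R r x" for x
    unfolding R_def by (rule normal_integral_tendsto[OF sv(1) _ _ policiesD(4)[OF sp] AE]) measurable
  have limS: "(\<lambda>n. surplus (s n) x) \<longlonglongrightarrow> surplus r x" for x
    unfolding surplus_def by (intro tendsto_intros limR)
  have limP: "(\<lambda>n. profit (s n) c) \<longlonglongrightarrow> profit r c"
    unfolding profit_eq[OF sp] profit_eq[OF rp]
  proof (rule normal_integral_tendsto[OF st, where B = "p * 1"])
    show "\<bar>(p - s n v) * Phi ((v - c) / se)\<bar> \<le> p * 1" for n v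
      unfolding abs_mult using policiesD(2,3)[OF sp, of n v] p by (intro mult_mono) auto
    show "AE v in lborel. (\<lambda>n. (p - s n v) * Phi ((v - c) / se)) \<longlonglongrightarrow> (p - r v) * Phi ((v - c) / se)"
      using AE by eventually_elim (intro tendsto_intros)
  qed measurable
  have inv0: "(\<lambda>n. 1 / real (Suc n)) \<longlonglongrightarrow> 0" by real_asymp
  have right: "surplus r x \<ge> 0" if "x > c" for x
  proof (rule tendsto_lowerbound[OF limS])
    have "\<forall>\<^sub>F n in sequentially. 1 / real (Suc n) < x - c" using inv0 that by (intro order_tendstoD) auto
    then show "\<forall>\<^sub>F n in sequentially. 0 \<le> surplus (s n) x"
      by eventually_elim (use s(1) in \<open>auto simp: C_def\<close>)
  qed simp
  have left: "surplus r x \<le> 0" if "x < c" for x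
  proof (rule tendsto_upperbound[OF limS])
    have "\<forall>\<^sub>F n in sequentially. 1 / real (Suc n) < c - x" using inv0 that by (intro order_tendstoD) auto
    then show "\<forall>\<^sub>F n in sequentially. surplus (s n) x \<le> 0"
      by eventually_elim (use s(1) in \<open>auto simp: C_def\<close>)
  qed simp
  \<comment> \<open>The sets \<open>C n\<close> say nothing about the valuation \<open>c\<close>
    itself; there, obedience follows from continuity on both sides.\<close>
  have cont: "(surplus r \<longlongrightarrow> surplus r c) (at_right c)" "(surplus r \<longlongrightarrow> surplus r c) (at_left c)"
    using isCont_surplus[OF rp, of c] by (auto simp: continuous_at filterlim_at_split)
  have "surplus r c \<ge> 0"
    using right by (intro tendsto_lowerbound[OF cont(1)]) (auto simp: eventually_at_filter)
  moreover have "surplus r c \<le> 0"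
    using left by (intro tendsto_upperbound[OF cont(2)]) (auto simp: eventually_at_filter)
  ultimately have feas: "obedient (r, c)"
    unfolding feasible_iff using rp left right by (auto simp: le_less)
  have "profit r c \<ge> V"
  proof (rule LIMSEQ_le[OF _ limP])
    have "(\<lambda>n. V - L / real (Suc n)) \<longlonglongrightarrow> V" by real_asymp
    then show "(\<lambda>n. V - L / real (Suc n)) \<longlonglongrightarrow> V" .
    show "\<exists>N. \<forall>n\<ge>N. V - L / real (Suc n) \<le> profit (s n) c" using s(1) by (auto simp: C_def)
  qed
  then have "optimal (r, c)"
    unfolding optimal_program_def is_arg_max_linorder
    using feas leV by (auto simp: profit_def) (metis order_trans)
  then show ?thesis ..
qed

end

section \<open>Finiteness of zeros\<close>

lemma exp_poly_append: "exp_poly (L @ M) v = exp_poly L v + exp_poly M v"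
  by (simp add: exp_poly_def)

lemma normal_density_swap: "normal_density v s x = normal_density x s v"
  by (simp add: normal_density_def power2_commute)

definition gauss_poly :: "real \<Rightarrow> (real \<Rightarrow> real) \<Rightarrow> bool" where
  "gauss_poly s h \<longleftrightarrow> (\<exists>L. \<forall>v. h v = exp (- v\<^sup>2 / (2 * s\<^sup>2)) * exp_poly L v)"

lemma gauss_poly_add: "gauss_poly s g \<Longrightarrow> gauss_poly s h \<Longrightarrow> gauss_poly s (\<lambda>v. g v + h v)"
  unfolding gauss_poly_def
proof (elim exE)
  fix L M assume "\<forall>v. g v = exp (- v\<^sup>2 / (2 * s\<^sup>2)) * exp_poly L v" "\<forall>v. h v = exp (- v\<^sup>2 / (2 * s\<^sup>2)) * exp_poly M v"
  then show "\<exists>L. \<forall>v. g v + h v = exp (- v\<^sup>2 / (2 * s\<^sup>2)) * exp_poly L v"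
    by (intro exI[of _ "L @ M"]) (simp add: exp_poly_append distrib_left)
qed

lemma gauss_poly_sum:
  assumes "finite T" "\<And>x. x \<in> T \<Longrightarrow> gauss_poly s (h x)"
  shows "gauss_poly s (\<lambda>v. \<Sum>x\<in>T. h x v)"
  using assms
proof (induction T rule: finite_induct)
  case empty
  then show ?case by (auto simp: gauss_poly_def exp_poly_def intro!: exI[of _ "[]"])
next
  case (insert x T)
  then show ?case by (simp add: gauss_poly_add)
qed

text \<open>Moving the centre to \<open>x\<close> multiplies the centred Gaussian by a constant and
  \<open>exp (x / s\<^sup>2 * v)\<close>. Densities with a common \<open>s\<close> thus share one
  Gaussian factor, and what remains of their sum is an exponential polynomial.\<close>

lemma gauss_poly_normal_density: "gauss_poly s (\<lambda>v. poly P v * normal_density x s v)"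
proof (cases "s = 0")
  \<comment> \<open>\<open>normal_density x 0\<close> vanishes, since
    \<open>1 / 0 = 0\<close>.\<close>
  case True
  then show ?thesis by (auto simp: gauss_poly_def exp_poly_def normal_density_def intro!: exI[of _ "[]"])
next
  case False
  define C where "C = 1 / sqrt (2 * pi * s\<^sup>2) * exp (- x\<^sup>2 / (2 * s\<^sup>2))"
  have "poly P v * normal_density x s v = exp (- v\<^sup>2 / (2 * s\<^sup>2)) * exp_poly [(x / s\<^sup>2, smult C P)] v" for v
  proof -
    have "- (v - x)\<^sup>2 / (2 * s\<^sup>2) = - x\<^sup>2 / (2 * s\<^sup>2) + - v\<^sup>2 / (2 * s\<^sup>2) + x / s\<^sup>2 * v"
      using False by (simp add: field_simps power2_eq_square)
    then have "normal_density x s v = C * (exp (- v\<^sup>2 / (2 * s\<^sup>2)) * exp (x / s\<^sup>2 * v))"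
      unfolding normal_density_def C_def by (simp only: exp_add mult.assoc)
    then show ?thesis by (simp add: exp_poly_def mult_ac)
  qed
  then show ?thesis unfolding gauss_poly_def by blast
qed

lemma normal_density_tails:
  assumes s: "s > 0" and F: "F = at_top \<or> F = at_bot"
  shows "((\<lambda>v. normal_density v s x) \<longlongrightarrow> 0) F"
    and "((\<lambda>v. gauss_slope s c v) \<longlongrightarrow> 0) F"
proof -
  have lin: "filterlim (\<lambda>v. (v - m) / s) F F" for m
    using F
  proof
    assume F: "F = at_top"
    show ?thesis unfolding F using s by real_asymp
  next
    assume F: "F = at_bot"
    show ?thesis unfolding F using s by real_asymp
  qed
  have 1: "(phi \<longlongrightarrow> 0) F" "((\<lambda>y. y * phi y) \<longlongrightarrow> 0) F"
    using F unfolding std_normal_density_def[abs_def] by (auto; real_asymp)+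
  have sw: "normal_density v s m = phi ((v - m) / s) / s" for v m
    using normal_density_std[OF s, of m v] by (simp add: normal_density_swap)
  show "((\<lambda>v. normal_density v s x) \<longlongrightarrow> 0) F"
    unfolding sw using tendsto_divide[OF filterlim_compose[OF 1(1) lin[of x]] tendsto_const[of s]] s by simp
  have "gauss_slope s c v = ((v - c) / s * phi ((v - c) / s)) / s\<^sup>2" for v
    unfolding sw by (simp add: power2_eq_square)
  then show "((\<lambda>v. gauss_slope s c v) \<longlongrightarrow> 0) F"
    using tendsto_divide[OF filterlim_compose[OF 1(2) lin[of c]] tendsto_const[of "s\<^sup>2"]] s by simp
qed

text \<open>The derivative of the Lagrangian in the rebate at quality \<open>v\<close>, relative to
  the prior: the profit lost by refunding, minus the priced kernels of the surplus at the points of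
  \<open>T\<close>, minus the priced kernel of its slope at \<open>c\<close>. A refund pays where
  this is negative.\<close>

abbreviation multiplier_fun :: "real \<Rightarrow> real \<Rightarrow> real set \<Rightarrow> (real \<Rightarrow> real) \<Rightarrow> real \<Rightarrow> real \<Rightarrow> real" where
  "multiplier_fun s c T a b v \<equiv> Phi ((v - c) / s) - (\<Sum>x\<in>T. a x * normal_density v s x) - b * gauss_slope s c v"

text \<open>
  The derivative of \<open>k\<close> is a Gaussian times an exponential polynomial, so Rolle's theorem bounds
  the number of zeros of \<open>k\<close>; \<open>k\<close> is not constant because its limits at \<open>\<plusminus>\<infinity>\<close> differ.
\<close>
lemma multiplier_function_negative_set:
  fixes s c b :: real and a :: "real \<Rightarrow> real"
  assumes s: "s > 0" and T: "finite T"
  defines "k \<equiv> \<lambda>v. multiplier_fun s c T a b v"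
  shows "finite {v. k v = 0}"
    and "x < y \<Longrightarrow> {x..y} \<inter> {v. k v = 0} = {} \<Longrightarrow> k x < 0 \<longleftrightarrow> k y < 0"
    and "\<exists>M. \<forall>x>M. \<not> k x < 0"
proof -
  \<comment> \<open>The constant 1 comes from \<open>Phi\<close>, whose chain rule yields
    \<open>normal_density c s\<close>; the terms with \<open>b\<close> are the expanded second
    derivative of that Gaussian.\<close>
  define k' where "k' v = (poly [:1 - b / s\<^sup>2 + b * c\<^sup>2 / s ^ 4, - 2 * b * c / s ^ 4, b / s ^ 4:] v * normal_density c s v)
     + (\<Sum>x\<in>T. poly [:- a x * x / s\<^sup>2, a x / s\<^sup>2:] v * normal_density x s v)" for v
  have nd: "(normal_density m s has_real_derivative normal_density m s v * ((m - v) / s\<^sup>2)) (at v)" for m v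
    unfolding normal_density_def[abs_def]
    by (rule derivative_eq_intros refl | use s in \<open>simp; fail\<close>)+ (use s in \<open>simp add: field_simps power2_eq_square\<close>)
  have k_eq: "k = (\<lambda>v. Phi ((v - c) / s) - (\<Sum>x\<in>T. a x * normal_density x s v)
      - b * (normal_density c s v * (v - c) / s\<^sup>2))"
  proof
    fix v
    note sw = normal_density_swap[of v s]
    have "(\<Sum>x\<in>T. a x * normal_density v s x) = (\<Sum>x\<in>T. a x * normal_density x s v)"
      by (intro sum.cong refl) (metis sw)
    then show "k v = Phi ((v - c) / s) - (\<Sum>x\<in>T. a x * normal_density x s v)
      - b * (normal_density c s v * (v - c) / s\<^sup>2)"
      unfolding k_def using sw[of c] by metis
  qed
  have cancel: "b * (s\<^sup>2 * u) / s ^ 4 = b * u / s\<^sup>2" for u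
    using s by (simp add: power2_eq_square power4_eq_xxxx)
  have kder: "(k has_real_derivative k' v) (at v)" for v
  proof -
    have "((\<lambda>v. Phi ((v - c) / s) - (\<Sum>x\<in>T. a x * normal_density x s v)
      - b * (normal_density c s v * (v - c) / s\<^sup>2)) has_real_derivative
      phi ((v - c) / s) * (1 / s) - (\<Sum>x\<in>T. a x * (normal_density x s v * ((x - v) / s\<^sup>2))) -
      b * ((normal_density c s v * ((c - v) / s\<^sup>2) * (v - c) + 1 * normal_density c s v) / s\<^sup>2)) (at v)"
      by (rule derivative_eq_intros nd refl | use s in \<open>simp; fail\<close>)+
         (use s in \<open>simp add: mult_ac\<close>, simp add: cancel)
    moreover have "phi ((v - c) / s) * (1 / s) - (\<Sum>x\<in>T. a x * (normal_density x s v * ((x - v) / s\<^sup>2))) -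
      b * ((normal_density c s v * ((c - v) / s\<^sup>2) * (v - c) + 1 * normal_density c s v) / s\<^sup>2) = k' v"
    proof -
      have 1: "phi ((v - c) / s) * (1 / s) = normal_density c s v"
        using normal_density_std[OF s, of c v] by simp
      have 2: "- (\<Sum>x\<in>T. a x * (normal_density x s v * ((x - v) / s\<^sup>2))) =
          (\<Sum>x\<in>T. poly [:- a x * x / s\<^sup>2, a x / s\<^sup>2:] v * normal_density x s v)"
        unfolding sum_negf[symmetric] using s by (intro sum.cong) (auto simp: field_simps)
      have 3: "normal_density c s v - b * ((normal_density c s v * ((c - v) / s\<^sup>2) * (v - c) + 1 * normal_density c s v) / s\<^sup>2)
         = poly [:1 - b / s\<^sup>2 + b * c\<^sup>2 / s ^ 4, - 2 * b * c / s ^ 4, b / s ^ 4:] v * normal_density c s v"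
        using s by (simp add: field_simps power2_eq_square power4_eq_xxxx)
      show ?thesis unfolding k'_def 3[symmetric] 2[symmetric] 1 by simp
    qed
    ultimately show ?thesis unfolding k_eq by (simp only:)
  qed
  have "gauss_poly s k'"
    unfolding k'_def by (intro gauss_poly_add gauss_poly_sum gauss_poly_normal_density T)
  then obtain L where L: "\<And>v. k' v = exp (- v\<^sup>2 / (2 * s\<^sup>2)) * exp_poly L v" unfolding gauss_poly_def by blast
  have Phi_lim: "((\<lambda>v. Phi ((v - c) / s)) \<longlongrightarrow> 1) at_top" "((\<lambda>v. Phi ((v - c) / s)) \<longlongrightarrow> 0) at_bot"
  proof -
    have "filterlim (\<lambda>v. (v - c) / s) at_top at_top" using s by real_asymp
    from filterlim_compose[OF Phi_at_top this] show "((\<lambda>v. Phi ((v - c) / s)) \<longlongrightarrow> 1) at_top" .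
    have "filterlim (\<lambda>v. (v - c) / s) at_bot at_bot" using s by real_asymp
    from filterlim_compose[OF Phi_at_bot this] show "((\<lambda>v. Phi ((v - c) / s)) \<longlongrightarrow> 0) at_bot" .
  qed
  have tails: "((\<lambda>v. (\<Sum>x\<in>T. a x * normal_density v s x)) \<longlongrightarrow> (\<Sum>x\<in>T. a x * 0)) F"
    "((\<lambda>v. b * gauss_slope s c v) \<longlongrightarrow> b * 0) F" if "F = at_top \<or> F = at_bot" for F
    by (intro tendsto_intros normal_density_tails[OF s that])+
  have top: "(k \<longlongrightarrow> 1) at_top"
    unfolding k_def using tendsto_diff[OF tendsto_diff[OF Phi_lim(1) tails(1)] tails(2)] by simp
  have bot: "(k \<longlongrightarrow> 0) at_bot"
    unfolding k_def using tendsto_diff[OF tendsto_diff[OF Phi_lim(2) tails(1)] tails(2)] by simp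
  have "\<not> (\<forall>v. exp_poly L v = 0)"
  proof
    assume "\<forall>v. exp_poly L v = 0"
    then have "\<And>v. (k has_real_derivative 0) (at v)" using kder L by simp
    then have "k v = k w" for v w using DERIV_isconst_all[of k] by blast
    then have "k = (\<lambda>_. k 0)" by auto
    then have "(\<lambda>_. k 0) = k" by simp
    then have "k 0 = 1" "k 0 = 0"
      using tendsto_unique[OF _ top, of "k 0"] tendsto_unique[OF _ bot, of "k 0"]
      by (metis tendsto_const trivial_limit_at_top_linorder trivial_limit_at_bot_linorder)+
    then show False by simp
  qed
  then have "finite {v. exp_poly L v = 0}" using exp_poly_finite_zeros by blast
  then have "finite {v. k' v = 0}" by (simp add: L)
  then show "finite {v. k v = 0}" using finite_zeros_of_finite_deriv_zeros[of k k'] kder by blast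
  have cont: "continuous_on A k" for A
    using kder DERIV_continuous_on has_field_derivative_at_within by blast
  show "k x < 0 \<longleftrightarrow> k y < 0" if xy: "x < y" "{x..y} \<inter> {v. k v = 0} = {}" for x y
  proof (rule ccontr)
    assume "\<not> ?thesis"
    then consider "k x < 0" "k y \<ge> 0" | "k x \<ge> 0" "k y < 0" by linarith
    then have "\<exists>z. x \<le> z \<and> z \<le> y \<and> k z = 0"
    proof cases
      case 1
      then show ?thesis using IVT'[of k x 0 y] xy cont by auto
    next
      case 2
      then show ?thesis using IVT2'[of k y 0 x] xy cont by auto
    qed
    then show False using xy by auto
  qed
  have "\<forall>\<^sub>F x in at_top. k x > 0" using top by (intro order_tendstoD) auto
  then show "\<exists>M. \<forall>x>M. \<not> k x < 0"
    unfolding eventually_at_top_linorder by (meson less_imp_le not_less)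
qed

context signal
begin

text \<open>Ties lie in \<open>{0..p}\<close>, so infinitely many of them would accumulate. The
  identity theorem would then make the surplus vanish at \<open>p + 1\<close> too, where it is
  positive.\<close>

lemma zeros_finite:
  assumes r: "r \<in> policies" shows "finite (tight_points r)"
proof (rule ccontr)
  assume inf: "infinite (tight_points r)"
  note [measurable] = policiesD(1)[OF r]
  define C where "C = 1 / sqrt (2 * pi * se\<^sup>2)"
  define D where "D = 1 / sqrt (2 * pi * sd\<^sup>2)"
  have C: "C \<ge> 0" by (simp add: C_def)
  \<comment> \<open>Expanding the square in \<open>normal_density v se x\<close> isolates
    \<open>exp (x / se\<^sup>2 * v)\<close>. What depends on \<open>v\<close> alone is collected in
    \<open>w\<close>, and the factor \<open>exp (- x\<^sup>2 / (2 * se\<^sup>2))\<close> is divided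
    out in \<open>E\<close>.\<close>
  define w where "w v = prior v * (C * exp (- v\<^sup>2 / (2 * se\<^sup>2)) * r v)" for v
  have [measurable]: "w \<in> borel_measurable borel" unfolding w_def by measurable
  have int: "integrable lborel (\<lambda>v. \<bar>w v\<bar> * exp (t * \<bar>v\<bar>))" for t
  proof -
    have "integrable lborel (\<lambda>v. prior v * (C * exp (- v\<^sup>2 / (2 * se\<^sup>2)) * r v * exp (t * \<bar>v\<bar>)))"
    proof (rule integrable_normal_density_mult[OF st])
      fix v
      \<comment> \<open>Completing the square: the Gaussian factor in \<open>w\<close> absorbs every
        exponential weight.\<close>
      have "t * \<bar>v\<bar> + - v\<^sup>2 / (2 * se\<^sup>2) = t\<^sup>2 * se\<^sup>2 / 2 - (\<bar>v\<bar> / se - t * se)\<^sup>2 / 2"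
        using se by (simp add: power2_diff field_simps power2_eq_square)
      then have "t * \<bar>v\<bar> + - v\<^sup>2 / (2 * se\<^sup>2) \<le> t\<^sup>2 * se\<^sup>2 / 2" by simp
      then have "exp (t * \<bar>v\<bar>) * exp (- v\<^sup>2 / (2 * se\<^sup>2)) \<le> exp (t\<^sup>2 * se\<^sup>2 / 2)"
        by (simp flip: exp_add)
      then have "C * (exp (t * \<bar>v\<bar>) * exp (- v\<^sup>2 / (2 * se\<^sup>2))) * r v \<le> C * exp (t\<^sup>2 * se\<^sup>2 / 2) * p"
        using C policiesD(2,3)[OF r, of v] by (intro mult_mono mult_left_mono) auto
      moreover have "0 \<le> C * exp (- v\<^sup>2 / (2 * se\<^sup>2)) * r v * exp (t * \<bar>v\<bar>)"
        using C policiesD(2)[OF r, of v] by simp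
      ultimately show "\<bar>C * exp (- v\<^sup>2 / (2 * se\<^sup>2)) * r v * exp (t * \<bar>v\<bar>)\<bar> \<le> C * exp (t\<^sup>2 * se\<^sup>2 / 2) * p"
        by (simp add: mult_ac)
    qed measurable
    moreover have "\<bar>w v\<bar> * exp (t * \<bar>v\<bar>) = prior v * (C * exp (- v\<^sup>2 / (2 * se\<^sup>2)) * r v * exp (t * \<bar>v\<bar>))" for v
      using C policiesD(2)[OF r, of v] by (simp add: w_def)
    ultimately show ?thesis by (simp only:)
  qed
  obtain F where F: "\<And>\<rho>. F holomorphic_on ball 0 \<rho>" "\<And>x. F (of_real x) = of_real (LBINT v. w v * exp (x * v))"
    using entire_exponential_transform[of w] int by auto
  define E where "E z = F (z / of_real (se\<^sup>2)) + (z - of_real p) * of_real D *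
      exp (z\<^sup>2 / of_real (2 * se\<^sup>2) - (z - of_real \<theta>)\<^sup>2 / of_real (2 * sd\<^sup>2))" for z :: complex
  \<comment> \<open>Radius \<open>p + 2\<close>: the ball contains both \<open>{0..p}\<close> and
    the test point \<open>p + 1\<close>.\<close>
  have "F \<circ> (\<lambda>z. z / of_real (se\<^sup>2)) holomorphic_on ball 0 (p + 2)"
    by (rule holomorphic_on_compose_gen[where t = "ball 0 ((p + 2) / se\<^sup>2)"])
       (use F(1) se in \<open>auto intro!: holomorphic_intros simp: norm_divide norm_power divide_strict_right_mono\<close>)
  then have hol: "E holomorphic_on ball 0 (p + 2)"
    unfolding E_def comp_def using se sd by (intro holomorphic_intros) auto
  have E: "E (of_real x) = of_real (exp (x\<^sup>2 / (2 * se\<^sup>2)) * g r x)" for x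
  proof -
    have "A r x = (LBINT v. exp (- x\<^sup>2 / (2 * se\<^sup>2)) * (w v * exp (x / se\<^sup>2 * v)))"
      unfolding A_def
    proof (rule bochner_cong)
      fix v
      have "- (x - v)\<^sup>2 / (2 * se\<^sup>2) = - x\<^sup>2 / (2 * se\<^sup>2) + - v\<^sup>2 / (2 * se\<^sup>2) + x / se\<^sup>2 * v"
        using se by (simp add: field_simps power2_eq_square)
      then have "normal_density v se x = exp (- x\<^sup>2 / (2 * se\<^sup>2)) * (C * exp (- v\<^sup>2 / (2 * se\<^sup>2))) * exp (x / se\<^sup>2 * v)"
        unfolding normal_density_def C_def by (simp only: exp_add mult_ac)
      then show "prior v * (normal_density v se x * r v) = exp (- x\<^sup>2 / (2 * se\<^sup>2)) * (w v * exp (x / se\<^sup>2 * v))"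
        by (simp add: w_def mult_ac)
    qed simp
    then have "A r x = exp (- x\<^sup>2 / (2 * se\<^sup>2)) * (LBINT v. w v * exp (x / se\<^sup>2 * v))" by simp
    then have 1: "exp (x\<^sup>2 / (2 * se\<^sup>2)) * A r x = (LBINT v. w v * exp (x / se\<^sup>2 * v))"
      by (simp add: mult.assoc[symmetric] exp_add[symmetric])
    have 2: "exp (x\<^sup>2 / (2 * se\<^sup>2)) * f x = D * exp (x\<^sup>2 / (2 * se\<^sup>2) - (x - \<theta>)\<^sup>2 / (2 * sd\<^sup>2))"
      unfolding f_def normal_density_def D_def by (simp add: exp_add[symmetric] exp_diff exp_minus field_simps)
    have "exp (x\<^sup>2 / (2 * se\<^sup>2)) * g r x = exp (x\<^sup>2 / (2 * se\<^sup>2)) * A r x + (x - p) * (exp (x\<^sup>2 / (2 * se\<^sup>2)) * f x)"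
      unfolding g_def surplus_def A_eq by (simp add: algebra_simps)
    also have "\<dots> = (LBINT v. w v * exp (x / se\<^sup>2 * v)) + (x - p) * D * exp (x\<^sup>2 / (2 * se\<^sup>2) - (x - \<theta>)\<^sup>2 / (2 * sd\<^sup>2))"
      unfolding 1 2 by simp
    finally have 3: "exp (x\<^sup>2 / (2 * se\<^sup>2)) * g r x = (LBINT v. w v * exp (x / se\<^sup>2 * v)) +
      (x - p) * D * exp (x\<^sup>2 / (2 * se\<^sup>2) - (x - \<theta>)\<^sup>2 / (2 * sd\<^sup>2))" .
    have "F (of_real x / of_real (se\<^sup>2)) = of_real (LBINT v. w v * exp (x / se\<^sup>2 * v))"
      using F(2)[of "x / se\<^sup>2"] by (simp only: of_real_divide)
    then show ?thesis unfolding 3 E_def by (simp add: exp_of_real[symmetric])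
  qed
  have sub: "(tight_points r) \<subseteq> {0..p}"
    using surplus_pos[OF r] surplus_neg[OF r] by (force simp: not_le[symmetric])
  then obtain \<xi> where \<xi>: "\<xi> \<in> {0..p}" "\<xi> islimpt (tight_points r)"
    using Heine_Borel_imp_Bolzano_Weierstrass[OF compact_Icc inf sub] by blast
  have lim: "complex_of_real \<xi> islimpt (of_real ` (tight_points r))"
    unfolding islimpt_approachable
  proof (intro allI impI)
    fix e :: real assume "e > 0"
    then obtain x where "surplus r x = 0" "x \<noteq> \<xi>" "dist x \<xi> < e"
      using \<xi>(2) unfolding islimpt_approachable by blast
    then show "\<exists>z\<in>of_real ` (tight_points r). z \<noteq> complex_of_real \<xi> \<and> dist z (complex_of_real \<xi>) < e"
      by (intro bexI[of _ "of_real x"]) auto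
  qed
  have "E (of_real (p + 1)) = 0"
  proof (rule analytic_continuation[OF hol open_ball connected_ball _ _ lim])
    show "of_real ` (tight_points r) \<subseteq> ball (0 :: complex) (p + 2)"
      using sub p by (auto simp: dist_norm)
    show "complex_of_real \<xi> \<in> ball 0 (p + 2)" "complex_of_real (p + 1) \<in> ball 0 (p + 2)"
      using \<xi>(1) p by (auto simp: dist_norm simp del: of_real_add of_real_1)
    show "E z = 0" if "z \<in> of_real ` (tight_points r)" for z
      using that E by (auto simp: g_def)
  qed
  then have "g r (p + 1) = 0" unfolding E by (simp del: of_real_mult)
  then show False using surplus_pos[OF r, of "p + 1"] f_pos[of "p + 1"] by (simp add: g_def)
qed

end

section \<open>Structure of optimal programs\<close>

context signal
begin

text \<open>Near a given valuation, a small mixture is obedient for one of three reasons: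
  \<open>r\<close> is slack, \<open>r'\<close> is strict where \<open>r\<close> is tight, or the
  valuation is \<open>c\<close> and the positive derivative of \<open>g r'\<close> gives the surplus
  of \<open>r'\<close> the sign of \<open>x - c\<close>. Compactness of \<open>{0..p}\<close> turns
  the local mixing bounds into a single \<open>t\<close>; outside that interval every policy has a
  surplus of the right sign.\<close>

lemma improving_mix_feasible:
  assumes feas: "obedient (r, c)" and r': "r' \<in> policies"
    and c0: "surplus r' c = 0" and c1: "g' r' c > 0"
    and tight: "\<And>x. x \<noteq> c \<Longrightarrow> surplus r x = 0 \<Longrightarrow> (x - c) * surplus r' x > 0"
  obtains t where "0 < t" "t \<le> 1" "obedient (\<lambda>v. (1 - t) * r v + t * r' v, c)"
proof -
  have r: "r \<in> policies" using feas feasible_iff by blast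
  \<comment> \<open>Multiplication by \<open>x - c\<close> merges the two sign conditions into
    \<open>S x \<ge> 0\<close>.\<close>
  define S where "S x = (x - c) * surplus r x" for x
  define S' where "S' x = (x - c) * surplus r' x" for x
  have S0: "S x \<ge> 0" for x
    using feas unfolding feasible_iff S_def by (cases "x \<ge> c") (auto intro: mult_nonneg_nonneg mult_nonpos_nonpos)
  have cS: "isCont S x" "isCont S' x" for x
    unfolding S_def S'_def by (intro continuous_intros isCont_surplus r r')+
  have local: "\<exists>U u. open U \<and> x \<in> U \<and> u > 0 \<and> u \<le> 1 \<and> (\<forall>y\<in>U. \<forall>t. 0 < t \<and> t \<le> u \<longrightarrow> (1 - t) * S y + t * S' y \<ge> 0)" for x
  proof -
    have good: "\<exists>U u. open U \<and> x \<in> U \<and> u > 0 \<and> u \<le> 1 \<and> (\<forall>y\<in>U. \<forall>t. 0 < t \<and> t \<le> u \<longrightarrow> (1 - t) * S y + t * S' y \<ge> 0)"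
      if U: "open U" "x \<in> U" "\<forall>y\<in>U. S' y \<ge> 0" for U
      using U S0 by (intro exI[of _ U] exI[of _ 1]) auto
    consider "x = c" | "x \<noteq> c" "surplus r x = 0" | "x \<noteq> c" "surplus r x \<noteq> 0" by blast
    then show ?thesis
    proof cases
      case 1
      have g0: "g r' c = 0" by (simp add: g_def c0)
      obtain d1 where d1: "d1 > 0" "\<And>h. 0 < h \<Longrightarrow> h < d1 \<Longrightarrow> g r' c < g r' (c + h)"
        using DERIV_pos_inc_right[OF g_deriv[OF r'] c1] by blast
      obtain d2 where d2: "d2 > 0" "\<And>h. 0 < h \<Longrightarrow> h < d2 \<Longrightarrow> g r' (c - h) < g r' c"
        using DERIV_pos_inc_left[OF g_deriv[OF r'] c1] by blast
      have "S' y \<ge> 0" if "y \<in> ball c (min d1 d2)" for y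
      proof (cases y c rule: linorder_cases)
        case less
        then have "g r' y < 0" using d2(2)[of "c - y"] that g0 by (auto simp: dist_real_def)
        then have "surplus r' y < 0" using f_pos[of y] by (simp add: g_def mult_less_0_iff)
        then show ?thesis using less by (simp add: S'_def mult_nonpos_nonpos)
      next
        case equal
        then show ?thesis by (simp add: S'_def)
      next
        case greater
        then have "g r' y > 0" using d1(2)[of "y - c"] that g0 by (auto simp: dist_real_def)
        then have "surplus r' y > 0" using f_pos[of y] by (simp add: g_def zero_less_mult_iff)
        then show ?thesis using greater by (simp add: S'_def)
      qed
      then show ?thesis using d1(1) d2(1) 1 by (intro good[of "ball c (min d1 d2)"]) auto
    next
      case 2
      then have "S' x > 0" using tight by (simp add: S'_def)
      then have "\<forall>\<^sub>F y in nhds x. S' y > 0"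
        using cS(2)[of x] unfolding isCont_def
        by (simp add: order_tendstoD(1) tendsto_at_iff_tendsto_nhds)
      then obtain U where "open U" "x \<in> U" "\<forall>y\<in>U. S' y > 0" unfolding eventually_nhds by blast
      then show ?thesis by (intro good[of U]) auto
    next
      case 3
      define e where "e = S x / 2"
      have "S x \<noteq> 0" using 3 by (simp add: S_def)
      then have e: "e > 0" "S x > e" using S0[of x] by (auto simp: e_def)
      define M where "M = \<bar>S' x\<bar> + 1"
      have M: "M > 0" "S' x > - M" by (auto simp: M_def)
      have "\<forall>\<^sub>F y in nhds x. S y > e"
        using cS(1)[of x] e(2) unfolding isCont_def by (simp add: order_tendstoD(1) tendsto_at_iff_tendsto_nhds)
      moreover have "\<forall>\<^sub>F y in nhds x. S' y > - M"
        using cS(2)[of x] M(2) unfolding isCont_def by (simp add: order_tendstoD(1) tendsto_at_iff_tendsto_nhds)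
      ultimately have "\<forall>\<^sub>F y in nhds x. S y > e \<and> S' y > - M" by eventually_elim auto
      then obtain U where U: "open U" "x \<in> U" "\<forall>y\<in>U. S y > e \<and> S' y > - M" unfolding eventually_nhds by blast
      \<comment> \<open>The solution of \<open>(1 - u) * e = u * M\<close>, the worst case of slack
        \<open>e\<close> against loss \<open>M\<close>.\<close>
      define u where "u = e / (e + M)"
      have u: "u > 0" "u \<le> 1" "u * (e + M) = e" using e M by (auto simp: u_def divide_simps)
      have "(1 - t) * S y + t * S' y \<ge> 0" if "y \<in> U" "0 < t" "t \<le> u" for y t
      proof -
        have "t * (e + M) \<le> e" using that(3) e M u(3) mult_right_mono[of t u "e + M"] by linarith
        moreover have "(1 - t) * e \<le> (1 - t) * S y" using U(3) that u(2) by (intro mult_left_mono) auto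
        moreover have "t * (- M) \<le> t * S' y" using U(3) that by (intro mult_left_mono) auto
        ultimately show ?thesis by (simp add: algebra_simps)
      qed
      then show ?thesis using U u by blast
    qed
  qed
  then obtain U u where Uu: "\<And>x. open (U x)" "\<And>x. x \<in> U x" "\<And>x. u x > 0" "\<And>x. u x \<le> 1"
    "\<And>x y t. y \<in> U x \<Longrightarrow> 0 < t \<Longrightarrow> t \<le> u x \<Longrightarrow> (1 - t) * S y + t * S' y \<ge> 0"
    by metis
  obtain C where C: "C \<subseteq> {0..p}" "finite C" "{0..p} \<subseteq> (\<Union>x\<in>C. U x)"
    by (rule compactE_image[of "{0..p}" "{0..p}" U]) (use Uu in auto)
  define t where "t = Min (insert 1 (u ` C))"
  have t: "t > 0" "t \<le> 1" "\<And>x. x \<in> C \<Longrightarrow> t \<le> u x"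
    unfolding t_def using C(2) Uu(3) by auto
  define m where "m = (mix t r r')"
  have m: "m \<in> policies" unfolding m_def using convex_functionsD[OF convex_policies r r'] t by simp
  have mS: "(y - c) * surplus m y = (1 - t) * S y + t * S' y" for y
    unfolding m_def S_def S'_def surplus_mix[OF r r' less_imp_le[OF t(1)] t(2)] by (simp add: algebra_simps)
  have inside: "(y - c) * surplus m y \<ge> 0" if "y \<in> {0..p}" for y
    using C(3) that Uu(5) t unfolding mS by blast
  have "surplus m c = 0"
    unfolding m_def using surplus_mix[OF r r', of t c] t c0 feasible_cutoff(1)[OF feas] by simp
  note cp = feasible_cutoff(2,3)[OF feas]
  have "surplus m y \<ge> 0" if y: "y \<ge> c" for y
  proof -
    consider "y = c" | "y > p" | "y \<in> {0..p}" "y > c" using y cp by fastforce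
    then show ?thesis
    proof cases
      case 3
      then show ?thesis using inside[of y] by (simp add: zero_le_mult_iff)
    qed (use \<open>surplus m c = 0\<close> surplus_pos[OF m, of y] in auto)
  qed
  moreover have "surplus m y \<le> 0" if y: "y \<le> c" for y
  proof -
    consider "y = c" | "y < 0" | "y \<in> {0..p}" "y < c" using y cp by fastforce
    then show ?thesis
    proof cases
      case 3
      then show ?thesis using inside[of y] by (simp add: zero_le_mult_iff)
    qed (use \<open>surplus m c = 0\<close> surplus_neg[OF m, of y] in auto)
  qed
  ultimately have "obedient (m, c)" using m by (simp add: feasible_iff)
  then show ?thesis using that t unfolding m_def by blast
qed

lemma optimal_iff:
  "optimal (r, c) \<longleftrightarrow> obedient (r, c) \<and>
    (\<forall>r' c'. obedient (r', c') \<longrightarrow> profit r' c' \<le> profit r c)"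
  unfolding optimal_program_def is_arg_max_linorder by (auto simp: profit_def)

lemma profit_mix:
  assumes "a \<in> policies" "b \<in> policies" "0 \<le> t" "t \<le> 1"
  shows "profit (mix t a b) c = (1 - t) * profit a c + t * profit b c"
  using affine_onD[OF profit_affine assms] .

lemma optimal_first_order:
  assumes opt: "optimal (r, c)" and r': "r' \<in> policies"
    and "surplus r' c = 0" "g' r' c > 0"
    "\<And>x. x \<noteq> c \<Longrightarrow> surplus r x = 0 \<Longrightarrow> (x - c) * surplus r' x > 0"
  shows "profit r' c \<le> profit r c"
proof -
  have feas: "obedient (r, c)" using opt optimal_iff by blast
  then have r: "r \<in> policies" using feasible_iff by blast
  obtain t where t: "0 < t" "t \<le> 1" "obedient (\<lambda>v. (1 - t) * r v + t * r' v, c)"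
    using improving_mix_feasible[OF feas assms(2-5)] by blast
  have "profit (mix t r r') c \<le> profit r c" using opt t(3) optimal_iff by blast
  then have "(1 - t) * profit r c + t * profit r' c \<le> profit r c"
    using profit_mix[OF r r', of t c] t by simp
  then have "t * (profit r' c - profit r c) \<le> 0" by (simp add: algebra_simps)
  then show ?thesis using t(1) by (simp add: mult_le_0_iff)
qed

text \<open>An average under a positive density attains an extreme value only if the function is
  almost everywhere constant. This settles the cutoffs \<open>0\<close> and \<open>p\<close>, which
  the multiplier argument excludes.\<close>

lemma R_boundary:
  assumes r: "r \<in> policies"
  shows "R r x = 0 \<Longrightarrow> AE v in lborel. r v = 0" and "R r x = p \<Longrightarrow> AE v in lborel. r v = p"
proof -
  note [measurable] = policiesD(1)[OF r]
  have pos: "post x v > 0" for v by (rule normal_density_pos[OF sv(1)])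
  show "AE v in lborel. r v = 0" if "R r x = 0"
  proof -
    have "AE v in lborel. post x v * r v = 0"
      using that integral_nonneg_eq_0_iff_AE[OF R_integrable[OF r, of x]] policiesD(2)[OF r] by (simp add: R_def)
    then show ?thesis by eventually_elim (metis mult_eq_0_iff pos less_irrefl)
  qed
  show "AE v in lborel. r v = p" if "R r x = p"
  proof -
    have int: "integrable lborel (\<lambda>v. post x v * (p - r v))"
    proof (rule integrable_normal_density_mult[OF sv(1)])
      show "\<bar>p - r v\<bar> \<le> p" for v using policiesD(2-4)[OF r, of v] by auto
    qed measurable
    have "(LBINT v. post x v * (p - r v)) =
        (LBINT v. p * post x v - post x v * r v)"
      by (intro bochner_cong) (auto simp: algebra_simps)
    also have "\<dots> = p - R r x" using R_integrable[OF r, of x] sv(1) by (simp add: R_def)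
    finally have "AE v in lborel. post x v * (p - r v) = 0"
      using that integral_nonneg_eq_0_iff_AE[OF int] policiesD(3)[OF r] by simp
    then show ?thesis by eventually_elim (metis mult_eq_0_iff pos less_irrefl eq_iff_diff_eq_0)
  qed
qed

lemma no_reward_profit_pos: "base_profit > 0"
  using p Phi_gt_0 by (simp add: no_reward_profit_def)

lemma optimal_cutoff_pos:
  assumes opt: "optimal (r, c)" shows "c > 0"
proof (rule ccontr)
  assume "\<not> c > 0"
  have feas: "obedient (r, c)" using opt optimal_iff by blast
  then have r: "r \<in> policies" using feasible_iff by blast
  have "c = 0" using feasible_cutoff[OF feas] \<open>\<not> c > 0\<close> by simp
  then have "R r 0 = p" using feasible_cutoff(1)[OF feas] by (simp add: surplus_def)
  then have AE: "AE v in lborel. r v = p" by (rule R_boundary(2)[OF r])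
  have "profit r c = 0" unfolding profit_eq[OF r]
    by (rule integral_eq_zero_AE) (use AE in eventually_elim, simp)
  moreover have "profit (\<lambda>v. 0) p \<le> profit r c" using opt no_reward_feasible optimal_iff by blast
  ultimately show False using no_reward_profit_pos by (simp add: no_reward_profit_eq)
qed

text \<open>Policies with zero surplus at \<open>c\<close> are compared first, which yields
  multipliers for the finitely many tight points; the equality at \<open>c\<close> receives its
  multiplier in a second step. The constant rebate \<open>p - c\<close> satisfies the equality and
  is strict in all other constraints at once.\<close>

lemma optimal_multipliers:
  assumes opt: "optimal (r, c)" and cp: "c < p"
  obtains a b where "\<And>r'. r' \<in> policies \<Longrightarrow>
     0 \<le> (LBINT v. prior v * ((multiplier_fun se c (tight_points r) a b v) * (r' v - r v)))"
proof -
  have feas: "obedient (r, c)" using opt optimal_iff by blast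
  then have r: "r \<in> policies" using feasible_iff by blast
  note [measurable] = policiesD(1)[OF r]
  have c0: "c > 0" by (rule optimal_cutoff_pos[OF opt])
  have rc: "surplus r c = 0" by (rule feasible_cutoff(1)[OF feas])
  define I where "I = (tight_points r)"
  have I: "finite I" "c \<in> I" unfolding I_def using zeros_finite[OF r] rc by auto
  define F where "F r' = profit r c - profit r' c" for r'
  \<comment> \<open>At \<open>x = c\<close> the product \<open>(x - c) * surplus r' x\<close> is 0
    for every \<open>r'\<close>, so strictness is expressed by the derivative instead.\<close>
  define G where "G x r' = (if x = c then g' r' c else (x - c) * surplus r' x)" for x r'
  define k where "k = (\<lambda>v :: real. p - c)"
  have k: "k \<in> policies" unfolding k_def using c0 cp by (intro const_policy) auto
  have surplus_affine: "affine_on policies (\<lambda>r. surplus r x)" for x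
    unfolding affine_on_def using surplus_mix by auto
  have Faff: "affine_on policies F"
    using profit_affine[of c] unfolding F_def affine_on_def by (auto simp: algebra_simps)
  have Gaff: "affine_on policies (G x)" for x
    unfolding affine_on_def
  proof (intro ballI)
    fix d e t assume "d \<in> policies" "e \<in> policies" "t \<in> {0..1::real}"
    then show "G x (mix t d e) = (1 - t) * G x d + t * G x e"
      by (simp add: G_def affine_onD[OF g'_affine] surplus_mix) (simp add: algebra_simps)
  qed
  define X where "X = {r' \<in> policies. surplus r' c = 0}"
  have sub: "X \<subseteq> policies" by (auto simp: X_def)
  have "\<exists>l. (\<forall>x\<in>I. l x \<ge> 0) \<and> (\<forall>r'\<in>X. F r' \<ge> (\<Sum>x\<in>I. l x * G x r'))"
  proof (rule multiplier_inequalities[OF I(1)])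
    show "convex_functions X" unfolding X_def by (rule convex_functions_zero[OF convex_policies surplus_affine])
    show "affine_on X F" "\<And>x. x \<in> I \<Longrightarrow> affine_on X (G x)" using affine_on_subset[OF Faff sub] affine_on_subset[OF Gaff sub] by auto
    show "k \<in> X" using k by (auto simp: X_def surplus_def) (auto simp: k_def)
    show "0 < G x k" if "x \<in> I" for x
    proof (cases "x = c")
      case True
      then show ?thesis using f_pos[of c] by (simp add: G_def k_def g'_const)
    next
      case False
      have "surplus k x = x - c" by (simp add: surplus_def k_def)
      then show ?thesis using False by (simp add: G_def flip: power2_eq_square)
    qed
    show "0 \<le> F r'" if r': "r' \<in> X" "\<And>x. x \<in> I \<Longrightarrow> 0 < G x r'" for r'
    proof -
      have "profit r' c \<le> profit r c"
      proof (rule optimal_first_order[OF opt])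
        show "r' \<in> policies" "surplus r' c = 0" using r'(1) by (auto simp: X_def)
        show "0 < g' r' c" using r'(2)[OF I(2)] by (simp add: G_def)
        show "0 < (x - c) * surplus r' x" if "x \<noteq> c" "surplus r x = 0" for x
          using r'(2)[of x] that by (simp add: G_def I_def)
      qed
      then show ?thesis by (simp add: F_def)
    qed
  qed
  then obtain l where l: "\<And>x. x \<in> I \<Longrightarrow> l x \<ge> 0" "\<And>r'. r' \<in> X \<Longrightarrow> F r' \<ge> (\<Sum>x\<in>I. l x * G x r')" by blast
  have "\<exists>b. \<forall>r'\<in>policies. F r' - 1 * (\<Sum>x\<in>I. l x * G x r') \<ge> b * surplus r' c"
  proof (rule multiplier_equality[OF convex_policies])
    show "affine_on policies (\<lambda>r'. F r' - 1 * (\<Sum>x\<in>I. l x * G x r'))"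
      by (intro affine_on_diff_scale affine_on_sum Faff Gaff)
    show "affine_on policies (\<lambda>r. surplus r c)" by (rule surplus_affine)
    show "(\<lambda>v. p) \<in> policies" "(\<lambda>v. 0) \<in> policies" using p const_policy by auto
    show "0 < surplus (\<lambda>v. p) c" "surplus (\<lambda>v. 0) c < 0" using c0 cp by (auto simp: surplus_def)
    show "0 \<le> F r' - 1 * (\<Sum>x\<in>I. l x * G x r')" if "r' \<in> policies" "surplus r' c = 0" for r'
      using l(2)[of r'] that by (simp add: X_def)
  qed
  then obtain b where b: "\<And>r'. r' \<in> policies \<Longrightarrow> F r' - (\<Sum>x\<in>I. l x * G x r') \<ge> b * surplus r' c" by auto
  \<comment> \<open>An obedient surplus cannot fall through 0 at \<open>c\<close>. The other
    constraint functions vanish at \<open>r\<close>, so the combination is nonnegative at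
    \<open>r\<close>; this sign lets the inequality be restated in terms of
    \<open>r' - r\<close>.\<close>
  have "g' r c \<ge> 0"
  proof (rule ccontr)
    assume "\<not> g' r c \<ge> 0"
    then obtain d where d: "d > 0" "\<And>h. 0 < h \<Longrightarrow> h < d \<Longrightarrow> g r (c + h) < g r c"
      using DERIV_neg_dec_right[OF g_deriv[OF r], of c] by auto
    have "g r (c + d / 2) < 0" using d(2)[of "d / 2"] d(1) rc by (simp add: g_def)
    then have "surplus r (c + d / 2) < 0" using f_pos[of "c + d / 2"] by (simp add: g_def mult_less_0_iff)
    moreover have "surplus r (c + d / 2) \<ge> 0" using feas d(1) unfolding feasible_iff by simp
    ultimately show False by simp
  qed
  then have Gr: "(\<Sum>x\<in>I. l x * G x r) \<ge> 0"
    using l(1) by (intro sum_nonneg mult_nonneg_nonneg) (auto simp: G_def I_def)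
  \<comment> \<open>Surplus differences are \<open>A h x / f x\<close>, hence the division by
    \<open>f x\<close>. At \<open>c\<close> the coefficient is the multiplier \<open>b\<close> of
    the equality; \<open>l c\<close> goes with the slope kernel.\<close>
  define a where "a x = (if x = c then b / f c else l x * (x - c) / f x)" for x
  have diff: "F r' - (\<Sum>x\<in>I. l x * G x r') - b * surplus r' c
      = (LBINT v. prior v * ((multiplier_fun se c I a (l c) v) * (r' v - r v))) - (\<Sum>x\<in>I. l x * G x r)"
    if r': "r' \<in> policies" for r'
  proof -
    note [measurable] = policiesD(1)[OF r']
    define h where "h v = r' v - r v" for v
    have hm[measurable]: "h \<in> borel_measurable borel" unfolding h_def by measurable
    have hb: "\<bar>h v\<bar> \<le> p" for v using policiesD(2-4)[OF r, of v] policiesD(2-4)[OF r', of v] by (auto simp: h_def)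
    have P: "F r' = (LBINT v. prior v * (Phi ((v - c) / se) * h v))"
    proof -
      have "F r' = (LBINT v. prior v * ((p - r v) * Phi ((v - c) / se)) -
         prior v * ((p - r' v) * Phi ((v - c) / se)))"
        unfolding F_def profit_eq[OF r] profit_eq[OF r'] using profit_integrable[OF r] profit_integrable[OF r'] by simp
      then show ?thesis by (simp add: h_def algebra_simps)
    qed
    have Pi: "integrable lborel (\<lambda>v. prior v * (Phi ((v - c) / se) * h v))"
    proof (rule integrable_normal_density_mult[OF st, where B = "1 * p"])
      show "\<bar>Phi ((v - c) / se) * h v\<bar> \<le> 1 * p" for v
        unfolding abs_mult using hb[of v] by (intro mult_mono) auto
    qed measurable
    have Ah: "surplus r' x - surplus r x = A h x / f x" for x
    proof -
      have "R h x = R r' x - R r x"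
        unfolding R_def h_def using R_integrable[OF r, of x] R_integrable[OF r', of x]
        by (simp add: right_diff_distrib)
      then show ?thesis using f_pos[of x] by (simp add: A_eq surplus_def)
    qed
    have A'h: "g' r' c - g' r c = A' h c"
    proof -
      have i: "integrable lborel (\<lambda>v. prior v * (gauss_slope se c v * (q v - (p - c))))"
        if q: "q \<in> policies" for q
      proof (rule A'_integrable)
        show "\<bar>q v - (p - c)\<bar> \<le> p + \<bar>p - c\<bar>" for v using policiesD(4)[OF q, of v] by linarith
      qed (use policiesD(1)[OF q] in measurable)
      have "A' (\<lambda>v. r' v - (p - c)) c - A' (\<lambda>v. r v - (p - c)) c =
         (LBINT v. prior v * (gauss_slope se c v * (r' v - (p - c))) -
           prior v * (gauss_slope se c v * (r v - (p - c))))"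
        unfolding A'_def by (rule Bochner_Integration.integral_diff[OF i[OF r'] i[OF r], symmetric])
      also have "\<dots> = A' h c" unfolding A'_def
        by (intro bochner_cong refl) (simp only: h_def, algebra)
      finally show ?thesis by (simp add: g'_def)
    qed
    have i1: "integrable lborel (\<lambda>v. a x * (prior v * (normal_density v se x * h v)))" for x
      by (intro integrable_mult_right A_integrable[OF hm hb])
    have i2: "integrable lborel (\<lambda>v. l c * (prior v * (gauss_slope se c v * h v)))"
      by (intro integrable_mult_right A'_integrable[OF hm hb])
    have "(LBINT v. prior v * ((multiplier_fun se c I a (l c) v) * (r' v - r v))) =
       (LBINT v. prior v * (Phi ((v - c) / se) * h v) -
         (\<Sum>x\<in>I. a x * (prior v * (normal_density v se x * h v))) -
         l c * (prior v * (gauss_slope se c v * h v)))"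
      unfolding h_def[symmetric]
      by (intro bochner_cong refl)
         (simp add: left_diff_distrib right_diff_distrib sum_distrib_left sum_distrib_right mult_ac)
    also have "\<dots> = F r' - (\<Sum>x\<in>I. a x * A h x) - l c * A' h c"
    proof -
      have "(LBINT v. (\<Sum>x\<in>I. a x * (prior v * (normal_density v se x * h v)))) = (\<Sum>x\<in>I. a x * A h x)"
        unfolding A_def by (subst Bochner_Integration.integral_sum[OF i1]) simp
      moreover have "integrable lborel (\<lambda>v. \<Sum>x\<in>I. a x * (prior v * (normal_density v se x * h v)))"
        by (intro Bochner_Integration.integrable_sum i1)
      moreover have "(LBINT v. l c * (prior v * (gauss_slope se c v * h v))) = l c * A' h c"
        unfolding A'_def by simp
      ultimately show ?thesis unfolding P using Pi i2
        by (simp only: Bochner_Integration.integral_diff Bochner_Integration.integrable_diff)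
    qed
    also have "\<dots> = F r' - ((\<Sum>x\<in>I. a x * A h x) + l c * A' h c)" by simp
    also have "(\<Sum>x\<in>I. a x * A h x) + l c * A' h c = (\<Sum>x\<in>I. l x * G x r') - (\<Sum>x\<in>I. l x * G x r) + b * surplus r' c"
    proof -
      have s: "(\<Sum>x\<in>I. q x) = q c + (\<Sum>x\<in>I - {c}. q x)" for q :: "real \<Rightarrow> real" by (rule sum.remove[OF I])
      have "a c * A h c = b * surplus r' c" using Ah[of c] rc by (simp add: a_def)
      moreover have "(\<Sum>x\<in>I - {c}. a x * A h x) = (\<Sum>x\<in>I - {c}. l x * G x r') - (\<Sum>x\<in>I - {c}. l x * G x r)"
        unfolding sum_subtractf[symmetric]
      proof (intro sum.cong refl)
        fix x assume "x \<in> I - {c}"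
        then have "x \<noteq> c" by simp
        have "a x * A h x = l x * (x - c) * (A h x / f x)" using \<open>x \<noteq> c\<close> by (simp add: a_def)
        then show "a x * A h x = l x * G x r' - l x * G x r"
          unfolding Ah[symmetric] using \<open>x \<noteq> c\<close> by (simp add: G_def algebra_simps)
      qed
      moreover have "l c * A' h c = l c * G c r' - l c * G c r"
        unfolding A'h[symmetric] by (simp add: G_def algebra_simps)
      ultimately show ?thesis unfolding s[of "\<lambda>x. a x * A h x"] s[of "\<lambda>x. l x * G x r'"] s[of "\<lambda>x. l x * G x r"] by simp
    qed
    finally show ?thesis by simp
  qed
  show ?thesis
  proof (rule that[of a "l c"])
    fix r' assume r': "r' \<in> policies"
    show "0 \<le> (LBINT v. prior v * ((multiplier_fun se c (tight_points r) a (l c) v) * (r' v - r v)))"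
      using diff[OF r'] b[OF r'] Gr unfolding I_def by linarith
  qed
qed

lemma optimal_full_refund_or_nothing:
  assumes opt: "optimal (r, c)"
  shows "\<exists>l. full_refund_or_nothing p l r"
proof (cases "c < p")
  case False
  have feas: "obedient (r, c)" using opt optimal_iff by blast
  then have r: "r \<in> policies" using feasible_iff by blast
  have "c = p" using feasible_cutoff[OF feas] False by simp
  then have "R r p = 0" using feasible_cutoff(1)[OF feas] by (simp add: surplus_def)
  then have "AE v in lborel. r v = 0" by (rule R_boundary(1)[OF r])
  then show ?thesis unfolding full_refund_or_nothing_def by (intro exI[of _ 0]) simp
next
  case True
  have feas: "obedient (r, c)" using opt optimal_iff by blast
  then have r: "r \<in> policies" using feasible_iff by blast
  note [measurable] = policiesD(1)[OF r]
  obtain a b where mult: "\<And>r'. r' \<in> policies \<Longrightarrow>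
     0 \<le> (LBINT v. prior v * ((multiplier_fun se c (tight_points r) a b v) * (r' v - r v)))"
    using optimal_multipliers[OF opt True] by blast
  define k where "k v = multiplier_fun se c (tight_points r) a b v" for v
  note km = multiplier_function_negative_set[OF se zeros_finite[OF r], where c = c and a = a and b = b, folded k_def]
  have [measurable]: "k \<in> borel_measurable borel" unfolding k_def by measurable
  \<comment> \<open>The pointwise minimiser of \<open>k v * r' v\<close> with \<open>r' v\<close> in
    \<open>{0..p}\<close>. Testing the multiplier inequality with it gives a nonpositive integrand a
    nonnegative integral, so \<open>r\<close> equals \<open>q\<close> almost everywhere off the null
    set \<open>k v = 0\<close>.\<close>
  define q where "q v = (if k v < 0 then p else 0)" for v
  have [measurable]: "q \<in> borel_measurable borel" unfolding q_def[abs_def] by measurable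
  have q: "q \<in> policies" using p by (simp add: policies_def) (simp add: q_def)
  have le: "prior v * (k v * (q v - r v)) \<le> 0" for v
  proof -
    have "k v * (q v - r v) \<le> 0"
      using policiesD(2,3)[OF r, of v] by (auto simp: q_def mult_le_0_iff)
    then show ?thesis by (simp add: mult_nonneg_nonpos)
  qed
  have kb: "\<bar>k v\<bar> \<le> 1 + (\<Sum>x\<in>(tight_points r). \<bar>a x\<bar> * (1 / se)) + \<bar>b\<bar> * (2 / se\<^sup>2)" for v
  proof -
    have "\<bar>\<Sum>x\<in>(tight_points r). a x * normal_density v se x\<bar> \<le> (\<Sum>x\<in>(tight_points r). \<bar>a x\<bar> * (1 / se))"
    proof (rule order_trans[OF sum_abs], rule sum_mono)
      fix x
      have "\<bar>a x * normal_density v se x\<bar> = \<bar>a x\<bar> * normal_density v se x" by (simp add: abs_mult)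
      also have "\<dots> \<le> \<bar>a x\<bar> * (1 / se)" by (intro mult_left_mono normal_density_le_inverse[OF se]) simp
      finally show "\<bar>a x * normal_density v se x\<bar> \<le> \<bar>a x\<bar> * (1 / se)" .
    qed
    moreover have "\<bar>b * gauss_slope se c v\<bar> \<le> \<bar>b\<bar> * (2 / se\<^sup>2)"
      unfolding abs_mult[of b] by (intro mult_left_mono normal_density_deriv_bound se) simp
    moreover have "\<bar>Phi ((v - c) / se)\<bar> \<le> 1" by simp
    ultimately show ?thesis unfolding k_def by linarith
  qed
  have int: "integrable lborel (\<lambda>v. prior v * (k v * (q v - r v)))"
  proof (rule integrable_normal_density_mult[OF st])
    show "(\<lambda>v. k v * (q v - r v)) \<in> borel_measurable borel" by measurable
    show "\<bar>k v * (q v - r v)\<bar> \<le> (1 + (\<Sum>x\<in>(tight_points r). \<bar>a x\<bar> * (1 / se)) + \<bar>b\<bar> * (2 / se\<^sup>2)) * p" for v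
    proof -
      have "\<bar>q v - r v\<bar> \<le> p" using policiesD(2-4)[OF r, of v] policiesD(2-4)[OF q, of v] by auto
      then show ?thesis unfolding abs_mult using kb[of v] by (intro mult_mono) auto
    qed
  qed
  have "(LBINT v. - (prior v * (k v * (q v - r v)))) = 0"
  proof (rule antisym)
    show "(LBINT v. - (prior v * (k v * (q v - r v)))) \<le> 0"
      using mult[OF q] unfolding k_def[symmetric] by simp
    show "0 \<le> (LBINT v. - (prior v * (k v * (q v - r v))))"
      using le by (intro integral_nonneg_AE AE_I2) simp
  qed
  then have "AE v in lborel. - (prior v * (k v * (q v - r v))) = 0"
    using integral_nonneg_eq_0_iff_AE[of lborel "\<lambda>v. - (prior v * (k v * (q v - r v)))"] int le by simp
  moreover have null: "AE v in lborel. v \<notin> {v. k v = 0}"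
    by (rule AE_not_in[OF finite_imp_null_set_lborel[OF km(1)]])
  ultimately have rq: "AE v in lborel. r v = q v"
  proof eventually_elim
    case (elim v)
    then show ?case using normal_density_pos[OF st, of \<theta> v] by auto
  qed
  obtain l and wL :: "nat \<Rightarrow> ereal" and wH where w: "\<forall>j\<in>{1..l}. wL j \<le> ereal (wH j)"
      "\<forall>j\<in>{1..<l}. ereal (wH j) < wL (Suc j)"
      "\<forall>v. v \<notin> {v. k v = 0} \<longrightarrow> indicator {v. k v < 0} v = (\<Sum>j=1..l. indicator (ereal_Icc (wL j) (wH j)) v :: real)"
  proof -
    have "\<exists>l (wL :: nat \<Rightarrow> ereal) wH. (\<forall>j\<in>{1..l}. wL j \<le> ereal (wH j)) \<and>
      (\<forall>j\<in>{1..<l}. ereal (wH j) < wL (Suc j)) \<and> (\<forall>j\<in>{1..l}. wH j \<in> {v. k v = 0}) \<and>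
      (\<forall>v. v \<notin> {v. k v = 0} \<longrightarrow> indicator {v. k v < 0} v = (\<Sum>j=1..l. indicator (ereal_Icc (wL j) (wH j)) v :: real))"
      by (rule interval_representation[OF km(1)]) (use km(2,3) in auto)
    then show thesis using that by blast
  qed
  have "AE v in lborel. r v = p * (\<Sum>j=1..l. indicator (ereal_Icc (wL j) (wH j)) v)"
    using rq null
  proof eventually_elim
    case (elim v)
    have "r v = p * indicator {v. k v < 0} v" using elim(1) by (simp add: q_def)
    then show ?case using w(3) elim(2) by simp
  qed
  then show ?thesis unfolding full_refund_or_nothing_def using w(1,2) by blast
qed

end

section \<open>Profit bounds\<close>

lemma normal_abs_deviation:
  assumes s: "s > 0"
  shows "integrable lborel (\<lambda>x. normal_density m s x * \<bar>x - m\<bar>)"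
    and "(LBINT x. normal_density m s x * \<bar>x - m\<bar>) \<le> s"
proof -
  have h: "has_bochner_integral lborel (\<lambda>x. normal_density m s x * \<bar>x - m\<bar>) (s * sqrt (2 / pi))"
    using normal_moment_abs_odd[OF s, of m 0] by simp
  show "integrable lborel (\<lambda>x. normal_density m s x * \<bar>x - m\<bar>)" using integrable.intros[OF h] .
  have "sqrt (2 / pi) \<le> 1" using pi_gt3 by (simp add: real_sqrt_le_1_iff)
  then show "(LBINT x. normal_density m s x * \<bar>x - m\<bar>) \<le> s"
    using s has_bochner_integral_integral_eq[OF h] by (simp add: mult_left_le)
qed

text \<open>Indicators of disjoint events are negatively correlated: splitting off one summand
  produces a cross term \<open>- 2 * u * t i\<close>, which is discarded.\<close>

lemma variance_subadditive:
  fixes t :: "nat \<Rightarrow> real"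
  assumes "\<And>j. j \<in> J \<Longrightarrow> t j \<ge> 0" "finite J"
  shows "(\<Sum>j\<in>J. t j) * (1 - (\<Sum>j\<in>J. t j)) \<le> (\<Sum>j\<in>J. t j * (1 - t j))"
  using assms(2,1)
proof (induction J rule: finite_induct)
  case (insert i J)
  define u where "u = (\<Sum>j\<in>J. t j)"
  have "0 \<le> u" "0 \<le> t i" using insert.prems by (auto simp: u_def intro: sum_nonneg)
  then have "0 \<le> u * t i" by simp
  then have "(t i + u) * (1 - (t i + u)) \<le> t i * (1 - t i) + u * (1 - u)" by (simp add: algebra_simps)
  moreover have "u * (1 - u) \<le> (\<Sum>j\<in>J. t j * (1 - t j))" using insert unfolding u_def by auto
  ultimately show ?case using insert.hyps by (simp add: u_def)
qed simp

context signal
begin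

text \<open>The bound of \<open>Phi_tails\<close> for a cut at quality \<open>a\<close>, as seen by
  a buyer with valuation \<open>x\<close>: it is small unless the posterior mean is within a few
  \<open>sv\<close> of \<open>a\<close>.\<close>

definition "spread a x = exp (- ((a - pm x) / sv)\<^sup>2 / 2)" for a x :: real

text \<open>An interval is a difference of two half-lines, and its variance is at most the sum of
  theirs; each of these is controlled by the tail bound at its endpoint.\<close>

lemma posterior_interval_variance:
  fixes x wH :: real and wL :: ereal
  assumes "wL \<le> ereal wH"
  defines "t \<equiv> LBINT v. post x v * indicator {v. wL \<le> ereal v \<and> v \<le> wH} v"
  shows "0 \<le> t" "t * (1 - t) \<le> spread (real_of_ereal wL) x + spread wH x"
proof -
  show "0 \<le> t" unfolding t_def by (intro integral_nonneg_AE AE_I2) simp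
  define q where "q a = Phi ((a - pm x) / sv)" for a
  have q01: "0 \<le> q a" "q a \<le> 1" for a by (auto simp: q_def)
  have qv: "q a * (1 - q a) \<le> spread a x" for a unfolding q_def spread_def by (rule Phi_tails)
  have sp: "spread a x \<ge> 0" for a by (simp add: spread_def)
  have i: "integrable lborel (\<lambda>v. post x v * indicator S v)" if "S \<in> sets borel" for S :: "real set"
    by (rule integrable_normal_density_mult[OF sv(1), where B = 1]) (use that in auto)
  show "t * (1 - t) \<le> spread (real_of_ereal wL) x + spread wH x"
  proof (cases wL)
    case MInf
    \<comment> \<open>\<open>real_of_ereal\<close> maps \<open>-\<infinity>\<close> to 0; the spread
      at that value enters merely as a nonnegative summand.\<close>
    then have "t = q wH" unfolding t_def q_def
      by (subst normal_lower_tail[OF sv(1), symmetric]) (simp add: atMost_def)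
    then show ?thesis using qv[of wH] sp[of "real_of_ereal wL"] by simp
  next
    case PInf
    then show ?thesis using assms(1) by simp
  next
    case (real a)
    have le: "a \<le> wH" using assms(1) real by simp
    have "t = (LBINT v. post x v * indicator {..wH} v - post x v * indicator {..a} v)"
      unfolding t_def real
    proof (rule Bochner_Integration.integral_cong_AE)
      show "AE v in lborel. post x v * indicator {v. ereal a \<le> ereal v \<and> v \<le> wH} v =
        post x v * indicator {..wH} v - post x v * indicator {..a} v"
        using AE_lborel_singleton[of a] by eventually_elim (use le in \<open>auto simp: indicator_def\<close>)
    qed simp_all
    also have "\<dots> = q wH - q a"
      using i[of "{..wH}"] i[of "{..a}"] by (simp add: q_def normal_lower_tail[OF sv(1)])
    finally have t: "t = q wH - q a" .
    \<comment> \<open>Twice the product of the masses below \<open>a\<close> and above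
      \<open>wH\<close> is the amount by which the two half-line variances together exceed the
      variance of the interval.\<close>
    have "0 \<le> 2 * q a * (1 - q wH)" using q01 by simp
    then have "t * (1 - t) \<le> q wH * (1 - q wH) + q a * (1 - q a)" unfolding t by (simp add: algebra_simps)
    then show ?thesis using qv[of wH] qv[of a] real by simp
  qed
qed

text \<open>The later estimate depends on the number of endpoints only, so they are returned without
  order or position.\<close>

lemma full_refund_variance:
  assumes r: "r \<in> policies" and full: "full_refund_or_nothing p l r"
  obtains w :: "nat \<Rightarrow> real" and w' :: "nat \<Rightarrow> real"
    where "\<And>x. R r x * (p - R r x) \<le> p\<^sup>2 * (\<Sum>j=1..l. spread (w j) x + spread (w' j) x)"
proof -
  note [measurable] = policiesD(1)[OF r]
  obtain wL :: "nat \<Rightarrow> ereal" and wH :: "nat \<Rightarrow> real" where w: "\<And>j. j \<in> {1..l} \<Longrightarrow> wL j \<le> ereal (wH j)"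
    "AE v in lborel. r v = p * (\<Sum>j=1..l. indicator (ereal_Icc (wL j) (wH j)) v)"
    using full unfolding full_refund_or_nothing_def by blast
  define t where "t x j = (LBINT v. post x v * indicator (ereal_Icc (wL j) (wH j)) v)" for x j
  have "R r x * (p - R r x) \<le> p\<^sup>2 * (\<Sum>j=1..l. spread (real_of_ereal (wL j)) x + spread (wH j) x)" for x
  proof -
    have "R r x = (LBINT v. post x v * (p * (\<Sum>j=1..l. indicator (ereal_Icc (wL j) (wH j)) v)))"
      unfolding R_def
    proof (rule Bochner_Integration.integral_cong_AE)
      show "AE v in lborel. post x v * r v =
          post x v * (p * (\<Sum>j=1..l. indicator (ereal_Icc (wL j) (wH j)) v))"
        using w(2) by eventually_elim simp
    qed simp_all
    also have "\<dots> = (LBINT v. p * (\<Sum>j=1..l. post x v * indicator (ereal_Icc (wL j) (wH j)) v))"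
      by (simp add: sum_distrib_left mult_ac)
    also have "\<dots> = p * (\<Sum>j=1..l. t x j)"
    proof -
      have i: "integrable lborel (\<lambda>v. post x v * indicator (ereal_Icc (wL j) (wH j)) v)" for j
        by (rule integrable_normal_density_mult[OF sv(1), where B = 1]) auto
      show ?thesis unfolding t_def integral_mult_right_zero by (subst Bochner_Integration.integral_sum[OF i]) (rule refl)
    qed
    finally have R: "R r x = p * (\<Sum>j=1..l. t x j)" .
    have "R r x * (p - R r x) = p\<^sup>2 * ((\<Sum>j=1..l. t x j) * (1 - (\<Sum>j=1..l. t x j)))"
      unfolding R by (simp add: power2_eq_square algebra_simps)
    also have "\<dots> \<le> p\<^sup>2 * (\<Sum>j=1..l. t x j * (1 - t x j))"
      using posterior_interval_variance(1)[OF w(1)] unfolding t_def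
      by (intro mult_left_mono variance_subadditive) auto
    also have "\<dots> \<le> p\<^sup>2 * (\<Sum>j=1..l. spread (real_of_ereal (wL j)) x + spread (wH j) x)"
      using posterior_interval_variance(2)[OF w(1)] unfolding t_def
      by (intro mult_left_mono sum_mono) auto
    finally show ?thesis .
  qed
  then show ?thesis by (rule that)
qed

text \<open>As a function of \<open>x\<close>, \<open>spread a\<close> is an unnormalised Gaussian,
  and the valuation density is at most \<open>1 / sd\<close>; the product of the mass with this
  bound does not depend on \<open>a\<close>.\<close>

lemma spread_integral:
  shows "integrable lborel (\<lambda>x. f x * spread a x)"
    and "(LBINT x. f x * spread a x) \<le> sqrt (2 * pi) * se / st"
proof -
  have pm_m: "(\<lambda>x. spread a x) \<in> borel_measurable borel" unfolding spread_def pm_def by measurable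
  show int: "integrable lborel (\<lambda>x. f x * spread a x)"
    unfolding f_def by (rule integrable_normal_density_mult[OF sd(1) pm_m, where B = 1]) (auto simp: spread_def)
  \<comment> \<open>\<open>m\<close> is the valuation whose posterior mean is \<open>a\<close>;
    \<open>\<omega>\<close> is \<open>sv\<close> divided by the slope of the posterior mean in
    \<open>x\<close>.\<close>
  define m where "m = ((se\<^sup>2 + st\<^sup>2) * a - se\<^sup>2 * \<theta>) / st\<^sup>2"
  define \<omega> where "\<omega> = se * sd / st"
  have \<omega>: "\<omega> > 0" using se st sd by (simp add: \<omega>_def)
  have sv_eq: "sv\<^sup>2 = (\<omega> * st\<^sup>2 / sd\<^sup>2)\<^sup>2"
  proof -
    have "\<omega> * st\<^sup>2 / sd\<^sup>2 = se * st / sd" using st sd(1) by (simp add: \<omega>_def power2_eq_square)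
    moreover have "(se * st / sd)\<^sup>2 = se\<^sup>2 * st\<^sup>2 / sd\<^sup>2" by (simp add: power_mult_distrib power_divide)
    ultimately show ?thesis by (simp add: sv sd(2) add.commute)
  qed
  have "spread a x = sqrt (2 * pi) * \<omega> * normal_density m \<omega> x" for x
  proof -
    have "a - pm x = (st\<^sup>2 / sd\<^sup>2) * (m - x)"
    proof -
      define D where "D = se\<^sup>2 + st\<^sup>2"
      have D: "D > 0" "sd\<^sup>2 = D" using ss by (simp_all add: D_def sd(2) add.commute)
      have "st\<^sup>2 * (m - x) = D * a - (st\<^sup>2 * x + se\<^sup>2 * \<theta>)"
      proof -
        have "st\<^sup>2 * m = D * a - se\<^sup>2 * \<theta>" using st by (simp add: m_def D_def)
        then show ?thesis by (simp add: right_diff_distrib)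
      qed
      then show ?thesis unfolding pm_eq D_def[symmetric] D(2) using D(1) by (simp add: diff_divide_distrib)
    qed
    then have "((a - pm x) / sv)\<^sup>2 = ((st\<^sup>2 / sd\<^sup>2) * (m - x))\<^sup>2 / sv\<^sup>2" by (simp only: power_divide)
    also have "\<dots> = ((x - m) / \<omega>)\<^sup>2"
      unfolding sv_eq using \<omega> st sd(1) by (simp add: power_divide power_mult_distrib power2_commute)
    finally have "spread a x = exp (- ((x - m) / \<omega>)\<^sup>2 / 2)" by (simp add: spread_def)
    then show ?thesis unfolding normal_density_std[OF \<omega>] std_normal_density_def using \<omega> by simp
  qed
  then have sp: "spread a = (\<lambda>x. sqrt (2 * pi) * \<omega> * normal_density m \<omega> x)" by auto
  have "(LBINT x. f x * spread a x) \<le> (LBINT x. 1 / sd * (sqrt (2 * pi) * \<omega> * normal_density m \<omega> x))"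
  proof (rule integral_mono[OF int])
    show "f x * spread a x \<le> 1 / sd * (sqrt (2 * pi) * \<omega> * normal_density m \<omega> x)" for x
      unfolding sp f_def using \<omega> by (intro mult_right_mono normal_density_le_inverse sd(1)) auto
  qed (use \<omega> in simp)
  also have "\<dots> = 1 / sd * (sqrt (2 * pi) * \<omega>)" using \<omega> by simp
  also have "\<dots> = sqrt (2 * pi) * se / st" using sd(1) by (simp add: \<omega>_def)
  finally show "(LBINT x. f x * spread a x) \<le> sqrt (2 * pi) * se / st" .
qed

lemma f_integrable:
  "w \<in> borel_measurable borel \<Longrightarrow> (\<And>x. \<bar>w x\<bar> \<le> B) \<Longrightarrow> integrable lborel (\<lambda>x. f x * w x)"
  unfolding f_def by (rule integrable_normal_density_mult[OF sd(1)])

text \<open>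
  Below \<open>p - \<delta>\<close> the obedience constraint forces \<open>R \<ge> \<delta>\<close>, so there the margin \<open>p - R\<close> is at most
  \<open>R * (p - R) / \<delta>\<close>, which is a posterior variance and hence concentrates near the interval endpoints.
\<close>
lemma full_refund_profit_le:
  assumes feas: "obedient (r, c)" and full: "full_refund_or_nothing p l r" and \<delta>: "\<delta> > 0"
  shows "profit r c \<le> base_profit + p * \<delta> / sd + p\<^sup>2 * (2 * real l * (sqrt (2 * pi) * se / st)) / \<delta>"
proof -
  have r: "r \<in> policies" using feas feasible_iff by blast
  note [measurable] = R_measurable[OF r]
  obtain w w' where w: "\<And>x. R r x * (p - R r x) \<le> p\<^sup>2 * (\<Sum>j=1..l. spread (w j) x + spread (w' j) x)"
    using full_refund_variance[OF r full] by blast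
  \<comment> \<open>Three parts dominate the profit: the no-reward sales above \<open>p\<close>, the
    window \<open>{p-\<delta>..p}\<close> charged at the full price, and the variance bound for
    everything below the window.\<close>
  define B where "B x = p * (f x * indicator {p<..} x) + p * (f x * indicator {p-\<delta>..p} x) +
    p\<^sup>2 / \<delta> * (\<Sum>j=1..l. f x * spread (w j) x + f x * spread (w' j) x)" for x
  have i1: "integrable lborel (\<lambda>x. f x * indicator S x)" if "S \<in> sets borel" for S
    by (rule f_integrable[where B = 1]) (use that in auto)
  have i2: "integrable lborel (\<lambda>x. \<Sum>j=1..l. f x * spread (w j) x + f x * spread (w' j) x)"
    by (intro Bochner_Integration.integrable_sum Bochner_Integration.integrable_add spread_integral)
  have "profit r c \<le> (LBINT x. B x)"
    unfolding profit_eq_valuation[OF r]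
  proof (rule integral_mono)
    show "integrable lborel (\<lambda>x. f x * ((p - R r x) * indicator {c<..} x))"
      by (rule f_integrable[where B = p]) (use R_range[OF r] p in \<open>auto simp: indicator_def\<close>)
    show "integrable lborel B"
      unfolding B_def by (intro Bochner_Integration.integrable_add integrable_mult_right i1 i2) auto
    fix x
    have nn: "0 \<le> p * (f x * indicator {p<..} x)" "0 \<le> p * (f x * indicator {p-\<delta>..p} x)"
      using p f_pos[of x] by auto
    have nn3: "0 \<le> p\<^sup>2 / \<delta> * (\<Sum>j=1..l. f x * spread (w j) x + f x * spread (w' j) x)"
      using \<delta> f_pos[of x] by (intro mult_nonneg_nonneg sum_nonneg add_nonneg_nonneg) (auto simp: spread_def less_imp_le)
    have fp: "f x * (p - R r x) \<le> p * f x"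
      using mult_left_mono[of "p - R r x" p "f x"] R_range[OF r, of x] f_pos[of x] by (simp add: mult.commute)
    consider "x \<le> c" | "x > c" "x \<ge> p - \<delta>" | "x > c" "x < p - \<delta>" by linarith
    then show "f x * ((p - R r x) * indicator {c<..} x) \<le> B x"
    proof cases
      case 1
      then show ?thesis using nn nn3 by (simp add: B_def)
    next
      case 2
      have "p * f x \<le> p * (f x * indicator {p<..} x) + p * (f x * indicator {p-\<delta>..p} x)"
        using 2 p f_pos[of x] by (auto simp: indicator_def)
      then show ?thesis using nn3 fp 2 unfolding B_def by simp
    next
      case 3
      have "surplus r x \<ge> 0" using feas 3(1) unfolding feasible_iff by simp
      then have "R r x \<ge> \<delta>" using 3(2) by (simp add: surplus_def)
      then have "(p - R r x) * \<delta> \<le> (p - R r x) * R r x" using R_range[OF r, of x] by (intro mult_left_mono) auto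
      also have "\<dots> \<le> p\<^sup>2 * (\<Sum>j=1..l. spread (w j) x + spread (w' j) x)" using w[of x] by (simp add: mult.commute)
      finally have "p - R r x \<le> p\<^sup>2 / \<delta> * (\<Sum>j=1..l. spread (w j) x + spread (w' j) x)"
        using \<delta> by (simp add: field_simps)
      then have "f x * (p - R r x) \<le> f x * (p\<^sup>2 / \<delta> * (\<Sum>j=1..l. spread (w j) x + spread (w' j) x))"
        using f_pos[of x] by (intro mult_left_mono) auto
      also have "\<dots> = p\<^sup>2 / \<delta> * (\<Sum>j=1..l. f x * spread (w j) x + f x * spread (w' j) x)"
        by (simp add: sum_distrib_left algebra_simps)
      finally show ?thesis using nn 3 unfolding B_def by simp
    qed
  qed
  also have "(LBINT x. B x) = p * (LBINT x. f x * indicator {p<..} x) + p * (LBINT x. f x * indicator {p-\<delta>..p} x)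
     + p\<^sup>2 / \<delta> * (\<Sum>j=1..l. (LBINT x. f x * spread (w j) x) + (LBINT x. f x * spread (w' j) x))"
    unfolding B_def using i1[of "{p<..}"] i1[of "{p-\<delta>..p}"] i2 spread_integral(1)
    by (simp add: Bochner_Integration.integral_sum)
  also have "\<dots> \<le> base_profit + p * (\<delta> / sd) + p\<^sup>2 / \<delta> * (\<Sum>j=1..l. sqrt (2 * pi) * se / st + sqrt (2 * pi) * se / st)"
  proof (intro add_mono mult_left_mono sum_mono spread_integral(2))
    show "p * (LBINT x. f x * indicator {p<..} x) \<le> base_profit"
      by (simp add: no_reward_profit_def f_def normal_upper_tail[OF sd(1)])
    have "(LBINT x. f x * indicator {p-\<delta>..p} x) \<le> (LBINT x. 1 / sd * indicator {p-\<delta>..p} x)"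
    proof (rule integral_mono)
      show "f x * indicator {p-\<delta>..p} x \<le> 1 / sd * indicator {p-\<delta>..p} x" for x
        unfolding f_def by (intro mult_right_mono normal_density_le_inverse sd(1)) auto
      show "integrable lborel (\<lambda>x. 1 / sd * indicator {p-\<delta>..p} x)"
        by (intro integrable_mult_right integrable_real_indicator) (use \<delta> in auto)
    qed (use i1 in auto)
    also have "\<dots> = \<delta> / sd" using \<delta> by simp
    finally show "(LBINT x. f x * indicator {p-\<delta>..p} x) \<le> \<delta> / sd" .
  qed (use p \<delta> in auto)
  also have "\<dots> = base_profit + p * \<delta> / sd + p\<^sup>2 * (2 * real l * (sqrt (2 * pi) * se / st)) / \<delta>"
    by (simp add: mult_ac)
  finally show ?thesis .
qed

text \<open>
  The refund \<open>p + \<eta> - v\<close>, clipped to \<open>[0, p]\<close>, is 1-Lipschitz, so the buyers' surplus is monotone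
  in the valuation; for small noise it makes nearly every buyer with a valuation above \<open>\<eta>\<close> buy.
\<close>
lemma profitable_program:
  defines "P \<equiv> Phi ((\<theta> - p / 2) / sd) - Phi ((\<theta> - p) / sd)"
  defines "\<eta> \<equiv> p * P / 4"
  assumes small: "se\<^sup>2 / sd\<^sup>2 * \<bar>\<eta> - \<theta>\<bar> + se < \<eta>"
  shows "\<exists>r c. obedient (r, c) \<and> base_profit + p * P / 4 - (se\<^sup>2 / sd + se) \<le> profit r c"
proof -
  \<comment> \<open>The margin the seller keeps at quality \<open>v\<close>: nothing up to
    \<open>\<eta>\<close>, and the full price from \<open>p + \<eta>\<close> on.\<close>
  define u where "u v = min p (max 0 (v - \<eta>))" for v
  define r where "r v = p - u v" for v
  have P1: "P \<le> 1" using Phi_le_1[of "(\<theta> - p / 2) / sd"] Phi_nonneg[of "(\<theta> - p) / sd"] unfolding P_def by linarith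
  have \<eta>: "\<eta> > 0"
  proof -
    have "se\<^sup>2 / sd\<^sup>2 * \<bar>\<eta> - \<theta>\<bar> + se > 0" using se by (intro add_nonneg_pos) auto
    then show ?thesis using small by linarith
  qed
  have \<eta>p: "\<eta> \<le> p / 4" using P1 p by (simp add: \<eta>_def mult_left_le)
  have [measurable]: "u \<in> borel_measurable borel" "r \<in> borel_measurable borel" unfolding u_def r_def by measurable
  have r: "r \<in> policies" using p by (auto simp: policies_def) (auto simp: r_def u_def)
  have lip: "\<bar>r v - r x\<bar> \<le> \<bar>v - x\<bar>" for v x by (auto simp: r_def u_def min_def max_def)
  define \<tau> where "\<tau> = st\<^sup>2 / (se\<^sup>2 + st\<^sup>2)"
  have \<tau>: "0 \<le> \<tau>" "\<tau> \<le> 1" "1 - \<tau> = se\<^sup>2 / sd\<^sup>2"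
  proof -
    have "1 = (se\<^sup>2 + st\<^sup>2) / (se\<^sup>2 + st\<^sup>2)" using ss(1) by (metis divide_self less_irrefl)
    also have "\<dots> = se\<^sup>2 / (se\<^sup>2 + st\<^sup>2) + \<tau>" unfolding \<tau>_def by (rule add_divide_distrib)
    finally show "1 - \<tau> = se\<^sup>2 / sd\<^sup>2" by (simp add: sd(2) add.commute)
    then have "1 - \<tau> \<ge> 0" by simp
    then show "\<tau> \<le> 1" by simp
  qed (simp add: \<tau>_def)
  have pm: "pm x = \<tau> * x + (1 - \<tau>) * \<theta>" for x by (simp add: pm_def \<tau>_def)
  have mono: "surplus r x \<le> surplus r y" if "x \<le> y" for x y
  proof -
    \<comment> \<open>Both posteriors are images of the same standard normal \<open>z\<close>. Under
      this coupling monotonicity reduces to the Lipschitz bound, as the posterior mean moves by at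
      most \<open>y - x\<close>.\<close>
    have i: "integrable lborel (\<lambda>z. phi z * r (pm x + sv * z))" for x
      by (rule integrable_normal_density_mult[where B = p]) (use policiesD(4)[OF r] in auto)
    have "R r x - R r y = (LBINT z. phi z * r (pm x + sv * z) - phi z * r (pm y + sv * z))"
      unfolding R_def integral_normal_density_affine[OF sv(1)] using i by simp
    also have "\<dots> \<le> (LBINT z. (y - x) * phi z)"
    proof (rule integral_mono)
      fix z
      have "r (pm x + sv * z) - r (pm y + sv * z) \<le> \<bar>pm x - pm y\<bar>"
        using lip[of "pm x + sv * z" "pm y + sv * z"] by simp
      also have "pm x - pm y = \<tau> * (x - y)" by (simp add: pm algebra_simps)
      also have "\<bar>\<tau> * (x - y)\<bar> \<le> y - x" using \<tau> that by (simp add: abs_mult mult_left_le_one_le)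
      finally have "phi z * (r (pm x + sv * z) - r (pm y + sv * z)) \<le> phi z * (y - x)"
        by (intro mult_left_mono) auto
      then show "phi z * r (pm x + sv * z) - phi z * r (pm y + sv * z) \<le> (y - x) * phi z"
        by (simp add: algebra_simps)
    qed (use i in auto)
    finally show ?thesis by (simp add: surplus_def)
  qed
  \<comment> \<open>Two sources of error: the posterior mean shifts \<open>x\<close> towards
    \<open>\<theta>\<close> by the fraction \<open>1 - \<tau>\<close> of their distance, and the
    posterior has standard deviation \<open>sv \<le> se\<close>.\<close>
  define err where "err x = se\<^sup>2 / sd\<^sup>2 * \<bar>x - \<theta>\<bar> + se" for x
  have sv_le: "sv \<le> se"
  proof (rule power2_le_imp_le)
    have "se\<^sup>2 * (st\<^sup>2 / (se\<^sup>2 + st\<^sup>2)) \<le> se\<^sup>2 * 1" using \<tau>(2) unfolding \<tau>_def by (intro mult_left_mono) auto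
    then show "sv\<^sup>2 \<le> se\<^sup>2" unfolding sv by simp
  qed (use se in simp)
  have close: "\<bar>R r x - r x\<bar> \<le> err x" for x
  proof -
    have "R r x - r x = (LBINT v. post x v * r v - r x * post x v)"
      using R_integrable[OF r, of x] sv(1) by (simp add: R_def)
    then have "\<bar>R r x - r x\<bar> \<le> (LBINT v. \<bar>post x v * r v - r x * post x v\<bar>)"
      using integral_abs_bound[of lborel "\<lambda>v. post x v * r v - r x * post x v"] by simp
    also have "\<dots> \<le> (LBINT v. post x v * \<bar>v - pm x\<bar> + \<bar>pm x - x\<bar> * post x v)"
    proof (rule integral_mono)
      fix v
      have "post x v * \<bar>r v - r x\<bar> \<le> post x v * (\<bar>v - pm x\<bar> + \<bar>pm x - x\<bar>)"
        using lip[of v x] by (intro mult_left_mono) auto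
      moreover have eq: "post x v * r v - r x * post x v = post x v * (r v - r x)"
        by (simp add: algebra_simps)
      ultimately show "\<bar>post x v * r v - r x * post x v\<bar>
          \<le> post x v * \<bar>v - pm x\<bar> + \<bar>pm x - x\<bar> * post x v"
        unfolding eq abs_mult by (simp add: distrib_left mult.commute)
    qed (use R_integrable[OF r, of x] normal_abs_deviation[OF sv(1)] sv(1) in auto)
    also have "\<dots> \<le> sv + \<bar>pm x - x\<bar>"
      using normal_abs_deviation[OF sv(1), of "pm x"] sv(1) by simp
    also have "pm x - x = (1 - \<tau>) * (\<theta> - x)" by (simp add: pm algebra_simps)
    also have "\<bar>(1 - \<tau>) * (\<theta> - x)\<bar> = se\<^sup>2 / sd\<^sup>2 * \<bar>x - \<theta>\<bar>" unfolding \<tau>(3) by (simp add: abs_mult abs_minus_commute)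
    finally show ?thesis using sv_le by (simp add: err_def)
  qed
  have "\<exists>c\<ge>0. c \<le> p \<and> surplus r c = 0"
  proof (rule IVT')
    show "surplus r 0 \<le> 0" "0 \<le> surplus r p" using R_range[OF r] by (auto simp: surplus_def)
    show "continuous_on {0..p} (surplus r)"
      by (intro continuous_at_imp_continuous_on ballI isCont_surplus r)
  qed (use p in simp)
  then obtain c where c: "surplus r c = 0" by blast
  have feas: "obedient (r, c)"
    unfolding feasible_iff using r mono[of c] mono[of _ c] c by auto
  \<comment> \<open>At \<open>\<eta>\<close> the refund is full, so the surplus is at least
    \<open>\<eta> - err \<eta>\<close>, which is positive by \<open>small\<close>.\<close>
  have "surplus r \<eta> > 0"
  proof -
    have "r \<eta> = p" using p by (simp add: r_def u_def)
    then show ?thesis using close[of \<eta>] small by (simp add: surplus_def err_def abs_le_iff)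
  qed
  then have c\<eta>: "c \<le> \<eta>" using mono[of \<eta> c] c by linarith
  note [measurable] = R_measurable[OF r]
  have i1: "integrable lborel (\<lambda>x. f x * indicator S x)" if "S \<in> sets borel" for S
    by (rule f_integrable[where B = 1]) (use that in auto)
  have ierr: "integrable lborel (\<lambda>x. f x * err x)" "(LBINT x. f x * err x) \<le> se\<^sup>2 / sd + se"
  proof -
    have eq: "f x * err x = se\<^sup>2 / sd\<^sup>2 * (f x * \<bar>x - \<theta>\<bar>) + se * f x" for x by (simp add: err_def algebra_simps)
    have i: "integrable lborel (\<lambda>x. f x * \<bar>x - \<theta>\<bar>)" "integrable lborel f"
      unfolding f_def using normal_abs_deviation[OF sd(1)] sd(1) by auto
    show "integrable lborel (\<lambda>x. f x * err x)" unfolding eq using i by simp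
    have "(LBINT x. f x * err x) = se\<^sup>2 / sd\<^sup>2 * (LBINT x. f x * \<bar>x - \<theta>\<bar>) + se * (LBINT x. f x)"
      unfolding eq using i by simp
    also have "\<dots> \<le> se\<^sup>2 / sd\<^sup>2 * sd + se * 1"
      unfolding f_def using normal_abs_deviation(2)[OF sd(1), of \<theta>] sd(1) se
      by (intro add_mono mult_left_mono) auto
    also have "\<dots> = se\<^sup>2 / sd + se" using sd(1) by (simp add: power2_eq_square)
    finally show "(LBINT x. f x * err x) \<le> se\<^sup>2 / sd + se" .
  qed
  \<comment> \<open>Valuations in \<open>(p / 2, p]\<close> keep a margin of at least
    \<open>p / 2 - \<eta>\<close> and those above \<open>p\<close> at least
    \<open>p - \<eta>\<close>, up to the error \<open>err\<close>.\<close>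
  define b where "b x = (p / 2 - \<eta>) * (f x * indicator {p/2<..} x - f x * indicator {p<..} x) + (p - \<eta>) * (f x * indicator {p<..} x) - f x * err x" for x
  have "(LBINT x. b x) \<le> profit r c"
    unfolding profit_eq_valuation[OF r]
  proof (rule integral_mono)
    show "integrable lborel b"
      unfolding b_def by (intro Bochner_Integration.integrable_add Bochner_Integration.integrable_diff integrable_mult_right i1 ierr) auto
    show "integrable lborel (\<lambda>x. f x * ((p - R r x) * indicator {c<..} x))"
      by (rule f_integrable[where B = p]) (use R_range[OF r] p in \<open>auto simp: indicator_def\<close>)
    fix x
    have e0: "err x \<ge> 0" using se by (simp add: err_def)
    define b' where "b' = (p / 2 - \<eta>) * (indicator {p/2<..} x - indicator {p<..} x) + (p - \<eta>) * indicator {p<..} x - err x"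
    have bb: "b x = f x * b'" by (simp add: b_def b'_def algebra_simps)
    have "b' \<le> (p - R r x) * indicator {c<..} x"
    proof (cases "x > p / 2")
      case True
      then have "x > c" using c\<eta> \<eta>p p by linarith
      moreover have "p - R r x \<ge> u x - err x" using close[of x] by (simp add: r_def abs_le_iff)
      moreover have "(p / 2 - \<eta>) * (indicator {p/2<..} x - indicator {p<..} x) + (p - \<eta>) * indicator {p<..} x \<le> u x"
        using True \<eta> \<eta>p p by (auto simp: u_def indicator_def)
      ultimately show ?thesis by (simp add: b'_def)
    next
      case False
      then have "b' \<le> 0" using e0 p by (simp add: b'_def)
      also have "0 \<le> (p - R r x) * indicator {c<..} x" using R_range[OF r, of x] by simp
      finally show ?thesis .
    qed
    then show "b x \<le> f x * ((p - R r x) * indicator {c<..} x)"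
      unfolding bb using f_pos[of x] by (intro mult_left_mono) auto
  qed
  moreover have "(LBINT x. b x) = (p / 2 - \<eta>) * P + (p - \<eta>) * Phi ((\<theta> - p) / sd) - (LBINT x. f x * err x)"
    unfolding b_def P_def using i1[of "{p/2<..}"] i1[of "{p<..}"] ierr(1)
    by (simp add: f_def normal_upper_tail[OF sd(1)])
  moreover have "(p / 2 - \<eta>) * P + (p - \<eta>) * Phi ((\<theta> - p) / sd) \<ge> base_profit + p * P / 4"
  proof -
    \<comment> \<open>\<open>P\<close> is the mass of the valuations between \<open>p / 2\<close>
      and \<open>p\<close>. They bring \<open>p * P / 2\<close>, and the reduction of all margins by
      \<open>\<eta>\<close> costs at most \<open>\<eta>\<close> in total;
      \<open>\<eta> = p * P / 4\<close> keeps half of the gain.\<close>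
    have "\<eta> * (P + Phi ((\<theta> - p) / sd)) \<le> \<eta> * 1" using \<eta> by (intro mult_left_mono) (auto simp: P_def)
    then show ?thesis by (simp add: no_reward_profit_def \<eta>_def algebra_simps)
  qed
  ultimately have "base_profit + p * P / 4 - (se\<^sup>2 / sd + se) \<le> profit r c"
    using ierr(2) by linarith
  then show ?thesis using feas by blast
qed

end

section \<open>Limits as the noise vanishes while the total uncertainty is fixed\<close>

lemma full_refund_or_nothing_zero: "full_refund_or_nothing p l (\<lambda>v. 0)"
proof -
  \<comment> \<open>The one-point intervals at \<open>1, ..., l\<close> are disjoint and null. The
    zero rebate therefore belongs to the class for every \<open>l\<close>, which makes the no-reward
    profit a lower bound there.\<close>
  have "AE v in lborel. v \<notin> real ` {1..l}"
    by (rule AE_not_in[OF finite_imp_null_set_lborel]) simp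
  then have "AE v in lborel. (0::real) = p * (\<Sum>j=1..l. indicator {v. ereal (real j) \<le> ereal v \<and> v \<le> real j} v)"
  proof eventually_elim
    case (elim v)
    have "(\<Sum>j=1..l. indicator {v. ereal (real j) \<le> ereal v \<and> v \<le> real j} v :: real) = 0"
      using elim by (intro sum.neutral ballI) (auto simp: indicator_def)
    then show ?case by simp
  qed
  then show ?thesis
    unfolding full_refund_or_nothing_def
    by (intro exI[of _ "\<lambda>j. ereal (real j)"] exI[of _ real]) auto
qed

lemma prior_sd:
  assumes "0 < s" "s < \<sigma>"
  shows "prior_sd \<sigma> s > 0" "sqrt ((prior_sd \<sigma> s)\<^sup>2 + s\<^sup>2) = \<sigma>" "s \<le> \<sigma> / 2 \<Longrightarrow> \<sigma> / 2 \<le> prior_sd \<sigma> s"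
proof -
  have "s\<^sup>2 < \<sigma>\<^sup>2" using assms by (intro power_strict_mono) auto
  then show "prior_sd \<sigma> s > 0" "sqrt ((prior_sd \<sigma> s)\<^sup>2 + s\<^sup>2) = \<sigma>"
    using assms by (simp_all add: prior_sd_def)
  show "\<sigma> / 2 \<le> prior_sd \<sigma> s" if "s \<le> \<sigma> / 2"
    unfolding prior_sd_def
  proof (rule real_le_rsqrt)
    have "s\<^sup>2 \<le> (\<sigma> / 2)\<^sup>2" using assms that by (intro power_mono) auto
    moreover have "(\<sigma> / 2)\<^sup>2 = \<sigma>\<^sup>2 / 4" by (simp add: power_divide)
    ultimately show "(\<sigma> / 2)\<^sup>2 \<le> \<sigma>\<^sup>2 - s\<^sup>2" using zero_le_power2[of \<sigma>] by linarith
  qed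
qed

lemma eventually_less_at_right_0: "(0::real) < a \<Longrightarrow> \<forall>\<^sub>F s in at_right 0. s < a"
  using eventually_at_right_real[of 0 a] by (auto elim: eventually_mono)

context
  fixes \<theta> \<sigma> p :: real
begin

abbreviation "profit_at s \<equiv> expected_profit \<theta> (prior_sd \<sigma> s) s p"
abbreviation "refunds_at s l \<equiv> feasible_full_refund \<theta> (prior_sd \<sigma> s) s p l"
abbreviation "optimal_at s \<equiv> optimal_program \<theta> (prior_sd \<sigma> s) s p"
abbreviation "base \<equiv> no_reward_profit \<theta> \<sigma> p"

text \<open>For \<open>s \<le> \<sigma> / 2\<close> the prior deviation is at least
  \<open>\<sigma> / 2\<close>, so the bound depends on the noise only through
  \<open>l * s\<close>.\<close>

lemma full_refund_profit_le_uniform: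
  assumes s: "0 < s" "s \<le> \<sigma> / 2" and p: "p > 0" and \<delta>: "\<delta> > 0"
    and feas: "refunds_at s l rc"
  shows "profit_at s rc \<le>
    base + p * \<delta> / \<sigma> + p\<^sup>2 * (2 * real l * (sqrt (2 * pi) * s / (\<sigma> / 2))) / \<delta>"
proof -
  have \<sigma>: "\<sigma> > 0" "s < \<sigma>" using s by linarith+
  note psd = prior_sd[OF s(1) \<sigma>(2)]
  interpret signal \<theta> "prior_sd \<sigma> s" s p by unfold_locales (use psd s p in auto)
  have sd: "sd = \<sigma>" using psd(2) by (simp add: sd_def)
  obtain r c where rc: "rc = (r, c)" by force
  have "sqrt (2 * pi) * s / prior_sd \<sigma> s \<le> sqrt (2 * pi) * s / (\<sigma> / 2)"
    using psd(1) psd(3)[OF s(2)] \<sigma> s by (intro divide_left_mono mult_nonneg_nonneg mult_pos_pos) auto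
  then have "p\<^sup>2 * (2 * real l * (sqrt (2 * pi) * s / prior_sd \<sigma> s)) / \<delta> \<le>
      p\<^sup>2 * (2 * real l * (sqrt (2 * pi) * s / (\<sigma> / 2))) / \<delta>"
    using \<delta> by (intro divide_right_mono mult_left_mono) auto
  moreover have "profit r c \<le> no_reward_profit \<theta> sd p + p * \<delta> / sd +
      p\<^sup>2 * (2 * real l * (sqrt (2 * pi) * s / prior_sd \<sigma> s)) / \<delta>"
    using feas \<delta> unfolding feasible_full_refund_def rc by (intro full_refund_profit_le) auto
  ultimately show ?thesis unfolding rc sd profit_def by linarith
qed

lemma no_reward_full_refund:
  assumes s: "0 < s" "s < \<sigma>" and p: "p > 0"
  shows "refunds_at s l (\<lambda>v. 0, p)"
    and "profit_at s (\<lambda>v. 0, p) = base"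
proof -
  note psd = prior_sd[OF s]
  interpret signal \<theta> "prior_sd \<sigma> s" s p by unfold_locales (use psd s p in auto)
  have sd: "sd = \<sigma>" using psd(2) by (simp add: sd_def)
  show "refunds_at s l (\<lambda>v. 0, p)"
    unfolding feasible_full_refund_def using no_reward_feasible full_refund_or_nothing_zero by simp
  show "profit_at s (\<lambda>v. 0, p) = base"
    using no_reward_profit_eq unfolding profit_def sd .
qed

lemma full_refund_profit_limit:
  assumes \<sigma>: "\<sigma> > 0" and p: "p > 0" and \<epsilon>: "\<epsilon> > 0"
  shows "\<forall>\<^sub>F s in at_right 0. \<forall>rc. refunds_at s l rc \<longrightarrow>
    profit_at s rc < base + \<epsilon>"
proof -
  \<comment> \<open>Charges \<open>\<epsilon> / 2\<close> to the window; with \<open>l\<close>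
    fixed, the other term tends to 0 with \<open>s\<close>.\<close>
  define \<delta> where "\<delta> = \<epsilon> * \<sigma> / (2 * p)"
  have \<delta>: "\<delta> > 0" "p * \<delta> / \<sigma> = \<epsilon> / 2" using \<sigma> p \<epsilon> by (auto simp: \<delta>_def)
  have "((\<lambda>s. p\<^sup>2 * (2 * real l * (sqrt (2 * pi) * s / (\<sigma> / 2))) / \<delta>) \<longlongrightarrow>
      p\<^sup>2 * (2 * real l * (sqrt (2 * pi) * 0 / (\<sigma> / 2))) / \<delta>) (at_right 0)"
    using \<sigma> \<delta> by (intro tendsto_intros) auto
  then have "\<forall>\<^sub>F s in at_right 0. p\<^sup>2 * (2 * real l * (sqrt (2 * pi) * s / (\<sigma> / 2))) / \<delta> < \<epsilon> / 2"
    using \<epsilon> by (intro order_tendstoD(2)) auto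
  moreover have "\<forall>\<^sub>F s in at_right 0. s < \<sigma> / 2" "\<forall>\<^sub>F s in at_right (0::real). 0 < s"
    by (rule eventually_less_at_right_0, use \<sigma> in simp) (rule eventually_at_right_less)
  ultimately show ?thesis
  proof eventually_elim
    case (elim s)
    show ?case
    proof (intro allI impI)
      fix rc assume "refunds_at s l rc"
      from full_refund_profit_le_uniform[OF elim(3) less_imp_le[OF elim(2)] p \<delta>(1) this]
      have "profit_at s rc \<le> base + \<epsilon> / 2 +
          p\<^sup>2 * (2 * real l * (sqrt (2 * pi) * s / (\<sigma> / 2))) / \<delta>"
        unfolding \<delta>(2) .
      also have "\<dots> < base + \<epsilon> / 2 + \<epsilon> / 2"
        by (intro add_strict_left_mono elim(1))
      finally show "profit_at s rc < base + \<epsilon>" by simp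
    qed
  qed
qed

text \<open>\<open>P\<close>, and with it \<open>\<eta>\<close>, depends on \<open>\<theta>\<close>,
  \<open>\<sigma>\<close> and \<open>p\<close> only, while the errors of
  \<open>profitable_program\<close> vanish with \<open>s\<close>; once they are below
  \<open>\<eta> / 2\<close>, half of the gain remains.\<close>

lemma optimal_profit_gap:
  assumes \<sigma>: "\<sigma> > 0" and p: "p > 0"
  obtains \<Delta> where "\<Delta> > 0" "\<forall>\<^sub>F s in at_right 0. \<forall>rc. optimal_at s rc \<longrightarrow>
    base + \<Delta> \<le> profit_at s rc"
proof -
  define P where "P = Phi ((\<theta> - p / 2) / \<sigma>) - Phi ((\<theta> - p) / \<sigma>)"
  have P: "P > 0" unfolding P_def using \<sigma> p by (simp add: Phi_strict_mono divide_strict_right_mono)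
  define \<eta> where "\<eta> = p * P / 4"
  have \<eta>: "\<eta> > 0" using p P by (simp add: \<eta>_def)
  have "((\<lambda>s. s\<^sup>2 / \<sigma>\<^sup>2 * \<bar>\<eta> - \<theta>\<bar> + s) \<longlongrightarrow> 0\<^sup>2 / \<sigma>\<^sup>2 * \<bar>\<eta> - \<theta>\<bar> + 0) (at_right 0)"
    using \<sigma> by (intro tendsto_intros) auto
  then have 1: "\<forall>\<^sub>F s in at_right 0. s\<^sup>2 / \<sigma>\<^sup>2 * \<bar>\<eta> - \<theta>\<bar> + s < \<eta>"
    using \<eta> by (intro order_tendstoD(2)) auto
  have "((\<lambda>s. s\<^sup>2 / \<sigma> + s) \<longlongrightarrow> 0\<^sup>2 / \<sigma> + 0) (at_right 0)"
    using \<sigma> by (intro tendsto_intros) auto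
  then have 2: "\<forall>\<^sub>F s in at_right 0. s\<^sup>2 / \<sigma> + s < \<eta> / 2"
    using \<eta> by (intro order_tendstoD(2)) auto
  have 3: "\<forall>\<^sub>F s in at_right 0. s < \<sigma>" "\<forall>\<^sub>F s in at_right (0::real). 0 < s"
    by (rule eventually_less_at_right_0, use \<sigma> in simp) (rule eventually_at_right_less)
  have "\<forall>\<^sub>F s in at_right 0. \<forall>rc. optimal_at s rc \<longrightarrow>
    base + \<eta> / 2 \<le> profit_at s rc"
    using 1 2 3
  proof eventually_elim
    case (elim s)
    note psd = prior_sd[OF elim(4,3)]
    interpret signal \<theta> "prior_sd \<sigma> s" s p by unfold_locales (use psd elim p in auto)
    have sd: "sd = \<sigma>" using psd(2) by (simp add: sd_def)
    obtain r c where rc: "feasible \<theta> (prior_sd \<sigma> s) s p (r, c)"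
      "base + \<eta> - (s\<^sup>2 / \<sigma> + s) \<le> profit r c"
      using profitable_program elim(1) unfolding sd P_def[symmetric] \<eta>_def[symmetric] by blast
    show ?case
    proof (intro allI impI)
      fix rc' assume opt: "optimal_at s rc'"
      obtain r' c' where rc': "rc' = (r', c')" by force
      have "profit r c \<le> profit r' c'" using opt rc(1) unfolding rc' optimal_iff by blast
      then show "base + \<eta> / 2 \<le> profit_at s rc'"
        using rc(2) elim(2) unfolding rc' profit_def by linarith
    qed
  qed
  then show ?thesis using that[of "\<eta> / 2"] \<eta> by simp
qed

lemma interval_count_lower_bound:
  assumes \<sigma>: "\<sigma> > 0" and p: "p > 0"
    and opt: "\<And>s. s \<in> {0<..<\<sigma>} \<Longrightarrow> optimal_at s (r s, c s) \<and> full_refund_or_nothing p (l s) (r s)"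
  obtains \<kappa> where "\<kappa> > 0" "\<forall>\<^sub>F s in at_right 0. \<kappa> / s \<le> real (l s)"
proof -
  obtain \<Delta> where \<Delta>: "\<Delta> > 0" "\<forall>\<^sub>F s in at_right 0. \<forall>rc. optimal_at s rc \<longrightarrow>
    base + \<Delta> \<le> profit_at s rc"
    using optimal_profit_gap[OF \<sigma> p] by blast
  \<comment> \<open>Half of the gap \<open>\<Delta>\<close> is spent on the window, so
    \<open>K * s * real (l s)\<close> has to cover the other half.\<close>
  define \<delta> where "\<delta> = \<Delta> * \<sigma> / (2 * p)"
  have \<delta>: "\<delta> > 0" "p * \<delta> / \<sigma> = \<Delta> / 2" using \<sigma> p \<Delta> by (auto simp: \<delta>_def)
  define K where "K = p\<^sup>2 * (2 * (sqrt (2 * pi) / (\<sigma> / 2))) / \<delta>"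
  have K: "K > 0" using \<sigma> p \<delta> by (simp add: K_def)
  have 3: "\<forall>\<^sub>F s in at_right 0. s < \<sigma> / 2" "\<forall>\<^sub>F s in at_right (0::real). 0 < s"
    by (rule eventually_less_at_right_0, use \<sigma> in simp) (rule eventually_at_right_less)
  have "\<forall>\<^sub>F s in at_right 0. \<Delta> / (2 * K) / s \<le> real (l s)"
    using \<Delta>(2) 3
  proof eventually_elim
    case (elim s)
    have s: "s \<in> {0<..<\<sigma>}" using elim \<sigma> by auto
    have "refunds_at s (l s) (r s, c s)"
      using opt[OF s] by (auto simp: feasible_full_refund_def optimal_program_def is_arg_max_def)
    from full_refund_profit_le_uniform[OF elim(3) less_imp_le[OF elim(2)] p \<delta>(1) this]
    have "profit_at s (r s, c s) \<le> base + \<Delta> / 2 + K * s * real (l s)"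
      unfolding \<delta>(2) by (simp add: K_def mult_ac)
    moreover have "base + \<Delta> \<le> profit_at s (r s, c s)"
      using elim(1) opt[OF s] by blast
    ultimately have "\<Delta> / 2 \<le> K * s * real (l s)" by linarith
    then show ?case using K elim(3) by (simp add: field_simps)
  qed
  then show ?thesis using that[of "\<Delta> / (2 * K)"] \<Delta> K by simp
qed

end

theorem theorem1:
  fixes \<theta> \<sigma>\<^sub>\<theta> \<sigma>\<^sub>\<epsilon> \<sigma> p :: real
  assumes "\<sigma>\<^sub>\<theta> > 0" and "\<sigma>\<^sub>\<epsilon> > 0"
    and "\<sigma> = sqrt (\<sigma>\<^sub>\<theta>\<^sup>2 + \<sigma>\<^sub>\<epsilon>\<^sup>2)"
    and "market_price \<theta> \<sigma> p"
  shows "(\<exists>rc. optimal_program \<theta> \<sigma>\<^sub>\<theta> \<sigma>\<^sub>\<epsilon> p rc) \<and>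
    (\<forall>r c. optimal_program \<theta> \<sigma>\<^sub>\<theta> \<sigma>\<^sub>\<epsilon> p (r, c) \<longrightarrow> (\<exists>l. full_refund_or_nothing p l r)) \<and>
    (\<forall>(r :: real \<Rightarrow> real \<Rightarrow> real) (c :: real \<Rightarrow> real) (l :: real \<Rightarrow> nat).
       (\<forall>s\<in>{0<..<\<sigma>}. optimal_program \<theta> (prior_sd \<sigma> s) s p (r s, c s) \<and>
                     full_refund_or_nothing p (l s) (r s)) \<longrightarrow>
       filterlim l at_top (at_right 0) \<and>
       (\<lambda>s. 1 / s) \<in> O[at_right 0](\<lambda>s. real (l s)) \<and>
       (\<lambda>s. real (l s)) \<in> \<Omega>[at_right 0](\<lambda>s. 1 / s)) \<and>
    (\<forall>l. ((\<lambda>s. SUP rc\<in>Collect (feasible_full_refund \<theta> (prior_sd \<sigma> s) s p l).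
                 expected_profit \<theta> (prior_sd \<sigma> s) s p rc)
            \<longlongrightarrow> no_reward_profit \<theta> \<sigma> p) (at_right 0) \<and>
         (\<forall>\<delta>>0. \<forall>\<^sub>F s in at_right 0. \<forall>rc. optimal_full_refund \<theta> (prior_sd \<sigma> s) s p l rc \<longrightarrow>
            \<bar>expected_profit \<theta> (prior_sd \<sigma> s) s p rc - no_reward_profit \<theta> \<sigma> p\<bar> < \<delta>))"
proof -
  have p: "p > 0" using assms(4) by (simp add: market_price_def)
  have \<sigma>: "\<sigma> > 0" using assms(1-3) by (simp add: add_pos_pos)
  interpret signal \<theta> \<sigma>\<^sub>\<theta> \<sigma>\<^sub>\<epsilon> p by unfold_locales (use assms p in auto)
  have ev: "\<forall>\<^sub>F s in at_right 0. s < \<sigma>" "\<forall>\<^sub>F s in at_right (0::real). 0 < s"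
    by (rule eventually_less_at_right_0, use \<sigma> in simp) (rule eventually_at_right_less)
  show ?thesis
  proof (intro conjI allI impI)
    show "\<exists>rc. optimal_program \<theta> \<sigma>\<^sub>\<theta> \<sigma>\<^sub>\<epsilon> p rc" by (rule optimal_exists)
    show "\<exists>l. full_refund_or_nothing p l r" if "optimal_program \<theta> \<sigma>\<^sub>\<theta> \<sigma>\<^sub>\<epsilon> p (r, c)" for r c
      using that by (rule optimal_full_refund_or_nothing)
  next
    fix r :: "real \<Rightarrow> real \<Rightarrow> real" and c :: "real \<Rightarrow> real" and l :: "real \<Rightarrow> nat"
    assume "\<forall>s\<in>{0<..<\<sigma>}. optimal_program \<theta> (prior_sd \<sigma> s) s p (r s, c s) \<and> full_refund_or_nothing p (l s) (r s)"
    then obtain \<kappa> where \<kappa>: "\<kappa> > 0" "\<forall>\<^sub>F s in at_right 0. \<kappa> / s \<le> real (l s)"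
      using interval_count_lower_bound[OF \<sigma> p] by blast
    have "filterlim (\<lambda>s. \<kappa> / s) at_top (at_right 0)" using \<kappa>(1) by real_asymp
    then have "filterlim (\<lambda>s. real (l s)) at_top (at_right 0)"
      using \<kappa>(2) by (rule filterlim_at_top_mono)
    then show "filterlim l at_top (at_right 0)"
      unfolding filterlim_at_top by (metis (mono_tags, lifting) eventually_mono of_nat_le_iff)
    have "\<forall>\<^sub>F s in at_right 0. norm (1 / s) \<le> 1 / \<kappa> * norm (real (l s))"
      using \<kappa>(2) ev(2) by eventually_elim (use \<kappa>(1) in \<open>simp add: field_simps\<close>)
    then show O: "(\<lambda>s. 1 / s) \<in> O[at_right 0](\<lambda>s. real (l s))" by (rule bigoI)
    then show "(\<lambda>s. real (l s)) \<in> \<Omega>[at_right 0](\<lambda>s. 1 / s)" by (simp add: bigomega_iff_bigo)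
  next
    fix l :: nat
    let ?N = "no_reward_profit \<theta> \<sigma> p"
    show "((\<lambda>s. SUP rc\<in>Collect (feasible_full_refund \<theta> (prior_sd \<sigma> s) s p l).
                 expected_profit \<theta> (prior_sd \<sigma> s) s p rc) \<longlongrightarrow> ?N) (at_right 0)"
    proof (rule tendstoI)
      fix e :: real assume e: "e > 0"
      have "\<forall>\<^sub>F s in at_right 0. \<forall>rc. feasible_full_refund \<theta> (prior_sd \<sigma> s) s p l rc \<longrightarrow>
          expected_profit \<theta> (prior_sd \<sigma> s) s p rc < ?N + e / 2"
        using e by (intro full_refund_profit_limit \<sigma> p) simp
      then show "\<forall>\<^sub>F s in at_right 0. dist (SUP rc\<in>Collect (feasible_full_refund \<theta> (prior_sd \<sigma> s) s p l).
                 expected_profit \<theta> (prior_sd \<sigma> s) s p rc) ?N < e"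
        using ev
      proof eventually_elim
        case (elim s)
        let ?C = "Collect (feasible_full_refund \<theta> (prior_sd \<sigma> s) s p l)"
        note nr = no_reward_full_refund(1)[OF elim(3,2) p, of \<theta> l] no_reward_full_refund(2)[OF elim(3,2) p, of \<theta>]
        have ub: "expected_profit \<theta> (prior_sd \<sigma> s) s p rc \<le> ?N + e / 2" if "rc \<in> ?C" for rc
          using elim(1) that less_imp_le by blast
        \<comment> \<open>Existence of a maximiser with \<open>l\<close> intervals is not
          presupposed: the supremum is squeezed between the no-reward profit and the uniform bound,
          which also shows that the set of profits is bounded above.\<close>
        have "(SUP rc\<in>?C. expected_profit \<theta> (prior_sd \<sigma> s) s p rc) \<le> ?N + e / 2"
          using nr(1) ub by (intro cSUP_least) auto
        moreover have "?N \<le> (SUP rc\<in>?C. expected_profit \<theta> (prior_sd \<sigma> s) s p rc)"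
          unfolding nr(2)[symmetric] using nr(1) ub by (intro cSUP_upper bdd_aboveI2) auto
        ultimately show ?case using e by (simp add: dist_real_def)
      qed
    qed
    fix \<delta> :: real assume \<delta>: "\<delta> > 0"
    show "\<forall>\<^sub>F s in at_right 0. \<forall>rc. optimal_full_refund \<theta> (prior_sd \<sigma> s) s p l rc \<longrightarrow>
            \<bar>expected_profit \<theta> (prior_sd \<sigma> s) s p rc - ?N\<bar> < \<delta>"
      using full_refund_profit_limit[OF \<sigma> p \<delta>, of \<theta> l] ev
    proof eventually_elim
      case (elim s)
      show ?case
      proof (intro allI impI)
        fix rc assume opt: "optimal_full_refund \<theta> (prior_sd \<sigma> s) s p l rc"
        then have "expected_profit \<theta> (prior_sd \<sigma> s) s p rc < ?N + \<delta>"
          using elim(1) unfolding optimal_full_refund_def is_arg_max_def by blast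
        moreover have "?N \<le> expected_profit \<theta> (prior_sd \<sigma> s) s p rc"
          using opt no_reward_full_refund(1)[OF elim(3,2) p, of \<theta> l] no_reward_full_refund(2)[OF elim(3,2) p, of \<theta>]
          unfolding optimal_full_refund_def is_arg_max_linorder by metis
        ultimately show "\<bar>expected_profit \<theta> (prior_sd \<sigma> s) s p rc - ?N\<bar> < \<delta>" using \<delta> by linarith
      qed
    qed
  qed
qed

end
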